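(* Let $1\le p,q\le\infty$ and $s>Q/p$. Every $f\in B^s_{p,q}(\mathbb{H})$ satisfies $$\text{for all } h\ge s-Q/p,\qquad d_f(h)\le\min\bigl(Q,\ p(h-s+Q/p)\bigr),$$ and $d_f(h)=-\infty$ (i.e. $E_f(h)=\emptyset$) if $h<s-Q/p$.
   Context: Heisenberg group: $\mathbb{H}=\mathbb{R}^3$ with law $(p,q,r)\ast(p',q',r')=(p+p',q+q',r+r'+2(qp'-pq'))$ (also written $xy$), inverse $x^{-1}=-x$, dilations $\lambda\circ(p,q,r)=(\lambda p,\lambda q,\lambda^2r)$, homogeneous dimension $Q=4$, Haar measure $dx=$ Lebesgue measure, pseudo-norm $\|(p,q,r)\|_{\mathbb{H}}=((p^2+q^2)^2+r^2)^{1/4}$ and $\delta(x,y)=\|x^{-1}\ast y\|_{\mathbb{H}}$. Left-invariant fields: $X=\partial_p+2q\,\partial_r$, $Y=\partial_q-2p\,\partial_r$, $Z=\partial_r$. For $\alpha\in\{1,2,3\}^m$, $\nabla_{\mathbb{H}}^\alpha f=V_{\alpha_1}\cdots V_{\alpha_m}f$ with $V_1=X,V_2=Y,V_3=Z$, and $|\alpha|=\sum_i\omega(\alpha_i)$ with $\omega(1)=\omega(2)=1$, $\omega(3)=2$. $\mathcal{L}=-(X^2+Y^2)$ and $H^s(\mathbb{H})=\{u\in L^2:\mathcal{L}^{s/2}u\in L^2\}$. The homogeneous degree of a polynomial $P(p,q,r)$ is obtained by giving $p,q$ weight 1 and $r$ weight 2. Pointwise regularity: for $f\in L^\infty_{loc}(\mathbb{H})$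 and $u>0$, $f\in C^u(x_0)$ means that there are $C,\eta>0$ and a polynomial $P$ of homogeneous degree $<u$ with $|f(x_0x)-P(x)|\le C\|x\|_{\mathbb{H}}^u$ whenever $\|x\|_{\mathbb{H}}<\eta$. $h_f(x_0)=\sup\{u>0: f\in C^u(x_0)\}$, with $h_f(x_0)=0$ if there is no such $u$. $E_f(h)=\{x\in\mathbb{H}:h_f(x)=h\}$ and $d_f(h)=\dim_HE_f(h)$ for $h\in[0,\infty]$, where $\dim_H$ is the Hausdorff dimension relative to $\delta$ (coverings by gauge balls) and $\dim_H\emptyset=-\infty$. Wavelets (Lemarié): $\mathcal{Z}=\mathbb{Z}^3$, $x_{j,k}=2^{-j}\circ k$. A fixed integer $M>Q/2$ is given together with $2^Q-1=15$ functions $\vartheta_\varepsilon\in H^{4M}(\mathbb{H})$ such that: (i) for some $C_0,r_0>0$, $|\nabla_{\mathbb{H}}^\alpha\vartheta_\varepsilon(x)|\le C_0e^{-\|x\|_{\mathbb{H}}/r_0}$ for all $x$ and all $|\alpha|<4M-Q$; (ii) $\Psi_\varepsilon=\mathcal{L}^M\vartheta_\varepsilon$ satisfies $\int\Psi_\varepsilon P\,dx=0$ for every polynomial $P$ of homogeneous degree $<2M$, and $|\Psi_\varepsilon(x)|\le C_0e^{-\|x\|_{\mathbb{H}}/r_0}$; (iii) with $\Psi^\varepsilon_{j,k}(x)=\Psi_\varepsilon(2^j\circ(x_{j,k}^{-1}\ast x))$, the family $(2^{jQ/2}\Psi^\varepsilon_{j,k})$ is a Hilbert basis of $L^2(\mathbb{H})$.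 The wavelet coefficients are $d^\varepsilon_{j,k}(f)=2^{jQ}\int_{\mathbb{H}}f\,\Psi^\varepsilon_{j,k}\,dx$, and $f=\sum_{\varepsilon,j,k}d^\varepsilon_{j,k}(f)\Psi^\varepsilon_{j,k}$. Standing assumption: $M$ is chosen large with respect to $s$, namely $[s]+2<2M-Q$. Besov space: $B^s_{p,q}(\mathbb{H})$ consists of the functions $f$ on $\mathbb{H}$ such that the sequence $a_j=\bigl\|2^{j(s-Q/p)}d^\varepsilon_{j,k}(f)\bigr\|_{\ell^p(k,\varepsilon)}$ belongs to $\ell^q(j)$. *)

theory Defs
  imports "HOL-Analysis.Analysis"
begin

section \<open>The Heisenberg group\<close>

type_synonym heis = "real \<times> real \<times> real"

text \<open>Homogeneous dimension (written \<open>Q\<close>).\<close>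

abbreviation hdim :: "'a::numeral"
  where "hdim \<equiv> 4"

fun hmul :: "heis \<Rightarrow> heis \<Rightarrow> heis"  (infixl "\<star>" 70)
  where "(p, q, r) \<star> (p', q', r') = (p + p', q + q', r + r' + 2 * (q * p' - p * q'))"

definition hinv :: "heis \<Rightarrow> heis"
  where "hinv x = - x"

fun dil :: "real \<Rightarrow> heis \<Rightarrow> heis"
  where "dil l (p, q, r) = (l * p, l * q, l\<^sup>2 * r)"

fun hnorm :: "heis \<Rightarrow> real"
  where "hnorm (p, q, r) = root 4 ((p\<^sup>2 + q\<^sup>2)\<^sup>2 + r\<^sup>2)"

definition hdist :: "heis \<Rightarrow> heis \<Rightarrow> real"
  where "hdist x y = hnorm (hinv x \<star> y)"

lemma hmul_hinv: "hinv x \<star> x = 0" "x \<star> hinv x = 0"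
  by (cases x; simp add: hinv_def zero_prod_def)+

text \<open>\<open>hpoly u\<close> is the set of polynomial functions of homogeneous degree \<open>< u\<close>;
  it contains the zero polynomial.\<close>

definition hpoly :: "real \<Rightarrow> (heis \<Rightarrow> real) set"
  where "hpoly u = {P. \<exists>S c. finite S \<and> (\<forall>(a, b, d) \<in> S. real (a + b + 2 * d) < u) \<and>
     P = (\<lambda>(p, q, r). \<Sum>(a, b, d) \<in> S. c (a, b, d) * p ^ a * q ^ b * r ^ d)}"


section \<open>Differentiation along vector fields\<close>

text \<open>Derivative along a vector field \<open>W\<close>, iterated along a word of fields
  (the head of the word is applied last), and the existence of all the derivatives involved.\<close>

definition along :: "(heis \<Rightarrow> heis) \<Rightarrow> (heis \<Rightarrow> real) \<Rightarrow> heis \<Rightarrow> real"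
  where "along W f x = deriv (\<lambda>t. f (x + t *\<^sub>R W x)) 0"

primrec iter_deriv :: "('i \<Rightarrow> heis \<Rightarrow> heis) \<Rightarrow> 'i list \<Rightarrow> (heis \<Rightarrow> real) \<Rightarrow> heis \<Rightarrow> real"
  where
    "iter_deriv W [] f = f"
  | "iter_deriv W (i # w) f = along (W i) (iter_deriv W w f)"

primrec iter_differentiable :: "('i \<Rightarrow> heis \<Rightarrow> heis) \<Rightarrow> 'i list \<Rightarrow> (heis \<Rightarrow> real) \<Rightarrow> bool"
  where
    "iter_differentiable W [] f \<longleftrightarrow> True"
  | "iter_differentiable W (i # w) f \<longleftrightarrow> iter_differentiable W w f \<and>
       (\<forall>x. (\<lambda>t. iter_deriv W w f (x + t *\<^sub>R W i x)) field_differentiable (at 0))"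

datatype hdir = DX | DY | DZ

fun left_field :: "hdir \<Rightarrow> heis \<Rightarrow> heis"
  where
    "left_field DX (p, q, r) = (1, 0, 2 * q)"
  | "left_field DY (p, q, r) = (0, 1, - 2 * p)"
  | "left_field DZ (p, q, r) = (0, 0, 1)"

lemma left_field_translation:
  "x + t *\<^sub>R left_field DX x = x \<star> (t, 0, 0)"
  "x + t *\<^sub>R left_field DY x = x \<star> (0, t, 0)"
  "x + t *\<^sub>R left_field DZ x = x \<star> (0, 0, t)"
  by (cases x; simp add: algebra_simps)+

primrec dir_weight :: "hdir \<Rightarrow> nat"
  where "dir_weight DX = 1" | "dir_weight DY = 1" | "dir_weight DZ = 2"

definition word_weight :: "hdir list \<Rightarrow> nat"
  where "word_weight w = sum_list (map dir_weight w)"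

definition sublap :: "(heis \<Rightarrow> real) \<Rightarrow> heis \<Rightarrow> real"
  where "sublap f x = - (iter_deriv left_field [DX, DX] f x + iter_deriv left_field [DY, DY] f x)"

text \<open>Smoothness is meant in the usual sense: continuous iterated partial derivatives
  (constant fields from the standard basis) of all orders.\<close>

definition smooth :: "(heis \<Rightarrow> real) \<Rightarrow> bool"
  where "smooth f \<longleftrightarrow> (\<forall>w. set w \<subseteq> Basis \<longrightarrow>
     iter_differentiable (\<lambda>b _. b) w f \<and> continuous_on UNIV (iter_deriv (\<lambda>b _. b) w f))"

definition test_functions :: "(heis \<Rightarrow> real) set"
  where "test_functions = {\<phi>. smooth \<phi> \<and> compact (closure {x. \<phi> x \<noteq> 0})}"


section \<open>Square integrable functions and Sobolev spaces\<close>

definition L2 :: "(heis \<Rightarrow> real) set"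
  where "L2 = {u. u \<in> borel_measurable lebesgue \<and> integrable lebesgue (\<lambda>x. (u x)\<^sup>2)}"

text \<open>\<open>sobolev_even m\<close> is the Sobolev space of order \<open>2 * m\<close>: the functions \<open>u \<in> L2\<close>
  such that \<open>sublap ^^ m\<close> applied to \<open>u\<close> in the sense of distributions is in \<open>L2\<close>
  (\<open>sublap\<close> is formally self-adjoint).\<close>

definition sobolev_even :: "nat \<Rightarrow> (heis \<Rightarrow> real) set"
  where "sobolev_even m = {u \<in> L2. \<exists>g \<in> L2. \<forall>\<phi> \<in> test_functions.
     (LINT x|lebesgue. u x * (sublap ^^ m) \<phi> x) = (LINT x|lebesgue. g x * \<phi> x)}"

definition hilbert_basis_L2 :: "'i set \<Rightarrow> ('i \<Rightarrow> heis \<Rightarrow> real) \<Rightarrow> bool"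
  where "hilbert_basis_L2 I e \<longleftrightarrow>
     (\<forall>i\<in>I. e i \<in> L2) \<and>
     (\<forall>i\<in>I. \<forall>i'\<in>I. (LINT x|lebesgue. e i x * e i' x) = (if i = i' then 1 else 0)) \<and>
     (\<forall>g\<in>L2. \<forall>\<eta>>0. \<exists>F c. finite F \<and> F \<subseteq> I \<and>
        (LINT x|lebesgue. (g x - (\<Sum>i\<in>F. c i * e i x))\<^sup>2) < \<eta>)"


section \<open>Wavelets\<close>

type_synonym lattice = "int \<times> int \<times> int"

abbreviation wtypes :: "nat set"
  where "wtypes \<equiv> {..< 2 ^ hdim - 1}"

fun lattice_pt :: "lattice \<Rightarrow> heis"
  where "lattice_pt (a, b, c) = (of_int a, of_int b, of_int c)"

definition grid_pt :: "int \<Rightarrow> lattice \<Rightarrow> heis"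
  where "grid_pt j k = dil (2 powi (- j)) (lattice_pt k)"

text \<open>\<open>mother M \<theta> \<epsilon>\<close> is the mother wavelet \<open>\<Psi>\<^sub>\<epsilon>\<close>; in the functions below the wavelets are
  not normalised in \<open>L2\<close>.\<close>

definition mother :: "nat \<Rightarrow> (nat \<Rightarrow> heis \<Rightarrow> real) \<Rightarrow> nat \<Rightarrow> heis \<Rightarrow> real"
  where "mother M \<theta> \<epsilon> = (sublap ^^ M) (\<theta> \<epsilon>)"

definition wavelet :: "nat \<Rightarrow> (nat \<Rightarrow> heis \<Rightarrow> real) \<Rightarrow> nat \<Rightarrow> int \<Rightarrow> lattice \<Rightarrow> heis \<Rightarrow> real"
  where "wavelet M \<theta> \<epsilon> j k x = mother M \<theta> \<epsilon> (dil (2 powi j) (hinv (grid_pt j k) \<star> x))"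

definition lemarie_wavelets :: "nat \<Rightarrow> (nat \<Rightarrow> heis \<Rightarrow> real) \<Rightarrow> bool"
  where "lemarie_wavelets M \<theta> \<longleftrightarrow>
     real M > hdim / 2 \<and>
     (\<forall>\<epsilon>\<in>wtypes. \<theta> \<epsilon> \<in> sobolev_even (2 * M)) \<and>
     (\<exists>C0>0. \<exists>r0>0. \<forall>\<epsilon>\<in>wtypes.
        (\<forall>w. int (word_weight w) < 4 * int M - hdim \<longrightarrow>
           iter_differentiable left_field w (\<theta> \<epsilon>) \<and>
           (\<forall>x. \<bar>iter_deriv left_field w (\<theta> \<epsilon>) x\<bar> \<le> C0 * exp (- hnorm x / r0))) \<and>
        (\<forall>P\<in>hpoly (real (2 * M)). (LINT x|lebesgue. mother M \<theta> \<epsilon> x * P x) = 0) \<and>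
        (\<forall>x. \<bar>mother M \<theta> \<epsilon> x\<bar> \<le> C0 * exp (- hnorm x / r0))) \<and>
     hilbert_basis_L2 (wtypes \<times> UNIV \<times> UNIV)
       (\<lambda>(\<epsilon>, j, k) x. 2 powr (real_of_int j * hdim / 2) * wavelet M \<theta> \<epsilon> j k x)"

definition wcoeff ::
  "nat \<Rightarrow> (nat \<Rightarrow> heis \<Rightarrow> real) \<Rightarrow> (heis \<Rightarrow> real) \<Rightarrow> nat \<Rightarrow> int \<Rightarrow> lattice \<Rightarrow> real"
  where "wcoeff M \<theta> f \<epsilon> j k = 2 powi (j * hdim) * (LINT x|lebesgue. f x * wavelet M \<theta> \<epsilon> j k x)"

text \<open>The identity between \<open>f\<close> and its wavelet series. All wavelets being orthogonal to
  polynomials of homogeneous degree \<open>< 2 * M\<close>, the series can only determine \<open>f\<close> modulo such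
  polynomials (for general \<open>f\<close> its low frequency part need not converge otherwise).
  The identity is therefore tested against test functions orthogonal to these polynomials.
  It holds automatically for \<open>f \<in> L2\<close>.\<close>

definition wavelet_expansion :: "nat \<Rightarrow> (nat \<Rightarrow> heis \<Rightarrow> real) \<Rightarrow> (heis \<Rightarrow> real) \<Rightarrow> bool"
  where "wavelet_expansion M \<theta> f \<longleftrightarrow>
     (\<forall>\<phi>\<in>test_functions.
        (\<forall>P\<in>hpoly (real (2 * M)). (LINT x|lebesgue. \<phi> x * P x) = 0) \<longrightarrow>
        ((\<lambda>(\<epsilon>, j, k). wcoeff M \<theta> f \<epsilon> j k * (LINT x|lebesgue. wavelet M \<theta> \<epsilon> j k x * \<phi> x))
           has_sum (LINT x|lebesgue. f x * \<phi> x)) (wtypes \<times> UNIV \<times> UNIV))"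


section \<open>Besov spaces\<close>

definition ell :: "ereal \<Rightarrow> 'i set \<Rightarrow> ('i \<Rightarrow> real) set"
  where "ell p I = {a. if p = \<infinity> then bdd_above ((\<lambda>i. \<bar>a i\<bar>) ` I)
     else (\<lambda>i. \<bar>a i\<bar> powr real_of_ereal p) summable_on I}"

text \<open>Only meaningful for \<open>a \<in> ell p I\<close>.\<close>

definition ell_norm :: "ereal \<Rightarrow> 'i set \<Rightarrow> ('i \<Rightarrow> real) \<Rightarrow> real"
  where "ell_norm p I a = (if p = \<infinity> then (SUP i\<in>I. \<bar>a i\<bar>)
     else (\<Sum>\<^sub>\<infinity>i\<in>I. \<bar>a i\<bar> powr real_of_ereal p) powr (1 / real_of_ereal p))"

definition scale_coeffs ::
  "nat \<Rightarrow> (nat \<Rightarrow> heis \<Rightarrow> real) \<Rightarrow> real \<Rightarrow> ereal \<Rightarrow> (heis \<Rightarrow> real) \<Rightarrow> int \<Rightarrow> lattice \<times> nat \<Rightarrow> real"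
  where "scale_coeffs M \<theta> s p f j = (\<lambda>(k, \<epsilon>).
     2 powr (real_of_int j * (s - real_of_ereal (hdim / p))) * wcoeff M \<theta> f \<epsilon> j k)"

definition besov ::
  "nat \<Rightarrow> (nat \<Rightarrow> heis \<Rightarrow> real) \<Rightarrow> real \<Rightarrow> ereal \<Rightarrow> ereal \<Rightarrow> (heis \<Rightarrow> real) set"
  where "besov M \<theta> s p q = {f.
     (\<forall>K. compact K \<longrightarrow> set_integrable lebesgue K f) \<and>
     (\<forall>\<epsilon>\<in>wtypes. \<forall>j k. integrable lebesgue (\<lambda>x. f x * wavelet M \<theta> \<epsilon> j k x)) \<and>
     wavelet_expansion M \<theta> f \<and>
     (\<forall>j. scale_coeffs M \<theta> s p f j \<in> ell p (UNIV \<times> wtypes)) \<and>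
     (\<lambda>j. ell_norm p (UNIV \<times> wtypes) (scale_coeffs M \<theta> s p f j)) \<in> ell q UNIV}"


section \<open>Pointwise regularity and multifractal spectrum\<close>

text \<open>Functions are considered up to equality almost everywhere (as elements of the local
  \<open>L\<^sup>\<infinity>\<close> space), hence the estimate is required for almost every \<open>x\<close>.\<close>

definition pointwise_holder :: "(heis \<Rightarrow> real) \<Rightarrow> real \<Rightarrow> heis \<Rightarrow> bool"
  where "pointwise_holder f u x0 \<longleftrightarrow> (\<exists>C>0. \<exists>\<eta>>0. \<exists>P\<in>hpoly u.
     AE x in lebesgue. hnorm x < \<eta> \<longrightarrow> \<bar>f (x0 \<star> x) - P x\<bar> \<le> C * hnorm x powr u)"

definition holder_exponent :: "(heis \<Rightarrow> real) \<Rightarrow> heis \<Rightarrow> ereal"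
  where "holder_exponent f x0 = (if \<exists>u>0. pointwise_holder f u x0
     then Sup {ereal u |u. u > 0 \<and> pointwise_holder f u x0} else 0)"

definition iso_holder :: "(heis \<Rightarrow> real) \<Rightarrow> ereal \<Rightarrow> heis set"
  where "iso_holder f h = {x. holder_exponent f x = h}"

definition gauge_ball :: "heis \<Rightarrow> real \<Rightarrow> heis set"
  where "gauge_ball x r = {y. hdist x y < r}"

text \<open>A radius \<open>0\<close> gives an empty ball and contributes \<open>0 powr t = 0\<close> (also for \<open>t = 0\<close>),
  so that coverings by sequences of balls include finite coverings.\<close>

definition hausdorff_pre :: "real \<Rightarrow> real \<Rightarrow> heis set \<Rightarrow> ennreal"
  where "hausdorff_pre t \<eta> E = Inf {(\<Sum>i. ennreal (r i powr t)) |(x :: nat \<Rightarrow> heis) r.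
     (\<forall>i. 0 \<le> r i \<and> r i \<le> \<eta>) \<and> E \<subseteq> (\<Union>i. gauge_ball (x i) (r i))}"

definition hausdorff_measure :: "real \<Rightarrow> heis set \<Rightarrow> ennreal"
  where "hausdorff_measure t E = (SUP \<eta>\<in>{0<..}. hausdorff_pre t \<eta> E)"

definition hausdorff_dim :: "heis set \<Rightarrow> ereal"
  where "hausdorff_dim E = (if E = {} then - \<infinity>
     else Inf {ereal t |t. 0 \<le> t \<and> hausdorff_measure t E = 0})"

definition spectrum :: "(heis \<Rightarrow> real) \<Rightarrow> ereal \<Rightarrow> ereal"
  where "spectrum f h = hausdorff_dim (iso_holder f h)"

text \<open>The upper bound \<open>min Q (p * (h - s + Q / p))\<close> for the spectrum at \<open>h \<ge> s - Q / p\<close>.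
  For \<open>p = \<infinity>\<close> it is read as \<open>min Q (p * (h - s) + Q) = Q\<close>; the product \<open>\<infinity> * 0 = 0\<close> of
  type \<^typ>\<open>ereal\<close> at \<open>h = s\<close> would be wrong there.\<close>

definition spectrum_bound :: "real \<Rightarrow> ereal \<Rightarrow> ereal \<Rightarrow> ereal"
  where "spectrum_bound s p h =
     (if p = \<infinity> then hdim else min hdim (p * (h - ereal s + hdim / p)))"

end

(*
  The wavelet coefficients of f are compared with a Taylor expansion of the mother wavelets. If
  |d_{j,k}| \<le> C (2^{-j} + \<delta>(x_{j,k}, x0))^v for all j \<ge> 0, then f is in C^u(x0) for every u < v: at
  each scale a Taylor polynomial at x0 is subtracted from every wavelet, and the resulting series
  converges absolutely to O(|x|^u). It differs from f by a function that annihilates all test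
  functions with vanishing moments, that is, by a polynomial.

  If the coefficient bound fails at x0 for every C, then x0 lies in infinitely many of the balls
  B(x_{j,k}, |d_{j,k}|^{1/v}) with |d_{j,k}| > 2^{-jv}. The l^p bound at each scale makes the t-th powers of
  these radii summable as soon as t > p (v - s + Q/p), so the set of such x0 has Hausdorff measure
  zero in dimension t. Since |d_{j,k}| \<le> C 2^{-j(s - Q/p)}, the coefficient bound holds everywhere
  when v < s - Q/p.
*)
theory Submission
  imports Defs
begin

section \<open>The gauge norm\<close>

text \<open>The expansion runs over all integers j, and membership in \<open>besov\<close> lets
  coefficients grow like 2^(-\<sigma> j) as j tends to minus infinity, with \<sigma> = s - Q/p. A
  Taylor polynomial of degree below u may leave a divergent low-frequency sum, so for j < 0 the
  order is raised to \<open>N0\<close> = floor s + 1 > \<sigma>. All subtracted polynomials still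
  have degree < 2 M, hence are invisible to test functions with vanishing moments. A remainder of
  order \<open>N0\<close> may consume derivatives of weight \<open>N0\<close> + 1, since Z has
  weight two and an odd order cannot be met exactly. The mother wavelets are controlled below weight
  2 M - Q, and floor s + 2 < 2 M - Q is precisely what this takes.

  For h \<ge> s and finite p the claimed bound is at least Q, so it is enough that the group itself
  has dimension at most Q; the coefficients are examined for h < s, where u and v stay below
  \<open>N0\<close>. When the radii are raised to the power t, comparing t / v with p decides which
  bound on a single coefficient is applied: the uniform upper bound or the lower threshold 2^(-j
  v).\<close>

lemma hmul_0 [simp]: "0 \<star> x = x" "x \<star> 0 = x"
  by (cases x; simp add: zero_prod_def)+

lemma hmul_assoc: "(x \<star> y) \<star> z = x \<star> (y \<star> z)"
  by (cases x; cases y; cases z) (simp add: algebra_simps)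

lemma hinv_cancel [simp]: "hinv x \<star> (x \<star> y) = y" "x \<star> (hinv x \<star> y) = y"
  by (simp_all flip: hmul_assoc add: hmul_hinv)

lemma dil_hmul: "dil l (x \<star> y) = dil l x \<star> dil l y"
  by (cases x; cases y) (simp add: algebra_simps power2_eq_square)

lemma dil_hinv: "dil l (hinv x) = hinv (dil l x)"
  by (cases x) (simp add: hinv_def)

lemma dil_dil: "dil l (dil m x) = dil (l * m) x"
  by (cases x) (simp add: power_mult_distrib)

lemma dil_1 [simp]: "dil 1 x = x"
  by (cases x) simp

lemma hnorm_nonneg [simp]: "0 \<le> hnorm x"
  by (cases x) simp

lemma hnorm_pow4: "hnorm (p, q, r) ^ 4 = (p\<^sup>2 + q\<^sup>2)\<^sup>2 + r\<^sup>2"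
  by simp

lemma hnorm_0 [simp]: "hnorm 0 = 0"
  by (simp add: zero_prod_def)

lemma hnorm_hinv [simp]: "hnorm (hinv x) = hnorm x"
  by (cases x) (simp add: hinv_def)

lemma hnorm_dil: "hnorm (dil l x) = \<bar>l\<bar> * hnorm x"
proof (cases x)
  case (fields p q r)
  have "((l * p)\<^sup>2 + (l * q)\<^sup>2)\<^sup>2 + (l\<^sup>2 * r)\<^sup>2 = \<bar>l\<bar> ^ 4 * ((p\<^sup>2 + q\<^sup>2)\<^sup>2 + r\<^sup>2)"
    by (simp add: power_mult_distrib algebra_simps flip: power_mult)
       (simp add: power2_eq_square power4_eq_xxxx algebra_simps)
  then show ?thesis
    using fields by (simp add: real_root_mult real_root_power_cancel del: power_even_abs_numeral)
qed

section \<open>Subadditivity of the gauge through complex numbers\<close>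

text \<open>With z = p + iq this is |z|^2 + ir, whose modulus is the square of the Koranyi gauge.
  The group law is additive on it up to the term 2 z \<open>cnj\<close> z'.\<close>

definition hcomplex :: "heis \<Rightarrow> complex"
  where "hcomplex = (\<lambda>(p, q, r). Complex (p\<^sup>2 + q\<^sup>2) r)"

declare hnorm.simps [simp del]

lemma cmod_hcomplex: "cmod (hcomplex x) = (hnorm x)\<^sup>2"
proof (cases x)
  case (fields p q r)
  have "((hnorm x)\<^sup>2)\<^sup>2 = (cmod (hcomplex x))\<^sup>2"
    using hnorm_pow4[of p q r] fields
    by (simp add: hcomplex_def cmod_def flip: power_mult)
  then show ?thesis
    by (metis norm_ge_zero power2_eq_iff_nonneg zero_le_power2)
qed

lemma cmod_le_hnorm: "cmod (Complex p q) \<le> hnorm (p, q, r)"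
proof (rule power2_le_imp_le)
  have "(cmod (Complex p q))\<^sup>2 = Re (hcomplex (p, q, r))"
    by (simp add: cmod_def hcomplex_def)
  also have "\<dots> \<le> cmod (hcomplex (p, q, r))"
    by (rule complex_Re_le_cmod)
  finally show "(cmod (Complex p q))\<^sup>2 \<le> (hnorm (p, q, r))\<^sup>2"
    by (simp only: cmod_hcomplex)
qed (rule hnorm_nonneg)

lemma hnorm_hmul_le: "hnorm (x \<star> y) \<le> hnorm x + hnorm y"
proof (cases x; cases y)
  fix p q r p' q' r' assume x: "x = (p, q, r)" and y: "y = (p', q', r')"
  define w where "w = Complex p q * cnj (Complex p' q')"
  \<comment> \<open>The real part is the expansion of |z + z'|^2; the imaginary part of
    \<open>w\<close> is q p' - p q', exactly the twist of the group law. Since |w| is at most the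
    product of the norms, the triangle inequality then yields a perfect square.\<close>
  have eq: "hcomplex (x \<star> y) = hcomplex x + hcomplex y + 2 * w"
    unfolding x y w_def hcomplex_def by (auto simp: complex_eq_iff power2_eq_square algebra_simps)
  have "cmod w = cmod (Complex p q) * cmod (Complex p' q')"
    unfolding w_def by (simp only: norm_mult complex_mod_cnj)
  also have "\<dots> \<le> hnorm x * hnorm y"
    unfolding x y by (intro mult_mono cmod_le_hnorm norm_ge_zero hnorm_nonneg)
  finally have w: "cmod w \<le> hnorm x * hnorm y" .
  have "(hnorm (x \<star> y))\<^sup>2 \<le> cmod (hcomplex x) + cmod (hcomplex y) + cmod (2 * w)"
    unfolding cmod_hcomplex[symmetric] eq by (meson add_mono norm_triangle_ineq order_refl order_trans)
  also have "\<dots> \<le> (hnorm x + hnorm y)\<^sup>2"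
    using w by (simp add: cmod_hcomplex norm_mult power2_sum)
  finally show "hnorm (x \<star> y) \<le> hnorm x + hnorm y"
    by (rule power2_le_imp_le) simp
qed

lemma hnorm_le_hmul_right: "hnorm x \<le> hnorm (x \<star> y) + hnorm y"
proof -
  have "hnorm ((x \<star> y) \<star> hinv y) \<le> hnorm (x \<star> y) + hnorm (hinv y)"
    by (rule hnorm_hmul_le)
  then show ?thesis by (simp add: hmul_assoc hmul_hinv)
qed

lemma abs_le_hnorm: "\<bar>p\<bar> \<le> hnorm (p, q, r)" "\<bar>q\<bar> \<le> hnorm (p, q, r)" "\<bar>r\<bar> \<le> (hnorm (p, q, r))\<^sup>2"
proof -
  show "\<bar>p\<bar> \<le> hnorm (p, q, r)" "\<bar>q\<bar> \<le> hnorm (p, q, r)"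
    using cmod_le_hnorm[of p q r] abs_Re_le_cmod[of "Complex p q"] abs_Im_le_cmod[of "Complex p q"]
    by simp_all
  have "Im (hcomplex (p, q, r)) = r" by (simp add: hcomplex_def)
  then show "\<bar>r\<bar> \<le> (hnorm (p, q, r))\<^sup>2"
    using abs_Im_le_cmod[of "hcomplex (p, q, r)"] by (simp add: cmod_hcomplex)
qed

lemma hnorm_axis: "hnorm (t, 0, 0) = \<bar>t\<bar>" "hnorm (0, t, 0) = \<bar>t\<bar>" "hnorm (0, 0, t) = sqrt \<bar>t\<bar>"
proof -
  have eq: "hnorm x = a" if "(hnorm x) ^ 4 = a ^ 4" "0 \<le> a" for x a
    using that power_eq_iff_eq_base[of 4 "hnorm x" a] by simp
  have "sqrt \<bar>t\<bar> ^ 4 = ((sqrt \<bar>t\<bar>)\<^sup>2)\<^sup>2" by (simp only: flip: power_mult) simp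
  also have "\<dots> = t\<^sup>2" by simp
  finally show "hnorm (t, 0, 0) = \<bar>t\<bar>" "hnorm (0, t, 0) = \<bar>t\<bar>" "hnorm (0, 0, t) = sqrt \<bar>t\<bar>"
    by (auto intro!: eq simp: hnorm_pow4 simp flip: power_mult)
qed

section \<open>Polynomials of given homogeneous degree\<close>

definition hdeg :: "nat \<times> nat \<times> nat \<Rightarrow> nat"
  where "hdeg = (\<lambda>(a, b, d). a + b + 2 * d)"

definition hmono :: "nat \<times> nat \<times> nat \<Rightarrow> heis \<Rightarrow> real"
  where "hmono = (\<lambda>(a, b, d) (p, q, r). p ^ a * q ^ b * r ^ d)"

lemma finite_hdeg_less: "finite {i. real (hdeg i) < u}"
proof (rule finite_subset)
  define n where "n = nat \<lceil>u\<rceil>"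
  show "{i. real (hdeg i) < u} \<subseteq> {..n} \<times> {..n} \<times> {..n}"
    unfolding n_def hdeg_def by (auto; linarith)
qed auto

text \<open>A normal form: the index set depends on \<open>u\<close> alone, absent monomials
  receiving coefficient zero, so that linear operations act on coefficients.\<close>

lemma hpoly_iff: "P \<in> hpoly u \<longleftrightarrow> (\<exists>c. P = (\<lambda>x. \<Sum>i | real (hdeg i) < u. c i * hmono i x))"
proof
  assume "P \<in> hpoly u"
  then obtain S c where S: "finite S" "\<forall>(a, b, d) \<in> S. real (a + b + 2 * d) < u"
    and P: "P = (\<lambda>(p, q, r). \<Sum>(a, b, d) \<in> S. c (a, b, d) * p ^ a * q ^ b * r ^ d)"
    unfolding hpoly_def by blast
  have "P = (\<lambda>x. \<Sum>i | real (hdeg i) < u. (if i \<in> S then c i else 0) * hmono i x)"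
  proof (rule ext)
    fix x :: heis
    have "P x = (\<Sum>i\<in>S. (if i \<in> S then c i else 0) * hmono i x)"
      by (cases x) (auto simp: P hmono_def split: prod.split intro!: sum.cong)
    also have "\<dots> = (\<Sum>i | real (hdeg i) < u. (if i \<in> S then c i else 0) * hmono i x)"
      by (rule sum.mono_neutral_left[OF finite_hdeg_less]) (use S in \<open>auto simp: hdeg_def\<close>)
    finally show "P x = \<dots>" .
  qed
  then show "\<exists>c. P = (\<lambda>x. \<Sum>i | real (hdeg i) < u. c i * hmono i x)"
    by (rule exI[of _ "\<lambda>i. if i \<in> S then c i else 0"])
next
  assume "\<exists>c. P = (\<lambda>x. \<Sum>i | real (hdeg i) < u. c i * hmono i x)"
  then obtain c where "P = (\<lambda>x. \<Sum>i | real (hdeg i) < u. c i * hmono i x)" by blast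
  moreover define S where "S = {i. real (hdeg i) < u}"
  ultimately have "P = (\<lambda>(p, q, r). \<Sum>(a, b, d) \<in> S. c (a, b, d) * p ^ a * q ^ b * r ^ d)"
    by (auto simp: hmono_def fun_eq_iff mult.assoc intro!: sum.cong split: prod.split)
  moreover have "finite S" "\<forall>(a, b, d) \<in> S. real (a + b + 2 * d) < u"
    using finite_hdeg_less[of u] by (auto simp: S_def hdeg_def)
  ultimately show "P \<in> hpoly u"
    unfolding hpoly_def by blast
qed

lemma hpolyI: "P = (\<lambda>x. \<Sum>i | real (hdeg i) < u. c i * hmono i x) \<Longrightarrow> P \<in> hpoly u"
  unfolding hpoly_iff by (rule exI[of _ c])

lemma hpoly_add:
  assumes "P \<in> hpoly u" "R \<in> hpoly u"
  shows "(\<lambda>x. P x + R x) \<in> hpoly u"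
proof -
  obtain c c' where "P = (\<lambda>x. \<Sum>i | real (hdeg i) < u. c i * hmono i x)"
    "R = (\<lambda>x. \<Sum>i | real (hdeg i) < u. c' i * hmono i x)"
    using assms by (auto simp: hpoly_iff)
  then have "(\<lambda>x. P x + R x) = (\<lambda>x. \<Sum>i | real (hdeg i) < u. (c i + c' i) * hmono i x)"
    by (simp add: sum.distrib algebra_simps)
  then show ?thesis by (rule hpolyI)
qed

lemma hpoly_scale:
  assumes "P \<in> hpoly u"
  shows "(\<lambda>x. k * P x) \<in> hpoly u"
proof -
  obtain c where "P = (\<lambda>x. \<Sum>i | real (hdeg i) < u. c i * hmono i x)"
    using assms by (auto simp: hpoly_iff)
  then have "(\<lambda>x. k * P x) = (\<lambda>x. \<Sum>i | real (hdeg i) < u. (k * c i) * hmono i x)"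
    by (simp add: sum_distrib_left mult.assoc)
  then show ?thesis by (rule hpolyI)
qed

lemma hpoly_0: "(\<lambda>x. 0) \<in> hpoly u"
  unfolding hpoly_iff by (rule exI[of _ "\<lambda>_. 0"]) simp

lemma hpoly_sum:
  assumes "\<And>i. i \<in> A \<Longrightarrow> P i \<in> hpoly u"
  shows "(\<lambda>x. \<Sum>i\<in>A. P i x) \<in> hpoly u"
  using assms by (induction A rule: infinite_finite_induct) (auto intro: hpoly_0 hpoly_add)

lemma hpoly_hmono:
  assumes "real (hdeg i) < u"
  shows "hmono i \<in> hpoly u"
  unfolding hpoly_iff
  by (rule exI[of _ "\<lambda>i'. if i' = i then 1 else 0"])
     (use assms in \<open>simp add: if_distrib[of "\<lambda>c. c * _"] finite_hdeg_less cong: if_cong\<close>)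

lemma hpoly_subset:
  assumes "P \<in> hpoly u" and le: "\<And>n. real n < u \<Longrightarrow> real n < v"
  shows "P \<in> hpoly v"
proof -
  obtain c where "P = (\<lambda>x. \<Sum>i | real (hdeg i) < u. c i * hmono i x)"
    using assms by (auto simp: hpoly_iff)
  then show ?thesis
    by (auto intro!: hpoly_sum hpoly_scale hpoly_hmono le)
qed

lemma real_less_plus_1_iff: "real n < real m + 1 \<longleftrightarrow> n \<le> m"
  by linarith

text \<open>The strict degree bound of \<open>hpoly\<close> is not additive as it stands. Degree at
  most \<open>m\<close> is therefore written \<open>hpoly (real m + 1)\<close>, and in this form
  degrees add exactly.\<close>

lemma hpoly_mult:
  assumes "P \<in> hpoly (real m + 1)" "R \<in> hpoly (real n + 1)"
  shows "(\<lambda>x. P x * R x) \<in> hpoly (real (m + n) + 1)"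
proof -
  obtain c c' where P: "P = (\<lambda>x. \<Sum>i | real (hdeg i) < real m + 1. c i * hmono i x)"
    and R: "R = (\<lambda>x. \<Sum>i | real (hdeg i) < real n + 1. c' i * hmono i x)"
    using assms by (auto simp: hpoly_iff)
  have "hmono i x * hmono j x = hmono (fst i + fst j, fst (snd i) + fst (snd j), snd (snd i) + snd (snd j)) x"
    for i j x
    by (cases i; cases j; cases x) (simp add: hmono_def power_add)
  then have "(\<lambda>x. P x * R x) = (\<lambda>x. \<Sum>i | real (hdeg i) < real m + 1. \<Sum>j | real (hdeg j) < real n + 1.
      (c i * c' j) * hmono (fst i + fst j, fst (snd i) + fst (snd j), snd (snd i) + snd (snd j)) x)"
    unfolding P R sum_product by (simp add: mult.assoc mult.left_commute)
  then show ?thesis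
  proof (simp only:, intro hpoly_sum hpoly_scale hpoly_hmono)
    fix i j assume "i \<in> {i. real (hdeg i) < real m + 1}" "j \<in> {j. real (hdeg j) < real n + 1}"
    then have "hdeg (fst i + fst j, fst (snd i) + fst (snd j), snd (snd i) + snd (snd j)) \<le> m + n"
      unfolding real_less_plus_1_iff hdeg_def by (auto simp: case_prod_unfold)
    then show "real (hdeg (fst i + fst j, fst (snd i) + fst (snd j), snd (snd i) + snd (snd j))) < real (m + n) + 1"
      unfolding real_less_plus_1_iff .
  qed
qed

lemma hpoly_const: "(\<lambda>x. k) \<in> hpoly (real n + 1)"
proof -
  have "(\<lambda>x. k * hmono (0, 0, 0) x) \<in> hpoly (real n + 1)"
    by (intro hpoly_scale hpoly_hmono) (simp add: hdeg_def)
  then show ?thesis by (simp add: hmono_def case_prod_unfold)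
qed

lemma hpoly_power:
  assumes "P \<in> hpoly (real m + 1)"
  shows "(\<lambda>x. P x ^ k) \<in> hpoly (real (m * k) + 1)"
proof (induction k)
  case (Suc k)
  then show ?case using hpoly_mult[OF assms Suc] by (simp add: algebra_simps)
qed (use hpoly_const[of 1 0] in simp)

lemma hpoly_coord:
  "(\<lambda>x. fst x) \<in> hpoly (real 1 + 1)" "(\<lambda>x. fst (snd x)) \<in> hpoly (real 1 + 1)"
  "(\<lambda>x. snd (snd x)) \<in> hpoly (real 2 + 1)"
  using hpoly_hmono[of "(1, 0, 0)" "real 1 + 1"] hpoly_hmono[of "(0, 1, 0)" "real 1 + 1"]
    hpoly_hmono[of "(0, 0, 1)" "real 2 + 1"]
  by (simp_all add: hmono_def hdeg_def case_prod_unfold)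

lemma hpoly_product:
  assumes "A \<in> hpoly (real 1 + 1)" "B \<in> hpoly (real 1 + 1)" "D \<in> hpoly (real 2 + 1)"
    and "real (hdeg (a, b, d)) < u"
  shows "(\<lambda>x. A x ^ a * B x ^ b * D x ^ d) \<in> hpoly u"
proof (rule hpoly_subset)
  show "(\<lambda>x. A x ^ a * B x ^ b * D x ^ d) \<in> hpoly (real (1 * a + 1 * b + 2 * d) + 1)"
    by (intro hpoly_mult hpoly_power assms)
  show "real n < u" if "real n < real (1 * a + 1 * b + 2 * d) + 1" for n
    using that assms(4) unfolding real_less_plus_1_iff by (simp add: hdeg_def)
qed

section \<open>Polynomials under translations and dilations; size of monomials\<close>

text \<open>Translation adds to the third coordinate only terms of degree at most one in
  \<open>x\<close>, so each coordinate of \<open>y \<star> x\<close> is a polynomial of the same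
  weight as before.\<close>

lemma hpoly_translate:
  assumes "P \<in> hpoly u"
  shows "(\<lambda>x. P (y \<star> x)) \<in> hpoly u"
proof -
  obtain c where P: "P = (\<lambda>x. \<Sum>i | real (hdeg i) < u. c i * hmono i x)"
    using assms by (auto simp: hpoly_iff)
  obtain p0 q0 r0 where y: "y = (p0, q0, r0)" by (cases y)
  have *: "fst (y \<star> x) = p0 + fst x" "fst (snd (y \<star> x)) = q0 + fst (snd x)"
    "snd (snd (y \<star> x)) = (r0 + snd (snd x)) + (2 * q0 * fst x + (- 2 * p0) * fst (snd x))" for x
    by (cases x; simp add: y algebra_simps)+
  have lin: "(\<lambda>x. p0 + fst x) \<in> hpoly (real 1 + 1)" "(\<lambda>x. q0 + fst (snd x)) \<in> hpoly (real 1 + 1)"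
    by (intro hpoly_add hpoly_const hpoly_coord)+
  have quad: "(\<lambda>x. (r0 + snd (snd x)) + (2 * q0 * fst x + (- 2 * p0) * fst (snd x))) \<in> hpoly (real 2 + 1)"
    by (intro hpoly_add hpoly_scale hpoly_const hpoly_coord hpoly_subset[OF hpoly_coord(1)]
        hpoly_subset[OF hpoly_coord(2)]) auto
  have "(\<lambda>x. hmono i (y \<star> x)) \<in> hpoly u" if "real (hdeg i) < u" for i
  proof -
    obtain a b d where i: "i = (a, b, d)" by (cases i)
    have "hmono i z = fst z ^ a * fst (snd z) ^ b * snd (snd z) ^ d" for z
      by (cases z) (simp add: i hmono_def)
    then show ?thesis
      unfolding * using that by (simp only: i * hpoly_product[OF lin quad])
  qed
  then show ?thesis unfolding P by (intro hpoly_sum hpoly_scale) auto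
qed

lemma hmono_dil: "hmono i (dil l x) = l ^ hdeg i * hmono i x"
  by (cases i; cases x)
     (simp add: hmono_def hdeg_def power_mult_distrib power_add power_mult algebra_simps flip: power_mult)

lemma hpoly_dil:
  assumes "P \<in> hpoly u"
  shows "(\<lambda>x. P (dil l x)) \<in> hpoly u"
proof -
  obtain c where P: "P = (\<lambda>x. \<Sum>i | real (hdeg i) < u. c i * hmono i x)"
    using assms by (auto simp: hpoly_iff)
  show ?thesis
    unfolding P hmono_dil by (intro hpoly_sum hpoly_scale hpoly_hmono) auto
qed

lemma abs_hmono_le: "\<bar>hmono i x\<bar> \<le> hnorm x ^ hdeg i"
proof (cases i; cases x)
  fix a b d p q r assume i: "i = (a, b, d)" and x: "x = (p, q, r)"
  have "\<bar>hmono i x\<bar> = \<bar>p\<bar> ^ a * \<bar>q\<bar> ^ b * \<bar>r\<bar> ^ d"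
    by (simp add: i x hmono_def abs_mult power_abs)
  also have "\<dots> \<le> hnorm x ^ a * hnorm x ^ b * ((hnorm x)\<^sup>2) ^ d"
    unfolding x by (intro mult_mono power_mono abs_le_hnorm) auto
  also have "\<dots> = hnorm x ^ hdeg i"
    by (simp add: i hdeg_def power_add power_mult)
  finally show ?thesis .
qed

text \<open>Inside the unit ball a monomial of degree at least \<open>u\<close> is dominated by the
  power \<open>u\<close> of the gauge. This brings the polynomial of degree < 2 M, by which
  \<open>f\<close> differs from the corrected series, down to the degree allowed in
  \<open>pointwise_holder\<close>.\<close>

lemma hpoly_truncate:
  assumes "P \<in> hpoly v" "0 < u"
  obtains R C where "R \<in> hpoly u" "\<And>x. hnorm x < 1 \<Longrightarrow> \<bar>P x - R x\<bar> \<le> C * hnorm x powr u" "0 \<le> C"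
proof -
  obtain c where P: "P = (\<lambda>x. \<Sum>i | real (hdeg i) < v. c i * hmono i x)"
    using assms by (auto simp: hpoly_iff)
  define I where "I = {i. real (hdeg i) < v}"
  have fin: "finite I" unfolding I_def by (rule finite_hdeg_less)
  define R where "R = (\<lambda>x. \<Sum>i\<in>{i\<in>I. real (hdeg i) < u}. c i * hmono i x)"
  have diff: "P x - R x = (\<Sum>i\<in>{i\<in>I. \<not> real (hdeg i) < u}. c i * hmono i x)" for x
    using sum.inter_filter[OF fin, of "\<lambda>i. c i * hmono i x" "\<lambda>i. real (hdeg i) < u"]
      sum.inter_filter[OF fin, of "\<lambda>i. c i * hmono i x" "\<lambda>i. \<not> real (hdeg i) < u"]
    unfolding P R_def I_def[symmetric] sum_subtractf[symmetric]
    by (auto simp: sum_subtractf[symmetric] intro!: sum.cong)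
  show ?thesis
  proof
    show "R \<in> hpoly u" unfolding R_def by (intro hpoly_sum hpoly_scale hpoly_hmono) auto
    fix x assume x: "hnorm x < 1"
    have "\<bar>hmono i x\<bar> \<le> hnorm x powr u" if "\<not> real (hdeg i) < u" for i
    proof (cases "hnorm x = 0")
      case True
      \<comment> \<open>At the origin both sides have to be 0; positivity of \<open>u\<close>
        excludes the constant monomial here.\<close>
      have "hdeg i \<noteq> 0" using that assms(2) by (cases "hdeg i") auto
      then show ?thesis using True abs_hmono_le[of i x] by (simp add: zero_power)
    next
      case False
      then have pos: "0 < hnorm x" using hnorm_nonneg[of x] by linarith
      have "\<bar>hmono i x\<bar> \<le> hnorm x powr real (hdeg i)"
        using abs_hmono_le[of i x] pos by (simp add: powr_realpow)
      also have "\<dots> \<le> hnorm x powr u"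
        by (rule powr_mono') (use pos x that in auto)
      finally show ?thesis .
    qed
    then show "\<bar>P x - R x\<bar> \<le> (\<Sum>i\<in>{i\<in>I. \<not> real (hdeg i) < u}. \<bar>c i\<bar>) * hnorm x powr u"
      unfolding diff sum_distrib_right
      by (intro order_trans[OF sum_abs] sum_mono) (auto simp: abs_mult intro!: mult_left_mono)
  qed (auto intro: sum_nonneg)
qed

lemma hpoly_continuous:
  assumes "P \<in> hpoly u"
  shows "continuous_on A P"
proof -
  obtain c where P: "P = (\<lambda>x. \<Sum>i | real (hdeg i) < u. c i * hmono i x)"
    using assms by (auto simp: hpoly_iff)
  show ?thesis unfolding P hmono_def case_prod_unfold by (intro continuous_intros)
qed

section \<open>Taylor expansion along the left-invariant fields\<close>

fun hexp :: "hdir \<Rightarrow> real \<Rightarrow> heis"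
  where "hexp DX t = (t, 0, 0)" | "hexp DY t = (0, t, 0)" | "hexp DZ t = (0, 0, t)"

lemma left_field_hexp: "x + t *\<^sub>R left_field V x = x \<star> hexp V t"
  by (cases V) (simp_all only: left_field_translation hexp.simps)

lemma hexp_add: "hexp V (s + t) = hexp V s \<star> hexp V t"
  by (cases V) simp_all

lemma hexp_0 [simp]: "hexp V 0 = 0"
  by (cases V) (simp_all add: zero_prod_def)

text \<open>Exponential coordinates of the second kind: the first two factors produce the third
  coordinate -2pq, which the last one compensates.\<close>

lemma hexp_decompose: "(p, q, r) = hexp DX p \<star> hexp DY q \<star> hexp DZ (r + 2 * p * q)"
  by simp

text \<open>\<open>iter_differentiable\<close> speaks of time 0 only. The flow of a left-invariant
  field is right multiplication by a one-parameter subgroup, so time \<open>t\<close> at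
  \<open>x\<close> is time 0 at \<open>x \<star> hexp V t\<close>.\<close>

lemma has_derivative_hexp:
  assumes "iter_differentiable left_field (V # w) g"
  shows "((\<lambda>t. iter_deriv left_field w g (x \<star> hexp V t)) has_real_derivative
    iter_deriv left_field (V # w) g (x \<star> hexp V t)) (at t)"
proof -
  let ?y = "x \<star> hexp V t"
  have "((\<lambda>s. iter_deriv left_field w g (?y \<star> hexp V s)) has_real_derivative
      iter_deriv left_field (V # w) g ?y) (at 0)"
    using assms by (auto simp: along_def left_field_hexp field_differentiable_derivI simp del: split_paired_All)
  then have "((\<lambda>s. iter_deriv left_field w g (x \<star> hexp V (s + t))) has_real_derivative
      iter_deriv left_field (V # w) g ?y) (at 0)"
    by (simp add: hmul_assoc hexp_add[symmetric] add.commute)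
  then show ?thesis
    using DERIV_shift[of "\<lambda>s. iter_deriv left_field w g (x \<star> hexp V s)" _ 0 t] by simp
qed

text \<open>The one-variable Maclaurin formula with Lagrange remainder along a single flow line; the
  word \<open>w\<close> allows derivatives that have already been taken.\<close>

lemma taylor_hexp:
  assumes "\<And>m. m \<le> n \<Longrightarrow> iter_differentiable left_field (replicate m V @ w) g"
  obtains \<xi> where "\<bar>\<xi>\<bar> \<le> \<bar>t\<bar>"
    "iter_deriv left_field w g (x \<star> hexp V t) =
      (\<Sum>m<n. iter_deriv left_field (replicate m V @ w) g x / fact m * t ^ m) +
      iter_deriv left_field (replicate n V @ w) g (x \<star> hexp V \<xi>) / fact n * t ^ n"
proof -
  have "\<exists>\<xi>. \<bar>\<xi>\<bar> \<le> \<bar>t\<bar> \<and> iter_deriv left_field w g (x \<star> hexp V t) =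
      (\<Sum>m<n. iter_deriv left_field (replicate m V @ w) g (x \<star> hexp V 0) / fact m * t ^ m) +
      iter_deriv left_field (replicate n V @ w) g (x \<star> hexp V \<xi>) / fact n * t ^ n"
  proof (rule Maclaurin_bi_le[where diff = "\<lambda>m t. iter_deriv left_field (replicate m V @ w) g (x \<star> hexp V t)"])
    show "\<forall>m s. m < n \<and> \<bar>s\<bar> \<le> \<bar>t\<bar> \<longrightarrow>
       ((\<lambda>t. iter_deriv left_field (replicate m V @ w) g (x \<star> hexp V t)) has_real_derivative
         iter_deriv left_field (replicate (Suc m) V @ w) g (x \<star> hexp V s)) (at s)"
    proof (intro allI impI)
      fix m s assume "m < n \<and> \<bar>s\<bar> \<le> \<bar>t\<bar>"
      then have "iter_differentiable left_field (V # (replicate m V @ w)) g"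
        using assms[of "Suc m"] by simp
      from has_derivative_hexp[OF this]
      show "((\<lambda>t. iter_deriv left_field (replicate m V @ w) g (x \<star> hexp V t)) has_real_derivative
         iter_deriv left_field (replicate (Suc m) V @ w) g (x \<star> hexp V s)) (at s)"
        by (simp only: replicate_Suc append_Cons)
    qed
  qed simp
  then show ?thesis using that by auto
qed

section \<open>Taylor polynomials in exponential coordinates\<close>

text \<open>The head of a word acts last, so this is X^a Y^b Z^d. It is the order in which
  derivatives arise when the factors of \<open>hexp_decompose\<close> are expanded one by one from
  the right.\<close>

definition hword :: "nat \<Rightarrow> nat \<Rightarrow> nat \<Rightarrow> hdir list"
  where "hword a b d = replicate a DX @ replicate b DY @ replicate d DZ"

lemma word_weight_hword: "word_weight (hword a b d) = a + b + 2 * d"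
  by (simp add: word_weight_def hword_def sum_list_replicate)

text \<open>The monomials are taken in the exponential coordinates of \<open>hexp_decompose\<close>.\<close>

definition htaylor :: "nat \<Rightarrow> (heis \<Rightarrow> real) \<Rightarrow> heis \<Rightarrow> heis \<Rightarrow> real"
  where "htaylor n g y = (\<lambda>(p, q, r). \<Sum>d<(n + 1) div 2. \<Sum>b<n - 2 * d. \<Sum>a<n - 2 * d - b.
    iter_deriv left_field (hword a b d) g y / (fact a * fact b * fact d) *
      (p ^ a * q ^ b * (r + 2 * p * q) ^ d))"

lemma htaylor_hpoly: "htaylor n g y \<in> hpoly (real n)"
proof -
  have quad: "(\<lambda>x. snd (snd x) + 2 * (fst x * fst (snd x))) \<in> hpoly (real 2 + 1)"
    using hpoly_mult[OF hpoly_coord(1) hpoly_coord(2)]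
    by (intro hpoly_add hpoly_scale hpoly_coord) simp
  have "htaylor n g y = (\<lambda>x. \<Sum>d<(n + 1) div 2. \<Sum>b<n - 2 * d. \<Sum>a<n - 2 * d - b.
    iter_deriv left_field (hword a b d) g y / (fact a * fact b * fact d) *
      (fst x ^ a * fst (snd x) ^ b * (snd (snd x) + 2 * (fst x * fst (snd x))) ^ d))"
    by (auto simp: htaylor_def fun_eq_iff mult.assoc)
  also have "\<dots> \<in> hpoly (real n)"
    by (intro hpoly_sum hpoly_scale hpoly_product[OF hpoly_coord(1,2) quad]) (auto simp: hdeg_def)
  finally show ?thesis .
qed

lemma exp_coord_le:
  assumes "N = hnorm (p, q, r)"
  shows "\<bar>p\<bar> \<le> N" "\<bar>q\<bar> \<le> N" "\<bar>r + 2 * p * q\<bar> \<le> 3 * N\<^sup>2"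
proof -
  show pq: "\<bar>p\<bar> \<le> N" "\<bar>q\<bar> \<le> N" using assms abs_le_hnorm by auto
  have "\<bar>r + 2 * p * q\<bar> \<le> \<bar>r\<bar> + 2 * (\<bar>p\<bar> * \<bar>q\<bar>)"
    using abs_triangle_ineq[of r "2 * p * q"] by (simp add: abs_mult)
  also have "\<dots> \<le> N\<^sup>2 + 2 * (N * N)"
    using assms abs_le_hnorm(3)[of r p q] pq by (intro add_mono mult_mono) auto
  finally show "\<bar>r + 2 * p * q\<bar> \<le> 3 * N\<^sup>2" by (simp add: power2_eq_square)
qed

lemma exp_monomial_le:
  assumes "N = hnorm (p, q, r)" "d \<le> n"
  shows "\<bar>p\<bar> ^ a * \<bar>q\<bar> ^ b * \<bar>r + 2 * p * q\<bar> ^ d \<le> 3 ^ n * N ^ (a + b + 2 * d)"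
proof -
  have N: "0 \<le> N" using assms by simp
  have "\<bar>p\<bar> ^ a * \<bar>q\<bar> ^ b * \<bar>r + 2 * p * q\<bar> ^ d \<le> N ^ a * N ^ b * (3 * N\<^sup>2) ^ d"
    by (intro mult_mono power_mono exp_coord_le[OF assms(1)]) (auto simp: N)
  also have "\<dots> = 3 ^ d * N ^ (a + b + 2 * d)"
    by (simp add: power_add power_mult power_mult_distrib)
  also have "\<dots> \<le> 3 ^ n * N ^ (a + b + 2 * d)"
    by (intro mult_right_mono power_increasing) (use assms N in auto)
  finally show ?thesis .
qed

lemma abs_fact_quotient_le: "\<bar>D\<bar> \<le> A \<Longrightarrow> \<bar>D / fact n * t\<bar> \<le> A * \<bar>t\<bar>" for D A t :: real
proof -
  assume D: "\<bar>D\<bar> \<le> A"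
  have "\<bar>D\<bar> / fact n \<le> \<bar>D\<bar> / 1" by (intro divide_left_mono) auto
  with D have "\<bar>D\<bar> / fact n * \<bar>t\<bar> \<le> A * \<bar>t\<bar>" by (intro mult_right_mono) auto
  then show "\<bar>D / fact n * t\<bar> \<le> A * \<bar>t\<bar>" by (simp add: abs_mult)
qed

text \<open>The point is reached from \<open>y\<close> along X, then Y, then Z; the expansions are
  made in the reverse order, each at the start of its segment. Every error is a monomial of weight
  at least \<open>n\<close>, and at most 1 + n + n^2 of them occur. The factor 3^n comes from the
  third exponential coordinate, bounded by three times the squared gauge. For odd \<open>n\<close>
  the Z expansion overshoots to weight n + 1.\<close>

lemma htaylor_remainder:
  assumes D: "\<And>w. word_weight w \<le> n + 1 \<Longrightarrow> iter_differentiable left_field w g"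
    and B: "\<And>w x. word_weight w \<le> n + 1 \<Longrightarrow> hnorm x \<le> 4 \<Longrightarrow> \<bar>iter_deriv left_field w g (y \<star> x)\<bar> \<le> A"
    and z: "hnorm z \<le> 1"
  shows "\<bar>g (y \<star> z) - htaylor n g y z\<bar> \<le> real ((n + 1) ^ 2) * 3 ^ n * A * hnorm z ^ n"
proof (cases z)
  case (fields p q r)
  define N where "N = hnorm z"
  have N: "N = hnorm (p, q, r)" "0 \<le> N" "N \<le> 1" using fields z by (auto simp: N_def)
  note coord = exp_coord_le[OF N(1)]
  define r' where "r' = r + 2 * p * q"
  \<comment> \<open>The least number of Z derivatives whose weight 2 * \<open>n3\<close> reaches
    \<open>n\<close>.\<close>
  define n3 where "n3 = (n + 1) div 2"
  define F where "F = (\<lambda>a b d. iter_deriv left_field (hword a b d) g)"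
  define K where "K = A * (3 ^ n * N ^ n)"
  have A: "0 \<le> A" using B[of "[]" 0] by (simp add: word_weight_def)
  have K: "0 \<le> K" using A N by (simp add: K_def)
  have mono: "\<bar>p\<bar> ^ a * \<bar>q\<bar> ^ b * \<bar>r'\<bar> ^ d \<le> 3 ^ n * N ^ n" if "n \<le> a + b + 2 * d" "d \<le> n" for a b d
  proof -
    have "\<bar>p\<bar> ^ a * \<bar>q\<bar> ^ b * \<bar>r'\<bar> ^ d \<le> 3 ^ n * N ^ (a + b + 2 * d)"
      unfolding r'_def by (rule exp_monomial_le[OF N(1)]) (use that in auto)
    also have "\<dots> \<le> 3 ^ n * N ^ n"
      by (intro mult_left_mono power_decreasing) (use that N in auto)
    finally show ?thesis .
  qed
  let ?y1 = "y \<star> hexp DX p" let ?y2 = "?y1 \<star> hexp DY q"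
  have step3: "\<bar>F 0 b d ?y1 - (\<Sum>a<m. F a b d y / fact a * p ^ a)\<bar> \<le> A * \<bar>p\<bar> ^ m"
    if le: "m + b + 2 * d \<le> n + 1" for m b d
  proof -
    obtain \<xi> where xi: "\<bar>\<xi>\<bar> \<le> \<bar>p\<bar>" "F 0 b d ?y1 = (\<Sum>a<m. F a b d y / fact a * p ^ a) +
        F m b d (y \<star> hexp DX \<xi>) / fact m * p ^ m"
      using taylor_hexp[of m DX "hword 0 b d" g p y thesis] D le
      by (force simp: F_def hword_def word_weight_def sum_list_replicate)
    have "\<bar>F m b d (y \<star> hexp DX \<xi>)\<bar> \<le> A"
      unfolding F_def by (rule B) (use le xi coord N in \<open>auto simp: word_weight_hword hnorm_axis\<close>)
    from abs_fact_quotient_le[OF this, of m "p ^ m"] show ?thesis unfolding xi(2) by (simp add: power_abs)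
  qed
  have step2: "\<bar>F 0 0 d ?y2 - (\<Sum>b<m. F 0 b d ?y1 / fact b * q ^ b)\<bar> \<le> A * \<bar>q\<bar> ^ m"
    if le: "m + 2 * d \<le> n + 1" for m d
  proof -
    obtain \<xi> where xi: "\<bar>\<xi>\<bar> \<le> \<bar>q\<bar>" "F 0 0 d ?y2 = (\<Sum>b<m. F 0 b d ?y1 / fact b * q ^ b) +
        F 0 m d (?y1 \<star> hexp DY \<xi>) / fact m * q ^ m"
      using taylor_hexp[of m DY "hword 0 0 d" g q ?y1 thesis] D le
      by (force simp: F_def hword_def word_weight_def sum_list_replicate)
    have "hnorm (hexp DX p \<star> hexp DY \<xi>) \<le> 4"
      by (rule order_trans[OF hnorm_hmul_le]) (use xi coord N in \<open>auto simp: hnorm_axis\<close>)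
    then have "\<bar>F 0 m d (?y1 \<star> hexp DY \<xi>)\<bar> \<le> A"
      unfolding F_def hmul_assoc by (intro B) (use le in \<open>auto simp: word_weight_hword\<close>)
    from abs_fact_quotient_le[OF this, of m "q ^ m"] show ?thesis unfolding xi(2) by (simp add: power_abs)
  qed
  have yz: "y \<star> z = ?y2 \<star> hexp DZ r'"
    unfolding fields r'_def hexp_decompose[of p q r] hmul_assoc ..
  have step1: "\<bar>g (y \<star> z) - (\<Sum>d<n3. F 0 0 d ?y2 / fact d * r' ^ d)\<bar> \<le> K"
  proof -
    have n3: "2 * n3 \<le> n + 1" "n \<le> 2 * n3" "n3 \<le> n" unfolding n3_def by presburger+
    obtain \<xi> where xi: "\<bar>\<xi>\<bar> \<le> \<bar>r'\<bar>" "g (y \<star> z) = (\<Sum>d<n3. F 0 0 d ?y2 / fact d * r' ^ d) +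
        F 0 0 n3 (?y2 \<star> hexp DZ \<xi>) / fact n3 * r' ^ n3"
      unfolding yz using taylor_hexp[of n3 DZ "[]" g r' ?y2 thesis] D n3
      by (force simp: F_def hword_def word_weight_def sum_list_replicate)
    have "N\<^sup>2 \<le> 1" using N by (simp add: power_le_one)
    then have "\<bar>\<xi>\<bar> \<le> 2\<^sup>2" using xi(1) coord(3) unfolding r'_def by simp
    then have "sqrt \<bar>\<xi>\<bar> \<le> 2" by (rule real_le_lsqrt[rotated]) auto
    \<comment> \<open>The Z factor has gauge at most 2 and the two others at most 1 each: this is
      the radius 4 in the hypothesis on derivatives.\<close>
    then have "hnorm (hexp DX p \<star> hexp DY q \<star> hexp DZ \<xi>) \<le> 4"
      using hnorm_hmul_le[of "hexp DX p \<star> hexp DY q" "hexp DZ \<xi>"] hnorm_hmul_le[of "hexp DX p" "hexp DY q"]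
        coord N by (simp only: hnorm_axis hexp.simps)
    then have "\<bar>F 0 0 n3 (?y2 \<star> hexp DZ \<xi>)\<bar> \<le> A"
      unfolding F_def using B[of "hword 0 0 n3" "hexp DX p \<star> hexp DY q \<star> hexp DZ \<xi>"] n3
      by (simp only: hmul_assoc word_weight_hword)
    from abs_fact_quotient_le[OF this, of n3 "r' ^ n3"]
    have "\<bar>g (y \<star> z) - (\<Sum>d<n3. F 0 0 d ?y2 / fact d * r' ^ d)\<bar> \<le> A * \<bar>r'\<bar> ^ n3"
      unfolding xi(2) by (simp add: power_abs)
    also have "\<dots> \<le> K"
      unfolding K_def using mono[of 0 0 n3] n3 A by (intro mult_left_mono) auto
    finally show ?thesis .
  qed
  have r2: "\<bar>(F 0 0 d ?y2 - (\<Sum>b<n - 2 * d. F 0 b d ?y1 / fact b * q ^ b)) / fact d * r' ^ d\<bar> \<le> K" if "d < n3" for d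
  proof -
    have le: "2 * d \<le> n" "d \<le> n" using that unfolding n3_def by auto
    have "\<bar>(F 0 0 d ?y2 - (\<Sum>b<n - 2 * d. F 0 b d ?y1 / fact b * q ^ b)) / fact d * r' ^ d\<bar> \<le> A * \<bar>q\<bar> ^ (n - 2 * d) * \<bar>r' ^ d\<bar>"
      by (rule abs_fact_quotient_le[OF step2]) (use le in auto)
    also have "\<dots> = A * (\<bar>p\<bar> ^ 0 * \<bar>q\<bar> ^ (n - 2 * d) * \<bar>r'\<bar> ^ d)" by (simp add: power_abs)
    also have "\<dots> \<le> K" unfolding K_def by (intro mult_left_mono mono A) (use le in auto)
    finally show ?thesis .
  qed
  have r3: "\<bar>(F 0 b d ?y1 - (\<Sum>a<n - 2 * d - b. F a b d y / fact a * p ^ a)) / fact b * q ^ b / fact d * r' ^ d\<bar> \<le> K"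
    if "d < n3" "b < n - 2 * d" for b d
  proof -
    have le: "2 * d + b \<le> n" "d \<le> n" using that unfolding n3_def by auto
    have "\<bar>(F 0 b d ?y1 - (\<Sum>a<n - 2 * d - b. F a b d y / fact a * p ^ a)) / fact b * q ^ b / fact d * r' ^ d\<bar>
        \<le> A * \<bar>p\<bar> ^ (n - 2 * d - b) * \<bar>q ^ b\<bar> * \<bar>r' ^ d\<bar>"
      by (intro abs_fact_quotient_le step3) (use le in auto)
    also have "\<dots> = A * (\<bar>p\<bar> ^ (n - 2 * d - b) * \<bar>q\<bar> ^ b * \<bar>r'\<bar> ^ d)" by (simp add: power_abs)
    also have "\<dots> \<le> K" unfolding K_def by (intro mult_left_mono mono A) (use le in auto)
    finally show ?thesis .
  qed
  have T: "htaylor n g y z = (\<Sum>d<n3. \<Sum>b<n - 2 * d. (\<Sum>a<n - 2 * d - b. F a b d y / fact a * p ^ a) / fact b * q ^ b / fact d * r' ^ d)"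
    unfolding htaylor_def fields prod.case F_def r'_def[symmetric] n3_def[symmetric]
    by (simp add: sum_distrib_left sum_distrib_right sum_divide_distrib mult_ac)
  \<comment> \<open>Telescoping: coefficients at \<open>?y2\<close> are replaced by their Y
    expansions at \<open>?y1\<close>, and those in turn by X expansions at \<open>y\<close>.\<close>
  have eq: "g (y \<star> z) - htaylor n g y z = (g (y \<star> z) - (\<Sum>d<n3. F 0 0 d ?y2 / fact d * r' ^ d))
     + (\<Sum>d<n3. (F 0 0 d ?y2 - (\<Sum>b<n - 2 * d. F 0 b d ?y1 / fact b * q ^ b)) / fact d * r' ^ d)
     + (\<Sum>d<n3. \<Sum>b<n - 2 * d. (F 0 b d ?y1 - (\<Sum>a<n - 2 * d - b. F a b d y / fact a * p ^ a)) / fact b * q ^ b / fact d * r' ^ d)"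
    unfolding T by (simp add: diff_divide_distrib left_diff_distrib sum_subtractf sum_divide_distrib sum_distrib_right)
  have s2: "\<bar>\<Sum>d<n3. (F 0 0 d ?y2 - (\<Sum>b<n - 2 * d. F 0 b d ?y1 / fact b * q ^ b)) / fact d * r' ^ d\<bar> \<le> real n3 * K"
    by (rule order_trans[OF sum_abs], rule order_trans[OF sum_mono[OF r2]]) auto
  have s3: "\<bar>\<Sum>d<n3. \<Sum>b<n - 2 * d. (F 0 b d ?y1 - (\<Sum>a<n - 2 * d - b. F a b d y / fact a * p ^ a)) / fact b * q ^ b / fact d * r' ^ d\<bar> \<le> real n3 * (real n * K)"
  proof (rule order_trans[OF sum_abs], rule order_trans[OF sum_mono])
    fix d assume d: "d \<in> {..<n3}"
    have "\<bar>\<Sum>b<n - 2 * d. (F 0 b d ?y1 - (\<Sum>a<n - 2 * d - b. F a b d y / fact a * p ^ a)) / fact b * q ^ b / fact d * r' ^ d\<bar> \<le> real (n - 2 * d) * K"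
      by (rule order_trans[OF sum_abs], rule order_trans[OF sum_mono[OF r3]]) (use d in auto)
    also have "\<dots> \<le> real n * K" by (intro mult_right_mono K) auto
    finally show "\<bar>\<Sum>b<n - 2 * d. (F 0 b d ?y1 - (\<Sum>a<n - 2 * d - b. F a b d y / fact a * p ^ a)) / fact b * q ^ b / fact d * r' ^ d\<bar> \<le> real n * K" .
  qed auto
  have "\<bar>g (y \<star> z) - htaylor n g y z\<bar> \<le> K + real n3 * K + real n3 * (real n * K)"
    unfolding eq using step1 s2 s3 by linarith
  also have "\<dots> \<le> K + real n * K + real n * (real n * K)"
    by (intro add_mono mult_right_mono) (use K in \<open>auto simp: n3_def\<close>)
  also have "\<dots> \<le> real ((n + 1) ^ 2) * K"
    using K by (simp add: power2_eq_square algebra_simps)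
  finally show ?thesis by (simp add: K_def N_def mult_ac)
qed

text \<open>Beyond the unit ball the highest monomials dominate; their degree is at most n - 1, and
  there are at most n^3 monomials.\<close>

lemma abs_htaylor_le:
  assumes B: "\<And>w. word_weight w \<le> n \<Longrightarrow> \<bar>iter_deriv left_field w g y\<bar> \<le> A"
    and z: "1 \<le> hnorm z"
  shows "\<bar>htaylor n g y z\<bar> \<le> real (n ^ 3) * 3 ^ n * A * hnorm z ^ (n - 1)"
proof (cases z)
  case (fields p q r)
  define N where "N = hnorm z"
  have N: "N = hnorm (p, q, r)" "1 \<le> N" using fields z by (auto simp: N_def)
  define K where "K = A * (3 ^ n * N ^ (n - 1))"
  have A: "0 \<le> A" using B[of "[]"] by (simp add: word_weight_def)
  have K: "0 \<le> K" using A N by (simp add: K_def)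
  have "\<bar>iter_deriv left_field (hword a b d) g y / (fact a * fact b * fact d) *
      (p ^ a * q ^ b * (r + 2 * p * q) ^ d)\<bar> \<le> K" (is "\<bar>?D / _ * _\<bar> \<le> K")
    if "d < (n + 1) div 2" "b < n - 2 * d" "a < n - 2 * d - b" for a b d
  proof -
    have "\<bar>?D\<bar> \<le> A" by (rule B) (use that in \<open>auto simp: word_weight_hword\<close>)
    from abs_fact_quotient_le[OF abs_fact_quotient_le[OF abs_fact_quotient_le[OF this, of a "p ^ a"], of b "q ^ b"],
        of d "(r + 2 * p * q) ^ d"]
    have "\<bar>?D / (fact a * fact b * fact d) * (p ^ a * q ^ b * (r + 2 * p * q) ^ d)\<bar>
        \<le> A * (\<bar>p\<bar> ^ a * \<bar>q\<bar> ^ b * \<bar>r + 2 * p * q\<bar> ^ d)"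
      by (simp add: power_abs mult_ac)
    also have "\<dots> \<le> A * (3 ^ n * N ^ (a + b + 2 * d))"
      by (intro mult_left_mono exp_monomial_le[OF N(1)] A) (use that in auto)
    also have "\<dots> \<le> K"
      unfolding K_def by (intro mult_left_mono power_increasing A) (use that N in auto)
    finally show ?thesis .
  qed
  then have "\<bar>htaylor n g y z\<bar> \<le> (\<Sum>d<(n + 1) div 2. \<Sum>b<n - 2 * d. \<Sum>a<n - 2 * d - b. K)"
    unfolding htaylor_def fields prod.case by (intro order_trans[OF sum_abs] sum_mono) auto
  also have "\<dots> \<le> (\<Sum>d<(n + 1) div 2. \<Sum>b<n - 2 * d. real n * K)"
    by (intro sum_mono) (auto intro!: mult_right_mono K)
  also have "\<dots> \<le> (\<Sum>d<(n + 1) div 2. real n * (real n * K))"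
    by (intro sum_mono) (auto intro!: mult_right_mono mult_nonneg_nonneg K)
  also have "\<dots> \<le> real n * (real n * (real n * K))"
    by (auto intro!: mult_right_mono mult_nonneg_nonneg K)
  finally show ?thesis by (simp add: K_def N_def power3_eq_cube mult_ac)
qed

section \<open>Derivatives of powers of the sub-Laplacian\<close>

text \<open>The sub-Laplacian acts before the letters of \<open>w\<close>, hence its own letters are
  appended at the end of the word.\<close>

lemma iter_deriv_sublap:
  assumes "iter_differentiable left_field (w @ [DX, DX]) g" "iter_differentiable left_field (w @ [DY, DY]) g"
  shows "iter_differentiable left_field w (sublap g) \<and> iter_deriv left_field w (sublap g) =
    (\<lambda>x. - (iter_deriv left_field (w @ [DX, DX]) g x + iter_deriv left_field (w @ [DY, DY]) g x))"
  using assms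
proof (induction w)
  case Nil
  then show ?case by (auto simp: sublap_def fun_eq_iff)
next
  case (Cons V w)
  let ?F = "iter_deriv left_field (w @ [DX, DX]) g" and ?G = "iter_deriv left_field (w @ [DY, DY]) g"
  have IH: "iter_differentiable left_field w (sublap g)"
    "iter_deriv left_field w (sublap g) = (\<lambda>x. - (?F x + ?G x))"
    using Cons by auto
  have D: "((\<lambda>t. - (?F (x + t *\<^sub>R left_field V x) + ?G (x + t *\<^sub>R left_field V x))) has_field_derivative
      - (along (left_field V) ?F x + along (left_field V) ?G x)) (at 0)" for x
    unfolding along_def
    by (intro DERIV_minus DERIV_add) (use Cons.prems in \<open>auto intro!: field_differentiable_derivI simp del: split_paired_All\<close>)
  have along: "along (left_field V) (\<lambda>x. - (?F x + ?G x)) x = - (along (left_field V) ?F x + along (left_field V) ?G x)" for x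
    unfolding along_def[of _ "\<lambda>x. - (?F x + ?G x)"] by (rule DERIV_imp_deriv[OF D])
  show ?case
    unfolding append_Cons iter_differentiable.simps iter_deriv.simps IH(2) field_differentiable_def
    by (intro conjI allI ext IH(1) along, rule exI, rule D)
qed

text \<open>Each application uses up weight two and, as a sum of two second-order terms, doubles the
  bound. The induction varies \<open>n\<close>, since the inner power must be controlled up to
  weight n + 2.\<close>

lemma sublap_power_bound:
  assumes "\<And>w. word_weight w < n + 2 * m \<Longrightarrow> iter_differentiable left_field w g"
    and "\<And>w x. word_weight w < n + 2 * m \<Longrightarrow> \<bar>iter_deriv left_field w g x\<bar> \<le> E x"
    and "word_weight w < n"
  shows "iter_differentiable left_field w ((sublap ^^ m) g) \<and>
    \<bar>iter_deriv left_field w ((sublap ^^ m) g) x\<bar> \<le> 2 ^ m * E x"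
  using assms
proof (induction m arbitrary: n w x)
  case (Suc m)
  let ?g = "(sublap ^^ m) g"
  have IH: "iter_differentiable left_field w' ?g \<and> \<bar>iter_deriv left_field w' ?g x\<bar> \<le> 2 ^ m * E x"
    if "word_weight w' < n + 2" for w' x
    by (rule Suc.IH[of "n + 2"]) (use Suc.prems that in auto)
  have w: "word_weight (w @ [V, V]) < n + 2" if "V = DX \<or> V = DY" for V
    using Suc.prems(3) that by (auto simp: word_weight_def)
  have "\<bar>iter_deriv left_field w (sublap ?g) x\<bar> \<le>
      \<bar>iter_deriv left_field (w @ [DX, DX]) ?g x\<bar> + \<bar>iter_deriv left_field (w @ [DY, DY]) ?g x\<bar>"
    using iter_deriv_sublap[of w ?g] IH w by simp
  also have "\<dots> \<le> 2 ^ m * E x + 2 ^ m * E x"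
    using IH w by (intro add_mono) auto
  finally show ?case
    using iter_deriv_sublap[of w ?g] IH w by (simp add: mult_ac)
qed auto

section \<open>Test functions and the fundamental lemma\<close>

text \<open>For \<open>P\<close> = 1 and \<open>n\<close> = 0 this is a classical cutoff, tending to
  the indicator of the interval as \<open>c\<close> tends to 0. The polynomial and the power of the
  reciprocal make the family closed under differentiation.\<close>

definition bump :: "real \<Rightarrow> real \<Rightarrow> real \<Rightarrow> real poly \<Rightarrow> nat \<Rightarrow> real \<Rightarrow> real"
  where "bump a b c P n t = (if a < t \<and> t < b
    then poly P t * (1 / ((t - a) * (b - t))) ^ n * exp (- c / ((t - a) * (b - t))) else 0)"

text \<open>A single term of the exponential series of c w is at most exp(c w).\<close>

lemma power_exp_bound:
  fixes c w :: real
  assumes "0 < c" "0 \<le> w"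
  shows "w ^ n * exp (- c * w) \<le> fact n / c ^ n"
proof -
  have "(c * w) ^ n / fact n \<le> exp (c * w)"
  proof -
    have s: "summable (\<lambda>k. (c * w) ^ k /\<^sub>R fact k)" by (rule summable_exp_generic)
    have "(\<Sum>k\<in>{n}. (c * w) ^ k /\<^sub>R fact k) \<le> (\<Sum>k. (c * w) ^ k /\<^sub>R fact k)"
      by (rule sum_le_suminf[OF s]) (use assms in auto)
    then show ?thesis by (simp add: exp_def divide_inverse mult.commute)
  qed
  then show ?thesis
    using assms by (simp add: exp_minus power_mult_distrib field_simps)
qed

text \<open>The exponential beats two more powers of the reciprocal \<open>w\<close> than are
  present; trading them for the squared distances to both end points gives the flatness needed to
  differentiate there.\<close>

lemma bump_le_square:
  assumes "a < b" "0 < c"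
  obtains K where "\<And>t. \<bar>bump a b c P n t\<bar> \<le> K * (t - a)\<^sup>2" "\<And>t. \<bar>bump a b c P n t\<bar> \<le> K * (t - b)\<^sup>2"
proof -
  have "compact (poly P ` {a..b})"
    by (intro compact_continuous_image continuous_intros) auto
  then have "bounded (poly P ` {a..b})" by (rule compact_imp_bounded)
  then obtain B where "\<forall>y\<in>poly P ` {a..b}. norm y \<le> B"
    unfolding bounded_iff by blast
  then have B: "\<And>t. t \<in> {a..b} \<Longrightarrow> \<bar>poly P t\<bar> \<le> B" by auto
  define K where "K = \<bar>B\<bar> * (fact (n + 2) / c ^ (n + 2)) * (b - a)\<^sup>2"
  have "0 \<le> K" using assms by (simp add: K_def)
  have *: "\<bar>bump a b c P n t\<bar> \<le> \<bar>B\<bar> * (fact (n + 2) / c ^ (n + 2)) * ((t - a)\<^sup>2 * (b - t)\<^sup>2)" if t: "a < t" "t < b" for t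
  proof -
    define w where "w = 1 / ((t - a) * (b - t))"
    have w: "0 < w" "(t - a)\<^sup>2 * (b - t)\<^sup>2 * w\<^sup>2 = 1"
      using t by (auto simp: w_def power_divide power_mult_distrib)
    have "\<bar>bump a b c P n t\<bar> = \<bar>poly P t\<bar> * ((w ^ n * exp (- c * w)))"
      using t w by (simp add: bump_def abs_mult w_def)
    also have "\<dots> \<le> \<bar>B\<bar> * (w ^ n * exp (- c * w))"
      using B[of t] t w by (intro mult_right_mono) auto
    also have "w ^ n * exp (- c * w) = (w ^ (n + 2) * exp (- c * w)) * ((t - a)\<^sup>2 * (b - t)\<^sup>2)"
      using w(2) by (simp only: power_add) (metis mult.assoc mult.commute mult.right_neutral)
    also have "\<bar>B\<bar> * \<dots> \<le> \<bar>B\<bar> * ((fact (n + 2) / c ^ (n + 2)) * ((t - a)\<^sup>2 * (b - t)\<^sup>2))"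
      using w assms by (intro mult_left_mono mult_right_mono power_exp_bound) auto
    finally show ?thesis by (simp only: mult.assoc)
  qed
  show ?thesis
  proof
    fix t
    have "\<bar>bump a b c P n t\<bar> \<le> K * (t - a)\<^sup>2 \<and> \<bar>bump a b c P n t\<bar> \<le> K * (t - b)\<^sup>2"
    proof (cases "a < t \<and> t < b")
      case True
      have m: "(t - a)\<^sup>2 * (b - t)\<^sup>2 \<le> (t - a)\<^sup>2 * (b - a)\<^sup>2" "(t - a)\<^sup>2 * (b - t)\<^sup>2 \<le> (b - a)\<^sup>2 * (b - t)\<^sup>2"
        using True by (auto intro!: mult_left_mono mult_right_mono power_mono)
      have nn: "0 \<le> \<bar>B\<bar> * (fact (n + 2) / c ^ (n + 2))" using assms by simp
      show ?thesis
        using order_trans[OF * mult_left_mono[OF m(1) nn]] order_trans[OF * mult_left_mono[OF m(2) nn]] True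
        unfolding K_def power2_commute[of t b] by (simp only: mult_ac)
    next
      case False
      then show ?thesis using \<open>0 \<le> K\<close> by (auto simp: bump_def)
    qed
    then show "\<bar>bump a b c P n t\<bar> \<le> K * (t - a)\<^sup>2" "\<bar>bump a b c P n t\<bar> \<le> K * (t - b)\<^sup>2" by auto
  qed
qed

lemma square_bound_imp_DERIV_0:
  fixes f :: "real \<Rightarrow> real"
  assumes "\<And>t. \<bar>f t\<bar> \<le> K * (t - a)\<^sup>2"
  shows "(f has_real_derivative 0) (at a)"
proof -
  have f0: "f a = 0" using assms[of a] by simp
  have "((\<lambda>h. \<bar>K\<bar> * \<bar>h\<bar>) \<longlongrightarrow> \<bar>K\<bar> * \<bar>0\<bar>) (at 0)" by (intro tendsto_intros)
  then have "((\<lambda>h. \<bar>K\<bar> * \<bar>h\<bar>) \<longlongrightarrow> 0) (at 0)" by simp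
  then have "((\<lambda>h. (f (a + h) - f a) / h) \<longlongrightarrow> 0) (at 0)"
  proof (rule Lim_null_comparison[rotated])
    show "\<forall>\<^sub>F h in at 0. norm ((f (a + h) - f a) / h) \<le> \<bar>K\<bar> * \<bar>h\<bar>"
    proof (rule eventuallyI)
      fix h
      have "\<bar>f (a + h)\<bar> \<le> \<bar>K\<bar> * h\<^sup>2"
        using assms[of "a + h"] by (smt (verit) mult_right_mono zero_le_power2 add_diff_cancel_left')
      then show "norm ((f (a + h) - f a) / h) \<le> \<bar>K\<bar> * \<bar>h\<bar>"
        by (cases "h = 0") (auto simp: f0 divide_simps power2_eq_square abs_mult_self_eq mult.assoc)
    qed
  qed
  then show ?thesis by (simp add: DERIV_def)
qed

lemma bump_DERIV:
  assumes "a < b" "0 < c"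
  obtains P' n' where "\<And>t. (bump a b c P n has_real_derivative bump a b c P' n' t) (at t)"
proof
  \<comment> \<open>\<open>?Q\<close> is (t - a)(b - t) and \<open>?L\<close> is minus its
    derivative, so w = 1 / \<open>?Q\<close> satisfies w' = \<open>?L\<close> w^2. Bringing all
    terms of the derivative to the common factor w^(n + 2) by means of \<open>?Q\<close> w = 1
    yields \<open>?P\<close>.\<close>
  let ?L = "[:- a - b, 2:]" and ?Q = "[:- (a * b), a + b, - 1:]"
  let ?P = "pderiv P * ?Q\<^sup>2 + smult (real n) (P * ?L * ?Q) - smult c (P * ?L)"
  fix t
  have Q: "poly ?Q t = (t - a) * (b - t)" for t by (simp add: algebra_simps)
  show "(bump a b c P n has_real_derivative bump a b c ?P (n + 2) t) (at t)"
  proof (cases "t = a \<or> t = b")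
    case True
    obtain K where "\<And>t. \<bar>bump a b c P n t\<bar> \<le> K * (t - a)\<^sup>2" "\<And>t. \<bar>bump a b c P n t\<bar> \<le> K * (t - b)\<^sup>2"
      using bump_le_square[OF assms] by blast
    with True have "(bump a b c P n has_real_derivative 0) (at t)"
      using square_bound_imp_DERIV_0 by blast
    then show ?thesis using True by (auto simp: bump_def)
  next
    case False
    show ?thesis
    proof (cases "a < t \<and> t < b")
      case True
      define w where "w = (\<lambda>t. 1 / poly ?Q t)"
      have Q0: "poly ?Q t \<noteq> 0" unfolding Q using True by simp
      have w1: "poly ?Q t * w t = 1" using Q0 by (simp add: w_def)
      have w: "(w has_real_derivative poly ?L t * (w t)\<^sup>2) (at t)"
      proof -
        have "((\<lambda>t. 1 / poly R t) has_real_derivative - poly (pderiv R) t * (1 / poly R t)\<^sup>2) (at t)"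
          if "poly R t \<noteq> 0" for R
          by (auto intro!: derivative_eq_intros that simp: power2_eq_square)
        from this[OF Q0] have "(w has_real_derivative - poly (pderiv ?Q) t * (w t)\<^sup>2) (at t)"
          by (simp only: w_def)
        moreover have "poly ?L t = - poly (pderiv ?Q) t" by (simp add: pderiv_pCons)
        ultimately show ?thesis by (simp only:)
      qed
      have "((\<lambda>t. poly P t * w t ^ n * exp (- c * w t)) has_real_derivative
          ((poly (pderiv P) t * w t ^ n + poly P t * (real n * w t ^ (n - 1) * (poly ?L t * (w t)\<^sup>2))) * exp (- c * w t)
           + poly P t * w t ^ n * (exp (- c * w t) * (- c * (poly ?L t * (w t)\<^sup>2))))) (at t)"
        by (auto intro!: derivative_eq_intros w simp: algebra_simps)
      also have "real n * w t ^ (n - 1) * (poly ?L t * (w t)\<^sup>2) = real n * w t ^ n * (poly ?L t * w t)"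
        by (cases n) (auto simp: power2_eq_square)
      also have "((poly (pderiv P) t * w t ^ n + poly P t * (real n * w t ^ n * (poly ?L t * w t))) * exp (- c * w t)
           + poly P t * w t ^ n * (exp (- c * w t) * (- c * (poly ?L t * (w t)\<^sup>2))))
           = (poly (pderiv P) t * (poly ?Q t * w t)\<^sup>2 + real n * poly P t * poly ?L t * (poly ?Q t * w t) * w t
              - c * poly P t * poly ?L t * (w t)\<^sup>2) * w t ^ n * exp (- c * w t)"
        unfolding w1 by (simp add: algebra_simps)
      also have "\<dots> = poly ?P t * w t ^ (n + 2) * exp (- c * w t)"
        by (simp only: poly_add poly_diff poly_mult poly_smult poly_power power_add power_mult_distrib power2_eq_square)
           (simp only: algebra_simps)
      also have "\<dots> = bump a b c ?P (n + 2) t"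
        using True by (simp only: bump_def w_def Q) simp
      finally show ?thesis
      proof (rule DERIV_cong_ev[THEN iffD1, rotated -1])
        have "\<forall>\<^sub>F s in nhds t. s \<in> {a<..<b}"
          using True by (intro eventually_nhds_in_open) auto
        then show "\<forall>\<^sub>F s in nhds t. poly P s * w s ^ n * exp (- c * w s) = bump a b c P n s"
          by eventually_elim (simp only: bump_def w_def Q, simp)
      qed auto
    next
      case out: False
      have "((\<lambda>_. 0 :: real) has_real_derivative bump a b c ?P (n + 2) t) (at t)"
        using out by (auto simp: bump_def)
      then show ?thesis
      proof (rule DERIV_cong_ev[THEN iffD1, rotated -1])
        have "\<forall>\<^sub>F s in nhds t. s \<in> {..<a} \<union> {b<..}"
          using out False by (intro eventually_nhds_in_open) auto
        then show "\<forall>\<^sub>F s in nhds t. 0 = bump a b c P n s"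
          by eventually_elim (auto simp: bump_def)
      qed auto
    qed
  qed
qed

text \<open>The witness is the entire sequence of derivatives, which suits families closed under
  differentiation better than iterating \<open>deriv\<close>.\<close>

definition smooth1 :: "(real \<Rightarrow> real) \<Rightarrow> bool"
  where "smooth1 f \<longleftrightarrow> (\<exists>D. D 0 = f \<and> (\<forall>n t. (D n has_real_derivative D (Suc n) t) (at t)))"

lemma smooth1_bump:
  assumes "a < b" "0 < c"
  shows "smooth1 (bump a b c P n)"
proof -
  \<comment> \<open>\<open>bump_DERIV\<close> asserts only that a next pair of polynomial and
    exponent exists, so the sequence of pairs is built by choice.\<close>
  define D where "D = rec_nat (P, n) (\<lambda>_ (P, n). SOME (P', n'). \<forall>t. (bump a b c P n has_real_derivative bump a b c P' n' t) (at t))"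
  have "(bump a b c (fst (D k)) (snd (D k)) has_real_derivative bump a b c (fst (D (Suc k))) (snd (D (Suc k))) t) (at t)" for k t
  proof -
    have "\<exists>Pn. case Pn of (P', n') \<Rightarrow> \<forall>t. (bump a b c (fst (D k)) (snd (D k)) has_real_derivative bump a b c P' n' t) (at t)"
    proof -
      obtain P' n' where "\<And>t. (bump a b c (fst (D k)) (snd (D k)) has_real_derivative bump a b c P' n' t) (at t)"
        using bump_DERIV[OF assms] by blast
      then show ?thesis by (intro exI[of _ "(P', n')"]) simp
    qed
    from someI_ex[OF this] show ?thesis by (simp add: D_def case_prod_unfold)
  qed
  then show ?thesis
    unfolding smooth1_def by (intro exI[of _ "\<lambda>k. bump a b c (fst (D k)) (snd (D k))"]) (auto simp: D_def)
qed

section \<open>Product test functions\<close>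

lemma Basis_heis: "(Basis :: heis set) = {(1, 0, 0), (0, 1, 0), (0, 0, 1)}"
  by (auto simp: Basis_prod_def zero_prod_def)

text \<open>A partial derivative raises one index of \<open>F i j k\<close>. Hence all iterated
  partials stay in this family of continuous functions, whatever the order of the letters.\<close>

lemma smooth_tensor:
  assumes "smooth1 f1" "smooth1 f2" "smooth1 f3"
  shows "smooth (\<lambda>(p, q, r). f1 p * f2 q * f3 r)"
proof -
  obtain D1 D2 D3 where D: "D1 0 = f1" "D2 0 = f2" "D3 0 = f3"
    and der: "\<And>n t. (D1 n has_real_derivative D1 (Suc n) t) (at t)"
      "\<And>n t. (D2 n has_real_derivative D2 (Suc n) t) (at t)"
      "\<And>n t. (D3 n has_real_derivative D3 (Suc n) t) (at t)"
    using assms unfolding smooth1_def by blast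
  define F where "F = (\<lambda>i j k x. D1 i (fst x) * D2 j (fst (snd x)) * D3 k (snd (snd x)))"
  have F0: "(\<lambda>(p, q, r). f1 p * f2 q * f3 r) = F 0 0 0"
    by (auto simp: F_def D)
  have cont: "continuous_on UNIV (F i j k)" for i j k
  proof -
    have c: "continuous_on UNIV (D1 i)" "continuous_on UNIV (D2 j)" "continuous_on UNIV (D3 k)"
      by (rule DERIV_continuous_on, rule has_field_derivative_at_within, rule der)+
    have "continuous_on UNIV (\<lambda>x::heis. D1 i (fst x))" "continuous_on UNIV (\<lambda>x::heis. D2 j (fst (snd x)))"
      "continuous_on UNIV (\<lambda>x::heis. D3 k (snd (snd x)))"
      using continuous_on_compose2[OF c(1), of UNIV "fst :: heis \<Rightarrow> _"]
        continuous_on_compose2[OF c(2), of UNIV "\<lambda>x::heis. fst (snd x)"]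
        continuous_on_compose2[OF c(3), of UNIV "\<lambda>x::heis. snd (snd x)"]
      by (simp_all add: continuous_intros)
    then show ?thesis
      unfolding F_def by (intro continuous_on_mult)
  qed
  have dF: "((\<lambda>t. F i j k (x + t *\<^sub>R (1, 0, 0))) has_real_derivative F (Suc i) j k x) (at 0)"
    "((\<lambda>t. F i j k (x + t *\<^sub>R (0, 1, 0))) has_real_derivative F i (Suc j) k x) (at 0)"
    "((\<lambda>t. F i j k (x + t *\<^sub>R (0, 0, 1))) has_real_derivative F i j (Suc k) x) (at 0)" for i j k x
  proof -
    have shift: "((\<lambda>t. a * g (y + t) * b) has_real_derivative a * g' * b) (at 0)"
      if "(g has_real_derivative g') (at y)" for g g' and y a b :: real
    proof -
      have "((\<lambda>t. g (y + t)) has_real_derivative g') (at 0)"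
        using that DERIV_shift[of g g' 0 y] by (simp add: add.commute)
      then show ?thesis by (intro DERIV_cmult_right DERIV_cmult)
    qed
    show "((\<lambda>t. F i j k (x + t *\<^sub>R (1, 0, 0))) has_real_derivative F (Suc i) j k x) (at 0)"
      using shift[OF der(1), where a = 1 and b = "D2 j (fst (snd x)) * D3 k (snd (snd x))" and y = "fst x"]
      by (simp add: F_def mult.assoc)
    show "((\<lambda>t. F i j k (x + t *\<^sub>R (0, 1, 0))) has_real_derivative F i (Suc j) k x) (at 0)"
      using shift[OF der(2), where a = "D1 i (fst x)" and b = "D3 k (snd (snd x))" and y = "fst (snd x)"]
      by (simp add: F_def)
    show "((\<lambda>t. F i j k (x + t *\<^sub>R (0, 0, 1))) has_real_derivative F i j (Suc k) x) (at 0)"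
      using shift[OF der(3), where a = "D1 i (fst x) * D2 j (fst (snd x))" and b = 1 and y = "snd (snd x)"]
      by (simp add: F_def)
  qed
  have "iter_differentiable (\<lambda>b _. b) w (F 0 0 0) \<and> (\<exists>i j k. iter_deriv (\<lambda>b _. b) w (F 0 0 0) = F i j k)"
    if "set w \<subseteq> Basis" for w
    using that
  proof (induction w)
    case (Cons e w)
    then obtain i j k where IH: "iter_differentiable (\<lambda>b _. b) w (F 0 0 0)" "iter_deriv (\<lambda>b _. b) w (F 0 0 0) = F i j k"
      by auto
    have "e \<in> Basis" using Cons.prems by simp
    then consider "e = (1, 0, 0)" | "e = (0, 1, 0)" | "e = (0, 0, 1)"
      unfolding Basis_heis by blast
    then obtain i' j' k' where d: "\<And>x. ((\<lambda>t. F i j k (x + t *\<^sub>R e)) has_real_derivative F i' j' k' x) (at 0)"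
      using that[of "Suc i" j k] that[of i "Suc j" k] that[of i j "Suc k"] by cases (simp_all only: dF)
    have "along (\<lambda>_. e) (F i j k) = F i' j' k'"
      unfolding along_def by (rule ext) (rule DERIV_imp_deriv[OF d])
    moreover have "\<forall>x. (\<lambda>t. F i j k (x + t *\<^sub>R e)) field_differentiable at 0"
      using d unfolding field_differentiable_def by blast
    ultimately show ?case
      by (simp only: iter_differentiable.simps iter_deriv.simps IH) blast
  qed auto
  note * = this
  show ?thesis
    unfolding smooth_def F0
  proof (intro allI impI)
    fix w :: "heis list" assume "set w \<subseteq> Basis"
    from *[OF this] obtain i j k where "iter_differentiable (\<lambda>b _. b) w (F 0 0 0)"
      "iter_deriv (\<lambda>b _. b) w (F 0 0 0) = F i j k" by blast
    then show "iter_differentiable (\<lambda>b _. b) w (F 0 0 0) \<and> continuous_on UNIV (iter_deriv (\<lambda>b _. b) w (F 0 0 0))"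
      using cont by simp
  qed
qed

lemma iter_deriv_diff_scaled:
  assumes "iter_differentiable W w f" "iter_differentiable W w g"
  shows "iter_differentiable W w (\<lambda>x. f x - c * g x) \<and>
    iter_deriv W w (\<lambda>x. f x - c * g x) = (\<lambda>x. iter_deriv W w f x - c * iter_deriv W w g x)"
  using assms
proof (induction w)
  case (Cons V w)
  let ?F = "iter_deriv W w f" and ?G = "iter_deriv W w g"
  have IH: "iter_differentiable W w (\<lambda>x. f x - c * g x)"
    "iter_deriv W w (\<lambda>x. f x - c * g x) = (\<lambda>x. ?F x - c * ?G x)"
    using Cons by auto
  have D: "((\<lambda>t. ?F (x + t *\<^sub>R W V x) - c * ?G (x + t *\<^sub>R W V x)) has_field_derivative
      along (W V) ?F x - c * along (W V) ?G x) (at 0)" for x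
    unfolding along_def
    by (intro DERIV_diff DERIV_cmult) (use Cons.prems in \<open>auto intro!: field_differentiable_derivI simp del: split_paired_All\<close>)
  have along: "along (W V) (\<lambda>x. ?F x - c * ?G x) x = along (W V) ?F x - c * along (W V) ?G x" for x
    unfolding along_def[of _ "\<lambda>x. ?F x - c * ?G x"] by (rule DERIV_imp_deriv[OF D])
  show ?case
    unfolding iter_differentiable.simps iter_deriv.simps IH(2) field_differentiable_def
    by (intro conjI allI ext IH(1) along, rule exI, rule D)
qed auto

text \<open>Closure under \<phi> - c \<psi> is the form of the subspace property that
  \<open>functional_in_span\<close> uses.\<close>

lemma test_functions_diff_scaled:
  assumes "\<phi> \<in> test_functions" "\<psi> \<in> test_functions"
  shows "(\<lambda>x. \<phi> x - c * \<psi> x) \<in> test_functions"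
proof -
  have sm: "smooth \<phi>" "smooth \<psi>" and cp: "compact (closure {x. \<phi> x \<noteq> 0})" "compact (closure {x. \<psi> x \<noteq> 0})"
    using assms by (auto simp: test_functions_def)
  have "smooth (\<lambda>x. \<phi> x - c * \<psi> x)"
    unfolding smooth_def
  proof (intro allI impI)
    fix w :: "heis list" assume w: "set w \<subseteq> Basis"
    have d: "iter_differentiable (\<lambda>b _. b) w \<phi>" "iter_differentiable (\<lambda>b _. b) w \<psi>"
      "continuous_on UNIV (iter_deriv (\<lambda>b _. b) w \<phi>)" "continuous_on UNIV (iter_deriv (\<lambda>b _. b) w \<psi>)"
      using sm w unfolding smooth_def by simp_all
    show "iter_differentiable (\<lambda>b _. b) w (\<lambda>x. \<phi> x - c * \<psi> x) \<and>
        continuous_on UNIV (iter_deriv (\<lambda>b _. b) w (\<lambda>x. \<phi> x - c * \<psi> x))"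
      using iter_deriv_diff_scaled[OF d(1,2), of c] d(3,4) by (simp add: continuous_intros)
  qed
  moreover have sub: "closure {x. \<phi> x - c * \<psi> x \<noteq> 0} \<subseteq> closure {x. \<phi> x \<noteq> 0} \<union> closure {x. \<psi> x \<noteq> 0}"
    unfolding closure_Un[symmetric] by (rule closure_mono) auto
  have "compact ((closure {x. \<phi> x \<noteq> 0} \<union> closure {x. \<psi> x \<noteq> 0}) \<inter> closure {x. \<phi> x - c * \<psi> x \<noteq> 0})"
    by (intro compact_Int_closed compact_Un cp closed_closure)
  then have "compact (closure {x. \<phi> x - c * \<psi> x \<noteq> 0})"
    unfolding Int_absorb1[OF sub] .
  ultimately show ?thesis by (simp add: test_functions_def)
qed

lemma test_functions_continuous: "\<phi> \<in> test_functions \<Longrightarrow> continuous_on UNIV \<phi>"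
  unfolding test_functions_def smooth_def by (auto dest: spec[of _ "[]"])

lemma test_functions_bounded:
  assumes "\<phi> \<in> test_functions"
  obtains K B where "compact K" "\<And>x. \<bar>\<phi> x\<bar> \<le> B * indicator K x" "0 \<le> B"
proof -
  define K where "K = closure {x. \<phi> x \<noteq> 0}"
  have K: "compact K" using assms by (simp add: test_functions_def K_def)
  then have "compact (\<phi> ` K)"
    by (intro compact_continuous_image continuous_on_subset[OF test_functions_continuous[OF assms]]) auto
  then have "bounded (\<phi> ` K)" by (rule compact_imp_bounded)
  then obtain B where "\<forall>y\<in>\<phi> ` K. norm y \<le> B"
    unfolding bounded_iff by blast
  then have B: "\<And>x. x \<in> K \<Longrightarrow> \<bar>\<phi> x\<bar> \<le> B" by auto
  have "\<phi> x = 0" if "x \<notin> K" for x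
    using that closure_subset[of "{x. \<phi> x \<noteq> 0}"] by (auto simp: K_def)
  then have "\<bar>\<phi> x\<bar> \<le> \<bar>B\<bar> * indicator K x" for x
    using B[of x] by (cases "x \<in> K") auto
  then show ?thesis by (intro that[OF K, of "\<bar>B\<bar>"]) auto
qed

section \<open>The fundamental lemma of the calculus of variations\<close>

definition locally_integrable :: "(heis \<Rightarrow> real) \<Rightarrow> bool"
  where "locally_integrable g \<longleftrightarrow> (\<forall>K. compact K \<longrightarrow> set_integrable lebesgue K g)"

lemma borel_measurable_lebesgueI: "continuous_on UNIV \<phi> \<Longrightarrow> \<phi> \<in> borel_measurable lebesgue"
  for \<phi> :: "heis \<Rightarrow> real"
  by (simp add: borel_measurable_continuous_onI measurable_completion)

lemma integrable_mult_test:
  assumes g: "locally_integrable g" and \<phi>: "\<phi> \<in> test_functions"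
  shows "integrable lebesgue (\<lambda>x. g x * \<phi> x)"
proof -
  obtain K B where K: "compact K" "\<And>x. \<bar>\<phi> x\<bar> \<le> B * indicator K x" "0 \<le> B"
    using test_functions_bounded[OF \<phi>] by blast
  have gK: "integrable lebesgue (\<lambda>x. indicator K x * g x)"
    using g K unfolding locally_integrable_def set_integrable_def by auto
  have eq: "g x * \<phi> x = (indicator K x * g x) * \<phi> x" for x
    using K(2)[of x] by (cases "x \<in> K") auto
  show ?thesis
    unfolding eq
  proof (rule Bochner_Integration.integrable_bound)
    show "integrable lebesgue (\<lambda>x. B * (indicator K x * g x))" using gK by simp
    show "(\<lambda>x. indicator K x * g x * \<phi> x) \<in> borel_measurable lebesgue"
      using gK borel_measurable_lebesgueI[OF test_functions_continuous[OF \<phi>]] by auto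
    show "AE x in lebesgue. norm (indicator K x * g x * \<phi> x) \<le> norm (B * (indicator K x * g x))"
    proof (rule AE_I2)
      fix x
      have "\<bar>\<phi> x\<bar> \<le> B" using K(2)[of x] K(3) by (cases "x \<in> K") auto
      then show "norm (indicator K x * g x * \<phi> x) \<le> norm (B * (indicator K x * g x))"
        using K(3) mult_right_mono[of "\<bar>\<phi> x\<bar>" B "\<bar>indicator K x * g x\<bar>"]
        by (simp add: abs_mult mult_ac)
    qed
  qed
qed

text \<open>Products of three bumps with parameter 1 / (n + 1) are test functions between 0 and the
  indicator of the box, and converge to it pointwise. Dominated convergence applies, |g| on the
  closed box being integrable.\<close>

lemma box_integral_0:
  assumes g: "locally_integrable g"
    and 0: "\<And>\<phi>. \<phi> \<in> test_functions \<Longrightarrow> (LINT x|lebesgue. g x * \<phi> x) = 0"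
  shows "(LINT x|lebesgue. indicator (box a b) x * g x) = 0"
proof (cases "box a b = {}")
  case False
  obtain a1 a2 a3 b1 b2 b3 where ab: "a = (a1, a2, a3)" "b = (b1, b2, b3)" by (cases a; cases b)
  have box: "(p, q, r) \<in> box a b \<longleftrightarrow> a1 < p \<and> p < b1 \<and> a2 < q \<and> q < b2 \<and> a3 < r \<and> r < b3" for p q r
    unfolding ab by (auto simp: mem_box Basis_heis)
  obtain x where "x \<in> box a b" using False by blast
  then have lt: "a1 < b1" "a2 < b2" "a3 < b3" using box by (cases x; auto)+
  define \<eta> where "\<eta> = (\<lambda>n u v. bump u v (1 / real (Suc n)) [:1:] 0)"
  define \<phi> where "\<phi> = (\<lambda>n (p, q, r). \<eta> n a1 b1 p * \<eta> n a2 b2 q * \<eta> n a3 b3 r)"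
  have \<eta>01: "0 \<le> \<eta> n u v t" "\<eta> n u v t \<le> 1" for n u v t
    by (auto simp: \<eta>_def bump_def)
  have \<phi>01: "\<bar>\<phi> n x\<bar> \<le> indicator (box a b) x" for n x
  proof (cases x)
    case (fields p q r)
    show ?thesis
    proof (cases "x \<in> box a b")
      case True
      have "\<eta> n a1 b1 p * \<eta> n a2 b2 q * \<eta> n a3 b3 r \<le> 1 * 1 * 1"
        by (intro mult_mono \<eta>01 mult_nonneg_nonneg) auto
      then show ?thesis using True \<eta>01 by (simp add: \<phi>_def fields)
    next
      case False
      then have "\<phi> n x = 0" using box[of p q r] by (auto simp: fields \<phi>_def \<eta>_def bump_def)
      then show ?thesis by simp
    qed
  qed
  have test: "\<phi> n \<in> test_functions" for n
  proof -
    have "smooth (\<phi> n)"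
      unfolding \<phi>_def \<eta>_def by (intro smooth_tensor smooth1_bump lt) auto
    moreover have "{x. \<phi> n x \<noteq> 0} \<subseteq> cbox a b"
    proof (rule subsetI)
      fix x assume "x \<in> {x. \<phi> n x \<noteq> 0}"
      then have "x \<in> box a b" using \<phi>01[of n x] by (cases "x \<in> box a b") auto
      then show "x \<in> cbox a b" using box_subset_cbox by blast
    qed
    then have "closure {x. \<phi> n x \<noteq> 0} \<subseteq> cbox a b"
      by (rule closure_minimal) auto
    then have "compact (closure {x. \<phi> n x \<noteq> 0})"
      using compact_Int_closed[OF compact_cbox closed_closure, of a b "{x. \<phi> n x \<noteq> 0}"]
      by (simp add: Int_absorb1)
    ultimately show ?thesis by (simp add: test_functions_def)
  qed
  have lim: "(\<lambda>n. \<phi> n x) \<longlonglongrightarrow> indicator (box a b) x" for x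
  proof (cases x)
    case (fields p q r)
    have \<eta>lim: "(\<lambda>n. \<eta> n u v t) \<longlonglongrightarrow> (if u < t \<and> t < v then 1 else 0)" for u v t
    proof (cases "u < t \<and> t < v")
      case True
      have "(\<lambda>n. exp (- (1 / real (Suc n)) / ((t - u) * (v - t)))) \<longlonglongrightarrow> exp (- 0 / ((t - u) * (v - t)))"
        by (intro tendsto_intros LIMSEQ_Suc lim_1_over_n) (use True in auto)
      then show ?thesis using True by (simp add: \<eta>_def bump_def)
    next
      case False
      then have "\<eta> n u v t = 0" for n unfolding \<eta>_def bump_def by (simp only: if_False)
      then show ?thesis using False by (simp only: if_False tendsto_const)
    qed
    have "(\<lambda>n. \<eta> n a1 b1 p * \<eta> n a2 b2 q * \<eta> n a3 b3 r) \<longlonglongrightarrow>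
      (if a1 < p \<and> p < b1 then 1 else 0) * (if a2 < q \<and> q < b2 then 1 else 0) * (if a3 < r \<and> r < b3 then 1 else 0)"
      by (intro tendsto_mult \<eta>lim)
    then show ?thesis
      using box[of p q r] by (auto simp: \<phi>_def fields indicator_def split: if_splits)
  qed
  have gK: "integrable lebesgue (\<lambda>x. indicator (cbox a b) x * g x)"
    using g compact_cbox[of a b] unfolding locally_integrable_def set_integrable_def real_scaleR_def by blast
  have gb: "(\<lambda>x. indicator (box a b) x * g x) \<in> borel_measurable lebesgue"
  proof -
    have "(\<lambda>x. indicator (box a b) x * (indicator (cbox a b) x * g x)) \<in> borel_measurable lebesgue"
      by (rule borel_measurable_times[OF borel_measurable_indicator borel_measurable_integrable[OF gK]]) auto
    moreover have "indicator (box a b) x * (indicator (cbox a b) x * g x) = indicator (box a b) x * g x" for x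
      using box_subset_cbox[of a b] by (auto simp: indicator_def)
    ultimately show ?thesis by simp
  qed
  have "(\<lambda>n. LINT x|lebesgue. g x * \<phi> n x) \<longlonglongrightarrow> (LINT x|lebesgue. indicator (box a b) x * g x)"
  proof (rule integral_dominated_convergence)
    show "integrable lebesgue (\<lambda>x. \<bar>indicator (cbox a b) x * g x\<bar>)" using gK by (rule integrable_abs)
    show "(\<lambda>x. g x * \<phi> n x) \<in> borel_measurable lebesgue" for n
      using integrable_mult_test[OF g test] by auto
    show "AE x in lebesgue. (\<lambda>n. g x * \<phi> n x) \<longlonglongrightarrow> indicator (box a b) x * g x"
      using tendsto_mult[OF tendsto_const lim] by (intro AE_I2) (simp add: mult.commute)
    show "AE x in lebesgue. norm (g x * \<phi> n x) \<le> \<bar>indicator (cbox a b) x * g x\<bar>" for n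
    proof (rule AE_I2)
      fix x
      have "\<bar>\<phi> n x\<bar> \<le> indicator (cbox a b) x"
        using \<phi>01[of n x] box_subset_cbox[of a b] by (cases "x \<in> box a b") auto
      then show "norm (g x * \<phi> n x) \<le> \<bar>indicator (cbox a b) x * g x\<bar>"
        by (simp add: abs_mult mult.commute mult_left_mono)
    qed
  qed (rule gb)
  then show ?thesis using 0[OF test] by (simp add: LIMSEQ_const_iff)
qed simp

text \<open>On a fixed box the integrals of \<open>g\<close> over all smaller boxes vanish. Boxes
  are stable under intersection and generate the Borel sets, so the integral over every Borel set
  vanishes and the density is 0; countably many boxes then exhaust the space.\<close>

lemma fundamental_lemma:
  assumes g: "locally_integrable g"
    and 0: "\<And>\<phi>. \<phi> \<in> test_functions \<Longrightarrow> (LINT x|lebesgue. g x * \<phi> x) = 0"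
  shows "AE x in lebesgue. g x = 0"
proof -
  have "AE x in lebesgue. x \<in> box u v \<longrightarrow> g x = 0" for u v
  proof -
    define h where "h = (\<lambda>x. indicator (box u v) x * g x)"
    have "integrable lebesgue (\<lambda>x. indicator (box u v) x * (indicator (cbox u v) x * g x))"
    proof -
      have "integrable lebesgue (\<lambda>x. indicator (cbox u v) x *\<^sub>R g x)"
        using g compact_cbox[of u v] unfolding locally_integrable_def set_integrable_def by blast
      then have "integrable lebesgue (\<lambda>x. indicator (box u v) x *\<^sub>R (indicator (cbox u v) x *\<^sub>R g x))"
        by (rule integrable_mult_indicator[rotated]) auto
      then show ?thesis by simp
    qed
    moreover have "indicator (box u v) x * (indicator (cbox u v) x * g x) = h x" for x
      using box_subset_cbox[of u v] by (auto simp: h_def indicator_def)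
    ultimately have h: "integrable lebesgue h" by simp
    \<comment> \<open>A Borel version of \<open>h\<close> is taken because the sigma-algebra
      generated by boxes is the Borel one, not its completion.\<close>
    then obtain h' where h': "h' \<in> borel_measurable lborel" "AE x in lborel. h x = h' x"
      using completion_ex_borel_measurable_real[of h lborel] by auto
    have AE: "AE x in lebesgue. h x = h' x" using h'(2) by (rule AE_completion)
    have hm: "h \<in> borel_measurable lebesgue" "h' \<in> borel_measurable lebesgue"
      using h h'(1) by (auto intro: measurable_completion)
    have int: "integrable lborel h'"
    proof -
      have "integrable lebesgue h'"
        using h h'(1) AE by (subst integrable_cong_AE[symmetric]) (auto intro: measurable_completion)
      then show ?thesis using h'(1) integrable_completion by blast
    qed
    have int': "set_integrable lborel A h'" if "A \<in> sets borel" for A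
      using int that unfolding set_integrable_def by (intro integrable_mult_indicator) auto
    have bx: "(LINT x:box c d|lborel. h' x) = 0" for c d
    proof -
      have "(LINT x:box c d|lborel. h' x) = (LINT x|lebesgue. indicator (box c d) x * h' x)"
        unfolding set_lebesgue_integral_def using h'(1) by (subst integral_completion) auto
      also have "\<dots> = (LINT x|lebesgue. indicator (box c d) x * h x)"
        using AE hm by (intro integral_cong_AE borel_measurable_times borel_measurable_indicator) auto
      also have "\<dots> = (LINT x|lebesgue. indicator (box c d \<inter> box u v) x * g x)"
        by (simp add: h_def indicator_inter_arith mult.assoc)
      also have "\<dots> = 0"
        unfolding box_Int_box by (rule box_integral_0[OF assms])
      finally show ?thesis .
    qed
    \<comment> \<open>The integral over the whole space is what the complement case of the induction
      on Borel sets subtracts from.\<close>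
    have total: "(LINT x|lborel. h' x) = 0"
    proof -
      have "(LINT x|lborel. h' x) = (LINT x|lebesgue. h' x)"
        using h'(1) by (subst integral_completion) auto
      also have "\<dots> = (LINT x|lebesgue. h x)"
        using AE hm by (intro integral_cong_AE) auto
      also have "\<dots> = 0" unfolding h_def by (rule box_integral_0[OF assms])
      finally show ?thesis .
    qed
    have "(LINT x:A|lborel. h' x) = 0" if A: "A \<in> sets borel" for A
    proof -
      have "Int_stable (range (\<lambda>(a, b). box a b :: heis set))"
        by (auto simp: Int_stable_def box_Int_box)
      moreover have "range (\<lambda>(a, b). box a b :: heis set) \<subseteq> Pow UNIV" by simp
      moreover have "A \<in> sigma_sets UNIV (range (\<lambda>(a, b). box a b :: heis set))"
        using A by (simp add: borel_eq_box)
      ultimately show ?thesis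
      proof (induction rule: sigma_sets_induct_disjoint)
        case (basic A)
        then show ?case using bx by auto
      next
        case empty
        then show ?case by (simp add: set_lebesgue_integral_def)
      next
        case (compl A)
        have "A \<in> sets borel" using compl(1) by (simp add: borel_eq_box)
        then have "(LINT x:A \<union> (UNIV - A)|lborel. h' x) = (LINT x:A|lborel. h' x) + (LINT x:UNIV - A|lborel. h' x)"
          by (intro set_integral_Un int') auto
        then show ?case using compl(2) total by (simp add: set_lebesgue_integral_def)
      next
        case (union A)
        have A: "A i \<in> sets borel" for i using union(2) by (auto simp: borel_eq_box)
        have "(LINT x:(\<Union>i. A i)|lborel. h' x) = (\<Sum>i. (LINT x:(A i)|lborel. h' x))"
          using union(1) A by (intro lebesgue_integral_countable_add int') (auto simp: disjoint_family_on_def)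
        then show ?case using union(3) by simp
      qed
    qed
    then have "AE x in lborel. h' x = 0"
      by (intro sigma_finite_measure.density_zero[OF sigma_finite_lborel] int) auto
    then have "AE x in lebesgue. h' x = 0" by (rule AE_completion)
    with AE show ?thesis by eventually_elim (auto simp: h_def)
  qed
  note AE_box = this
  have "AE x in lebesgue. \<forall>n::nat. x \<in> box (- (real n *\<^sub>R One)) (real n *\<^sub>R One) \<longrightarrow> g x = 0"
    unfolding AE_all_countable using AE_box by blast
  then show ?thesis
  proof eventually_elim
    case (elim x)
    have "x \<in> (\<Union>n::nat. box (- (real n *\<^sub>R One)) (real n *\<^sub>R One))"
      unfolding UN_box_eq_UNIV by simp
    with elim show ?case by blast
  qed
qed

section \<open>Functions determined by vanishing moments\<close>

text \<open>Induction on the number of functionals. If some \<psi> is killed by all of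
  \<open>I\<close> but not by \<open>l j\<close>, subtracting the right multiple of
  \<open>l j\<close> from \<open>L\<close> reduces to \<open>I\<close>. Otherwise \<open>l j\<close>
  vanishes on the common kernel of \<open>I\<close> and gets coefficient 0.\<close>

lemma functional_in_span:
  fixes l :: "'i \<Rightarrow> ('a \<Rightarrow> real) \<Rightarrow> real"
  assumes "finite I"
    and V: "\<And>\<phi> \<psi> c. \<phi> \<in> V \<Longrightarrow> \<psi> \<in> V \<Longrightarrow> (\<lambda>x. \<phi> x - c * \<psi> x) \<in> V"
    and l: "\<And>i \<phi> \<psi> c. \<phi> \<in> V \<Longrightarrow> \<psi> \<in> V \<Longrightarrow> l i (\<lambda>x. \<phi> x - c * \<psi> x) = l i \<phi> - c * l i \<psi>"
    and L: "\<And>\<phi> \<psi> c. \<phi> \<in> V \<Longrightarrow> \<psi> \<in> V \<Longrightarrow> L (\<lambda>x. \<phi> x - c * \<psi> x) = L \<phi> - c * L \<psi>"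
    and 0: "\<And>\<phi>. \<phi> \<in> V \<Longrightarrow> (\<And>i. i \<in> I \<Longrightarrow> l i \<phi> = 0) \<Longrightarrow> L \<phi> = 0"
  shows "\<exists>c. \<forall>\<phi>\<in>V. L \<phi> = (\<Sum>i\<in>I. c i * l i \<phi>)"
  using assms(1) L 0
proof (induction I arbitrary: L rule: finite_induct)
  case (insert j I)
  show ?case
  proof (cases "\<exists>\<psi>\<in>V. (\<forall>i\<in>I. l i \<psi> = 0) \<and> l j \<psi> \<noteq> 0")
    case True
    then obtain \<psi> where \<psi>: "\<psi> \<in> V" "\<And>i. i \<in> I \<Longrightarrow> l i \<psi> = 0" "l j \<psi> \<noteq> 0" by blast
    define k where "k = L \<psi> / l j \<psi>"
    have "\<exists>c. \<forall>\<phi>\<in>V. L \<phi> - k * l j \<phi> = (\<Sum>i\<in>I. c i * l i \<phi>)"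
    proof (rule insert.IH)
      fix \<phi> assume \<phi>: "\<phi> \<in> V" "\<And>i. i \<in> I \<Longrightarrow> l i \<phi> = 0"
      define m where "m = l j \<phi> / l j \<psi>"
      have "l i (\<lambda>x. \<phi> x - m * \<psi> x) = 0" if "i \<in> insert j I" for i
        unfolding l[OF \<phi>(1) \<psi>(1)] using that \<phi>(2) \<psi>(2,3) by (auto simp: m_def)
      then have "L (\<lambda>x. \<phi> x - m * \<psi> x) = 0"
        by (intro insert.prems(2) V \<phi>(1) \<psi>(1))
      then show "L \<phi> - k * l j \<phi> = 0"
        using insert.prems(1)[OF \<phi>(1) \<psi>(1), of m] by (simp add: k_def m_def mult.commute)
    qed (simp add: insert.prems(1) l algebra_simps)
    then obtain c where c: "\<And>\<phi>. \<phi> \<in> V \<Longrightarrow> L \<phi> - k * l j \<phi> = (\<Sum>i\<in>I. c i * l i \<phi>)" by blast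
    have "L \<phi> = (\<Sum>i\<in>insert j I. (c(j := k)) i * l i \<phi>)" if "\<phi> \<in> V" for \<phi>
    proof -
      have "(\<Sum>i\<in>I. (c(j := k)) i * l i \<phi>) = (\<Sum>i\<in>I. c i * l i \<phi>)"
        by (rule sum.cong) (use insert.hyps in auto)
      then show ?thesis using c[OF that] insert.hyps by simp
    qed
    then show ?thesis by blast
  next
    case False
    have "\<exists>c. \<forall>\<phi>\<in>V. L \<phi> = (\<Sum>i\<in>I. c i * l i \<phi>)"
    proof (rule insert.IH)
      fix \<phi> assume \<phi>: "\<phi> \<in> V" "\<And>i. i \<in> I \<Longrightarrow> l i \<phi> = 0"
      then have "l j \<phi> = 0" using False by blast
      with \<phi> show "L \<phi> = 0" by (intro insert.prems(2)) auto
    qed (rule insert.prems(1))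
    then obtain c where c: "\<And>\<phi>. \<phi> \<in> V \<Longrightarrow> L \<phi> = (\<Sum>i\<in>I. c i * l i \<phi>)" by blast
    have "L \<phi> = (\<Sum>i\<in>insert j I. (c(j := 0)) i * l i \<phi>)" if "\<phi> \<in> V" for \<phi>
    proof -
      have "(\<Sum>i\<in>I. (c(j := 0)) i * l i \<phi>) = (\<Sum>i\<in>I. c i * l i \<phi>)"
        by (rule sum.cong) (use insert.hyps in auto)
      then show ?thesis using c[OF that] insert.hyps by simp
    qed
    then show ?thesis by blast
  qed
qed simp

lemma locally_integrable_continuous:
  assumes "continuous_on UNIV g"
  shows "locally_integrable g"
  unfolding locally_integrable_def set_integrable_def
proof (intro allI impI)
  fix K :: "heis set" assume K: "compact K"
  have "integrable lborel (\<lambda>x. indicator K x *\<^sub>R g x)"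
    by (rule borel_integrable_compact[OF K continuous_on_subset[OF assms]]) simp
  then show "integrable lebesgue (\<lambda>x. indicator K x *\<^sub>R g x)"
    by (subst integrable_completion) auto
qed

text \<open>Integration against \<open>g\<close> vanishes wherever the finitely many monomial
  moments do, so it is a combination of these moments. The coefficients of the combination are those
  of the polynomial, and the difference is orthogonal to every test function.\<close>

lemma AE_eq_hpoly:
  assumes g: "locally_integrable g"
    and 0: "\<And>\<phi>. \<phi> \<in> test_functions \<Longrightarrow> (\<And>P. P \<in> hpoly u \<Longrightarrow> (LINT x|lebesgue. \<phi> x * P x) = 0) \<Longrightarrow>
      (LINT x|lebesgue. g x * \<phi> x) = 0"
  shows "\<exists>P\<in>hpoly u. AE x in lebesgue. g x = P x"
proof -
  let ?I = "{i. real (hdeg i) < u}"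
  have lm: "locally_integrable (hmono i)" for i
    using hpoly_continuous[OF hpoly_hmono[of i "real (hdeg i) + 1"]] by (intro locally_integrable_continuous) auto
  have lin: "(LINT x|lebesgue. h x * (\<phi> x - c * \<psi> x)) = (LINT x|lebesgue. h x * \<phi> x) - c * (LINT x|lebesgue. h x * \<psi> x)"
    if "locally_integrable h" "\<phi> \<in> test_functions" "\<psi> \<in> test_functions" for h \<phi> \<psi> c
    using integrable_mult_test[OF that(1,2)] integrable_mult_test[OF that(1,3)]
    by (simp add: right_diff_distrib mult.left_commute[of _ c])
  have "\<exists>c. \<forall>\<phi>\<in>test_functions. (LINT x|lebesgue. g x * \<phi> x) = (\<Sum>i\<in>?I. c i * (LINT x|lebesgue. hmono i x * \<phi> x))"
  proof (rule functional_in_span[where l = "\<lambda>i \<phi>. LINT x|lebesgue. hmono i x * \<phi> x"])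
    show "finite ?I" by (rule finite_hdeg_less)
    fix \<phi> assume \<phi>: "\<phi> \<in> test_functions" and z: "\<And>i. i \<in> ?I \<Longrightarrow> (LINT x|lebesgue. hmono i x * \<phi> x) = 0"
    show "(LINT x|lebesgue. g x * \<phi> x) = 0"
    proof (rule 0[OF \<phi>])
      fix P assume "P \<in> hpoly u"
      then obtain c where P: "P = (\<lambda>x. \<Sum>i\<in>?I. c i * hmono i x)" by (auto simp: hpoly_iff)
      have "(LINT x|lebesgue. \<phi> x * P x) = (LINT x|lebesgue. (\<Sum>i\<in>?I. c i * (hmono i x * \<phi> x)))"
        unfolding P sum_distrib_left by (simp only: mult_ac)
      also have "\<dots> = (\<Sum>i\<in>?I. c i * (LINT x|lebesgue. hmono i x * \<phi> x))"
        using integrable_mult_test[OF lm \<phi>] by (subst Bochner_Integration.integral_sum) auto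
      finally show "(LINT x|lebesgue. \<phi> x * P x) = 0" using z by simp
    qed
  qed (auto intro: test_functions_diff_scaled lin lm g)
  then obtain c where c: "\<And>\<phi>. \<phi> \<in> test_functions \<Longrightarrow>
      (LINT x|lebesgue. g x * \<phi> x) = (\<Sum>i\<in>?I. c i * (LINT x|lebesgue. hmono i x * \<phi> x))" by blast
  define P where "P = (\<lambda>x. \<Sum>i\<in>?I. c i * hmono i x)"
  have P: "P \<in> hpoly u" unfolding P_def by (rule hpolyI) simp
  have lP: "locally_integrable P" by (intro locally_integrable_continuous hpoly_continuous[OF P])
  have "AE x in lebesgue. g x - P x = 0"
  proof (rule fundamental_lemma)
    show "locally_integrable (\<lambda>x. g x - P x)"
      using g lP unfolding locally_integrable_def by (auto intro: set_integral_diff)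
    fix \<phi> assume \<phi>: "\<phi> \<in> test_functions"
    have "(LINT x|lebesgue. P x * \<phi> x) = (LINT x|lebesgue. (\<Sum>i\<in>?I. c i * (hmono i x * \<phi> x)))"
      unfolding P_def sum_distrib_right by (simp only: mult_ac)
    also have "\<dots> = (\<Sum>i\<in>?I. c i * (LINT x|lebesgue. hmono i x * \<phi> x))"
      using integrable_mult_test[OF lm \<phi>] by (subst Bochner_Integration.integral_sum) auto
    finally show "(LINT x|lebesgue. (g x - P x) * \<phi> x) = 0"
      using c[OF \<phi>] integrable_mult_test[OF g \<phi>] integrable_mult_test[OF lP \<phi>]
      by (simp add: left_diff_distrib)
  qed
  with P show ?thesis by auto
qed

section \<open>Sums over the lattice\<close>

text \<open>Every natural number is the absolute value of at most two integers.\<close>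

lemma sum_int_le:
  fixes g :: "nat \<Rightarrow> real"
  assumes "finite B" "summable g" "\<And>n. 0 \<le> g n"
  shows "(\<Sum>m\<in>B. g (nat \<bar>m\<bar>)) \<le> 2 * suminf g"
proof -
  have *: "(\<Sum>m\<in>A. g (nat \<bar>m\<bar>)) \<le> suminf g" if "finite A" "inj_on (\<lambda>m. nat \<bar>m\<bar>) A" for A :: "int set"
  proof -
    have "(\<Sum>m\<in>A. g (nat \<bar>m\<bar>)) = sum g ((\<lambda>m. nat \<bar>m\<bar>) ` A)"
      by (simp add: sum.reindex[OF that(2)])
    also have "\<dots> \<le> suminf g"
      by (rule sum_le_suminf) (use assms that in auto)
    finally show ?thesis .
  qed
  have "(\<Sum>m\<in>B. g (nat \<bar>m\<bar>)) = (\<Sum>m\<in>{m\<in>B. 0 \<le> m} \<union> {m\<in>B. m < 0}. g (nat \<bar>m\<bar>))"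
    by (rule sum.cong) auto
  also have "\<dots> = (\<Sum>m\<in>{m\<in>B. 0 \<le> m}. g (nat \<bar>m\<bar>)) + (\<Sum>m\<in>{m\<in>B. m < 0}. g (nat \<bar>m\<bar>))"
    by (rule sum.union_disjoint) (use assms in auto)
  also have "\<dots> \<le> suminf g + suminf g"
    by (intro add_mono * inj_onI) (use assms in auto)
  finally show ?thesis by simp
qed

text \<open>Uniformity in \<open>t\<close> is the point: in the lattice sum the centre for the third
  coordinate moves with the first two. Recentring at the floor of \<open>t\<close> costs a factor 2,
  hence the 4 after squaring.\<close>

lemma sum_inverse_square_le:
  obtains C where "\<And>A t. finite A \<Longrightarrow> (\<Sum>n\<in>A. 1 / (1 + \<bar>t - of_int n\<bar>)\<^sup>2) \<le> (C :: real)" "0 \<le> C"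
proof
  define g where "g = (\<lambda>n::nat. 4 / (1 + real n)\<^sup>2)"
  have g: "summable g" "\<And>n. 0 \<le> g n"
  proof -
    have "summable (\<lambda>n. 4 * inverse (real (Suc n) ^ 2))"
      using inverse_power_summable[of 2, where 'a = real] by (intro summable_mult) (subst summable_Suc_iff, simp)
    then show "summable g" by (simp add: g_def divide_inverse add.commute)
  qed (simp add: g_def)
  show "0 \<le> 2 * suminf g" using g by (simp add: suminf_nonneg)
  fix A :: "int set" and t :: real assume A: "finite A"
  have "1 / (1 + \<bar>t - of_int n\<bar>)\<^sup>2 \<le> g (nat \<bar>n - \<lfloor>t\<rfloor>\<bar>)" for n
  proof -
    define m where "m = real (nat \<bar>n - \<lfloor>t\<rfloor>\<bar>)"
    have "m = \<bar>of_int n - of_int \<lfloor>t\<rfloor>\<bar>" by (simp add: m_def)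
    moreover have "1 + \<bar>x - u\<bar> \<le> 2 * (1 + \<bar>t - x\<bar>)" if "u \<le> t" "t < u + 1" for u x :: real
      using that by (smt (verit))
    ultimately have "1 + m \<le> 2 * (1 + \<bar>t - of_int n\<bar>)"
      using floor_correct[of t] by simp
    moreover have "0 \<le> m" by (simp add: m_def)
    ultimately have "(1 + m)\<^sup>2 \<le> (2 * (1 + \<bar>t - of_int n\<bar>))\<^sup>2" by (intro power_mono) auto
    then have "(1 + m)\<^sup>2 \<le> 4 * (1 + \<bar>t - of_int n\<bar>)\<^sup>2" by (simp only: power_mult_distrib) simp
    moreover have "0 < (1 + m)\<^sup>2" "0 < (1 + \<bar>t - of_int n\<bar>)\<^sup>2" using \<open>0 \<le> m\<close> by auto
    ultimately show ?thesis unfolding g_def m_def[symmetric] by (simp add: divide_simps)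
  qed
  then have "(\<Sum>n\<in>A. 1 / (1 + \<bar>t - of_int n\<bar>)\<^sup>2) \<le> (\<Sum>n\<in>A. g (nat \<bar>n - \<lfloor>t\<rfloor>\<bar>))"
    by (rule sum_mono)
  also have "\<dots> = (\<Sum>m\<in>(\<lambda>n. n - \<lfloor>t\<rfloor>) ` A. g (nat \<bar>m\<bar>))"
    by (subst sum.reindex) (auto simp: inj_on_def)
  also have "\<dots> \<le> 2 * suminf g"
    by (rule sum_int_le) (use A g in auto)
  finally show "(\<Sum>n\<in>A. 1 / (1 + \<bar>t - of_int n\<bar>)\<^sup>2) \<le> 2 * suminf g" .
qed

section \<open>Lattice sums of rapidly decaying weights\<close>

text \<open>The exponential decay of a wavelet, multiplied by the growth of order \<open>v\<close>
  that the coefficient bound allows away from the base point.\<close>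

definition decay :: "real \<Rightarrow> real \<Rightarrow> heis \<Rightarrow> real"
  where "decay v \<rho> x = (1 + hnorm x) powr v * exp (- hnorm x / \<rho>)"

lemma decay_nonneg: "0 \<le> decay v \<rho> x"
  by (simp add: decay_def)

lemma exp_le_decay: "0 \<le> v \<Longrightarrow> exp (- hnorm x / \<rho>) \<le> decay v \<rho> x"
  using mult_right_mono[of 1 "(1 + hnorm x) powr v" "exp (- hnorm x / \<rho>)"]
    ge_one_powr_ge_zero[of "1 + hnorm x" v]
  by (simp add: decay_def)

lemma decay_le:
  assumes "0 < \<rho>"
  obtains K where "0 \<le> K" "\<And>a b c. decay v \<rho> (a, b, c) \<le> K * (1 / (1 + \<bar>a\<bar>)\<^sup>2 * (1 / (1 + \<bar>b\<bar>)\<^sup>2) * (1 / (1 + \<bar>c\<bar>)\<^sup>2))"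
proof -
  define m where "m = nat \<lceil>v\<rceil>"
  \<comment> \<open>The exponent 8 is 2 + 2 + 4, the third coordinate being quadratic in the gauge;
    \<open>m\<close> is the power \<open>v\<close> rounded up.\<close>
  define K where "K = exp (1 / \<rho>) * (fact (m + 8) / (1 / \<rho>) ^ (m + 8))"
  have "0 \<le> K" using assms by (simp add: K_def)
  moreover have "decay v \<rho> (a, b, c) \<le> K * (1 / (1 + \<bar>a\<bar>)\<^sup>2 * (1 / (1 + \<bar>b\<bar>)\<^sup>2) * (1 / (1 + \<bar>c\<bar>)\<^sup>2))" for a b c
  proof -
    define N where "N = hnorm (a, b, c)"
    have N: "0 \<le> N" "\<bar>a\<bar> \<le> N" "\<bar>b\<bar> \<le> N" "\<bar>c\<bar> \<le> N\<^sup>2" unfolding N_def by (simp_all add: abs_le_hnorm)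
    have c: "1 + \<bar>c\<bar> \<le> (1 + N)\<^sup>2" using N by (simp add: power2_sum)
    have "(1 + \<bar>a\<bar>)\<^sup>2 * (1 + \<bar>b\<bar>)\<^sup>2 * (1 + \<bar>c\<bar>)\<^sup>2 \<le> (1 + N)\<^sup>2 * (1 + N)\<^sup>2 * ((1 + N)\<^sup>2)\<^sup>2"
      by (intro mult_mono power_mono c) (use N in auto)
    also have "\<dots> = (1 + N) ^ 8" by (simp flip: power_add power_mult)
    finally have poly: "(1 + \<bar>a\<bar>)\<^sup>2 * (1 + \<bar>b\<bar>)\<^sup>2 * (1 + \<bar>c\<bar>)\<^sup>2 \<le> (1 + N) ^ 8" .
    have "(1 + N) powr v \<le> (1 + N) powr real m"
      by (rule powr_mono) (use N in \<open>auto simp: m_def intro: real_nat_ceiling_ge\<close>)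
    also have "\<dots> = (1 + N) ^ m" using N by (intro powr_realpow) auto
    finally have pw: "(1 + N) powr v \<le> (1 + N) ^ m" .
    have "decay v \<rho> (a, b, c) * ((1 + \<bar>a\<bar>)\<^sup>2 * (1 + \<bar>b\<bar>)\<^sup>2 * (1 + \<bar>c\<bar>)\<^sup>2)
        \<le> ((1 + N) ^ m * exp (- N / \<rho>)) * (1 + N) ^ 8"
      unfolding decay_def N_def[symmetric]
      by (intro mult_mono pw poly) (use N in auto)
    also have "\<dots> = exp (1 / \<rho>) * ((1 + N) ^ (m + 8) * exp (- (1 / \<rho>) * (1 + N)))"
    proof -
      have "exp (- N / \<rho>) = exp (1 / \<rho>) * exp (- (1 / \<rho>) * (1 + N))"
        unfolding exp_add[symmetric] by (simp add: add_divide_distrib)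
      then show ?thesis by (simp only: power_add mult_ac)
    qed
    also have "\<dots> \<le> K"
      unfolding K_def by (intro mult_left_mono power_exp_bound) (use N assms in auto)
    finally have "decay v \<rho> (a, b, c) * ((1 + \<bar>a\<bar>)\<^sup>2 * (1 + \<bar>b\<bar>)\<^sup>2 * (1 + \<bar>c\<bar>)\<^sup>2) \<le> K" .
    moreover have "0 < (1 + \<bar>a\<bar>)\<^sup>2 * (1 + \<bar>b\<bar>)\<^sup>2 * (1 + \<bar>c\<bar>)\<^sup>2" by (intro mult_pos_pos zero_less_power) auto
    ultimately show ?thesis by (simp add: field_simps)
  qed
  ultimately show ?thesis using that by blast
qed

text \<open>Translation by a lattice point shears the third coordinate, whose centre
  \<open>\<tau> a b\<close> depends on the other two. Summing over the third index first, with a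
  bound uniform in the centre, removes the shear and leaves two independent sums.\<close>

lemma sum_decay_lattice:
  assumes "0 < \<rho>"
  obtains C where "0 \<le> C" "\<And>A y. finite A \<Longrightarrow> (\<Sum>k\<in>A. decay v \<rho> (hinv (lattice_pt k) \<star> y)) \<le> C"
proof -
  obtain K where K: "0 \<le> K" "\<And>a b c. decay v \<rho> (a, b, c) \<le> K * (1 / (1 + \<bar>a\<bar>)\<^sup>2 * (1 / (1 + \<bar>b\<bar>)\<^sup>2) * (1 / (1 + \<bar>c\<bar>)\<^sup>2))"
    using decay_le[OF assms] by blast
  obtain C where C: "\<And>A t. finite A \<Longrightarrow> (\<Sum>n\<in>A. 1 / (1 + \<bar>t - of_int n\<bar>)\<^sup>2) \<le> (C :: real)" "0 \<le> C"
    by (rule sum_inverse_square_le) (rule that)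
  have "(\<Sum>k\<in>A. decay v \<rho> (hinv (lattice_pt k) \<star> y)) \<le> K * (C * (C * C))" if A: "finite A" for A y
  proof (cases y)
    case (fields p q r)
    define h where "h = (\<lambda>t n. 1 / (1 + \<bar>t - of_int n\<bar>)\<^sup>2 :: real)"
    define \<tau> where "\<tau> = (\<lambda>a b. r + 2 * (of_int a * q - of_int b * p))"
    have h: "0 \<le> h t n" for t n by (simp add: h_def)
    have hC: "finite B \<Longrightarrow> (\<Sum>n\<in>B. h t n) \<le> C" for B t unfolding h_def by (rule C)
    define A1 A2 A3 where "A1 = fst ` A" and "A2 = (fst \<circ> snd) ` A" and "A3 = (snd \<circ> snd) ` A"
    have fin: "finite A1" "finite A2" "finite A3" using A by (auto simp: A1_def A2_def A3_def)
    have sub: "A \<subseteq> A1 \<times> A2 \<times> A3"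
    proof
      fix k assume "k \<in> A"
      then show "k \<in> A1 \<times> A2 \<times> A3"
        unfolding A1_def A2_def A3_def mem_Times_iff
        using imageI[of k A fst] imageI[of k A "fst \<circ> snd"] imageI[of k A "snd \<circ> snd"] by simp
    qed
    have eq: "hinv (lattice_pt (a, b, c)) \<star> y = (p - of_int a, q - of_int b, \<tau> a b - of_int c)" for a b c
      by (simp add: fields hinv_def \<tau>_def)
    have "decay v \<rho> (hinv (lattice_pt (a, b, c)) \<star> y) \<le> K * (h p a * h q b * h (\<tau> a b) c)" for a b c
      unfolding eq h_def by (rule K(2))
    then have "(\<Sum>k\<in>A. decay v \<rho> (hinv (lattice_pt k) \<star> y)) \<le> (\<Sum>(a, b, c)\<in>A. K * (h p a * h q b * h (\<tau> a b) c))"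
      by (intro sum_mono) (simp only: split_paired_all prod.case)
    also have "\<dots> \<le> (\<Sum>(a, b, c)\<in>A1 \<times> A2 \<times> A3. K * (h p a * h q b * h (\<tau> a b) c))"
      by (rule sum_mono2) (use fin sub in \<open>auto intro!: mult_nonneg_nonneg K(1) h\<close>)
    also have "\<dots> = (\<Sum>a\<in>A1. \<Sum>b\<in>A2. \<Sum>c\<in>A3. K * (h p a * h q b * h (\<tau> a b) c))"
      by (simp only: sum.cartesian_product)
    also have "\<dots> = K * (\<Sum>a\<in>A1. h p a * (\<Sum>b\<in>A2. h q b * (\<Sum>c\<in>A3. h (\<tau> a b) c)))"
      by (simp only: sum_distrib_left mult.assoc)
    also have "\<dots> \<le> K * (\<Sum>a\<in>A1. h p a * (\<Sum>b\<in>A2. h q b * C))"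
      by (intro mult_left_mono sum_mono hC fin h K(1))
    also have "\<dots> = K * (\<Sum>a\<in>A1. h p a * ((\<Sum>b\<in>A2. h q b) * C))"
      by (simp add: sum_distrib_right)
    also have "\<dots> \<le> K * (\<Sum>a\<in>A1. h p a * (C * C))"
      by (intro mult_left_mono mult_right_mono sum_mono hC fin h K(1) C(2))
    also have "\<dots> = K * ((\<Sum>a\<in>A1. h p a) * (C * C))"
      by (simp add: sum_distrib_right)
    also have "\<dots> \<le> K * (C * (C * C))"
      by (intro mult_left_mono mult_right_mono hC fin K(1) mult_nonneg_nonneg C(2))
    finally show ?thesis .
  qed
  moreover have "0 \<le> K * (C * (C * C))" using K C by simp
  ultimately show ?thesis using that by blast
qed

lemma dil_grid_pt: "dil (2 powi j) (hinv (grid_pt j k) \<star> x) = hinv (lattice_pt k) \<star> dil (2 powi j) x"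
  by (simp add: dil_hmul dil_hinv grid_pt_def dil_dil power_int_minus flip: power_int_add)

lemma hdist_grid_pt: "hdist (grid_pt j k) x = 2 powi (- j) * hnorm (hinv (lattice_pt k) \<star> dil (2 powi j) x)"
proof -
  have "hnorm (hinv (lattice_pt k) \<star> dil (2 powi j) x) = 2 powi j * hdist (grid_pt j k) x"
    unfolding dil_grid_pt[symmetric] hnorm_dil hdist_def by simp
  then show ?thesis by (simp add: power_int_minus)
qed

lemma bdd_imp_summable_on:
  fixes g :: "'a \<Rightarrow> real"
  assumes "\<And>i. i \<in> I \<Longrightarrow> 0 \<le> g i" "\<And>F. finite F \<Longrightarrow> F \<subseteq> I \<Longrightarrow> sum g F \<le> B"
  shows "g summable_on I"
  using assms by (intro nonneg_bdd_above_summable_on) (auto intro!: bdd_aboveI[of _ B])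

lemma summable_on_Sigma_nat:
  fixes g :: "nat \<Rightarrow> 'a \<Rightarrow> real"
  assumes le: "\<And>j F. finite F \<Longrightarrow> F \<subseteq> K j \<Longrightarrow> (\<Sum>k\<in>F. g j k) \<le> a j"
    and a: "summable a" and g: "\<And>j k. k \<in> K j \<Longrightarrow> 0 \<le> g j k"
  shows "(\<lambda>(j, k). g j k) summable_on (Sigma UNIV K)"
proof (rule bdd_imp_summable_on)
  fix F assume F: "finite F" "F \<subseteq> Sigma UNIV K"
  define S where "S = (\<lambda>j. {k. (j, k) \<in> F})"
  have S: "finite (S j)" "S j \<subseteq> K j" for j
    using F finite_subset[of "S j" "snd ` F"] by (force simp: S_def)+
  have "(\<Sum>(j, k)\<in>F. g j k) = (\<Sum>(j, k)\<in>Sigma (fst ` F) S. g j k)"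
    by (rule sum.cong) (force simp: S_def)+
  also have "\<dots> = (\<Sum>j\<in>fst ` F. \<Sum>k\<in>S j. g j k)"
    by (rule sum.Sigma[symmetric]) (use F S in auto)
  also have "\<dots> \<le> (\<Sum>j\<in>fst ` F. a j)"
    by (intro sum_mono le S)
  also have "\<dots> \<le> suminf a"
  proof (rule sum_le_suminf[OF a])
    show "0 \<le> a n" for n using le[of "{}" n] by simp
  qed (use F in auto)
  finally show "(\<Sum>(j, k)\<in>F. g j k) \<le> suminf a" .
qed (use g in auto)

section \<open>Hausdorff measures of limsup sets\<close>

text \<open>The convergence half of the Borel-Cantelli argument: points in infinitely many balls
  remain covered after any finite set of balls is deleted, and the tails of the sum are
  small.\<close>

lemma hausdorff_measure_limsup:
  fixes c :: "'i \<Rightarrow> heis"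
  assumes "0 < t" "countable I" and r: "\<And>i. i \<in> I \<Longrightarrow> 0 < r i"
    and sm: "(\<lambda>i. r i powr t) summable_on I"
    and inf: "\<And>x. x \<in> E \<Longrightarrow> infinite {i \<in> I. x \<in> gauge_ball (c i) (r i)}"
  shows "hausdorff_measure t E = 0"
proof -
  have "hausdorff_pre t \<eta> E \<le> 0" if \<eta>: "0 < \<eta>" for \<eta>
  proof (rule ennreal_le_epsilon)
    fix \<epsilon> :: real assume \<epsilon>: "0 < \<epsilon>"
    \<comment> \<open>A tail below \<epsilon> bounds the covering sum; a tail below
      \<open>\<eta> powr t\<close> forces each remaining radius to be at most \<eta>.\<close>
    define d where "d = min \<epsilon> (\<eta> powr t)"
    have d: "0 < d" using \<epsilon> \<eta> by (simp add: d_def)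
    obtain F where F: "finite F" "F \<subseteq> I" "dist (sum (\<lambda>i. r i powr t) F) (infsum (\<lambda>i. r i powr t) I) \<le> d / 2"
      using infsum_finite_approximation[OF sm, of "d / 2"] d by auto
    define J where "J = I - F"
    have smJ: "(\<lambda>i. r i powr t) summable_on J"
      unfolding J_def by (rule summable_on_subset_banach[OF sm]) auto
    have "infsum (\<lambda>i. r i powr t) J = infsum (\<lambda>i. r i powr t) I - sum (\<lambda>i. r i powr t) F"
      unfolding J_def using F sm by (subst infsum_Diff) auto
    then have inJ: "infsum (\<lambda>i. r i powr t) J < d"
      using F(3) d unfolding dist_real_def by linarith
    have fin: "sum (\<lambda>i. r i powr t) G < d" if "finite G" "G \<subseteq> J" for G
      using finite_sum_le_infsum[OF smJ that] inJ by simp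
    have rJ: "r i \<le> \<eta>" if "i \<in> J" for i
    proof (rule ccontr)
      assume "\<not> r i \<le> \<eta>"
      then have "\<eta> powr t \<le> r i powr t" using \<eta> assms(1) by (intro powr_mono2) auto
      moreover have "r i powr t < d" using fin[of "{i}"] that by simp
      ultimately show False by (simp add: d_def)
    qed
    have J: "countable J" using assms(2) by (auto simp: J_def)
    define e where "e = to_nat_on J"
    have e: "inj_on e J" unfolding e_def by (rule inj_on_to_nat_on[OF J])
    define x where "x = (\<lambda>n. c (inv_into J e n))"
    \<comment> \<open>Numbers outside the enumeration of \<open>J\<close> get radius 0: an empty
      ball that contributes nothing.\<close>
    define r' where "r' = (\<lambda>n. if n \<in> e ` J then r (inv_into J e n) else 0)"
    have "hausdorff_pre t \<eta> E \<le> (\<Sum>n. ennreal (r' n powr t))"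
      unfolding hausdorff_pre_def
    proof (rule Inf_lower, intro CollectI exI conjI allI)
      show "0 \<le> r' n" "r' n \<le> \<eta>" for n
        using r rJ \<eta> inv_into_into[of n e J] by (auto simp: r'_def J_def less_imp_le)
      show "E \<subseteq> (\<Union>n. gauge_ball (x n) (r' n))"
      proof
        fix y assume "y \<in> E"
        then have "infinite {i \<in> I. y \<in> gauge_ball (c i) (r i)}" by (rule inf)
        then have "\<not> {i \<in> I. y \<in> gauge_ball (c i) (r i)} \<subseteq> F" using F(1) finite_subset by blast
        then obtain i where "i \<in> J" "y \<in> gauge_ball (c i) (r i)" by (auto simp: J_def)
        then have "y \<in> gauge_ball (x (e i)) (r' (e i))"
          using e by (simp add: x_def r'_def inv_into_f_f)
        then show "y \<in> (\<Union>n. gauge_ball (x n) (r' n))" by blast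
      qed
    qed auto
    also have "\<dots> \<le> ennreal d"
      unfolding suminf_eq_SUP
    proof (rule SUP_least)
      fix n
      define G where "G = {i \<in> J. e i < n}"
      have "e ` G \<subseteq> {..<n}" "inj_on e G" using e by (auto simp: G_def inj_on_def)
      then have G: "finite G" "G \<subseteq> J"
        using finite_imageD[of e G] finite_subset[of "e ` G" "{..<n}"] by (auto simp: G_def)
      have "(\<Sum>m<n. r' m powr t) = (\<Sum>m\<in>e ` G. r' m powr t)"
        by (rule sum.mono_neutral_right) (auto simp: G_def r'_def)
      also have "\<dots> = (\<Sum>i\<in>G. r i powr t)"
        using \<open>inj_on e G\<close> e G(2) by (auto simp: sum.reindex r'_def inv_into_f_f intro!: sum.cong)
      also have "\<dots> < d" using fin G by blast
      finally show "(\<Sum>m<n. ennreal (r' m powr t)) \<le> ennreal d"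
        by (simp add: ennreal_leI)
    qed
    also have "\<dots> \<le> 0 + ennreal \<epsilon>" by (simp add: d_def ennreal_leI)
    finally show "hausdorff_pre t \<eta> E \<le> 0 + ennreal \<epsilon>" .
  qed
  then have "hausdorff_measure t E \<le> 0"
    unfolding hausdorff_measure_def by (intro SUP_least) simp
  then show ?thesis by simp
qed

lemma hausdorff_dim_le:
  assumes "0 \<le> t" "hausdorff_measure t E = 0"
  shows "hausdorff_dim E \<le> ereal t"
  using assms by (auto simp: hausdorff_dim_def intro!: Inf_lower)

section \<open>Dimension of the whole group\<close>

text \<open>\<rho> is split as e * e; one factor e^j absorbs the polynomial, the other remains as a
  geometric majorant.\<close>

lemma summable_power4_geometric:
  assumes "0 < \<rho>" "\<rho> < 1"
  shows "summable (\<lambda>j. (real j + 1) ^ 4 * \<rho> ^ j)"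
proof -
  define c where "c = - ln \<rho> / 2"
  have c: "0 < c" using assms by (simp add: c_def)
  define e where "e = exp (- c)"
  have e: "0 < e" "e < 1" using c by (auto simp: e_def)
  have "e * e = exp (ln \<rho>)" unfolding e_def exp_add[symmetric] by (simp add: c_def)
  then have \<rho>: "\<rho> ^ j = e ^ j * e ^ j" for j
    using assms by (simp only: power_mult_distrib[symmetric] exp_ln)
  define K where "K = fact 4 / c ^ 4 * exp c"
  have le: "(real j + 1) ^ 4 * \<rho> ^ j \<le> K * e ^ j" for j
  proof -
    have "exp (- c * (real j + 1)) * exp c = exp (real j * (- c))"
      unfolding exp_add[symmetric] by (rule arg_cong[where f = exp]) (simp add: algebra_simps)
    then have eq: "exp (- c * (real j + 1)) * exp c = e ^ j"
      unfolding e_def exp_of_nat_mult .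
    have "(real j + 1) ^ 4 * exp (- c * (real j + 1)) \<le> fact 4 / c ^ 4"
      by (rule power_exp_bound) (use c in auto)
    then have "(real j + 1) ^ 4 * exp (- c * (real j + 1)) * exp c \<le> K"
      unfolding K_def by (rule mult_right_mono) simp
    then have "(real j + 1) ^ 4 * e ^ j \<le> K"
      unfolding mult.assoc eq .
    then have "(real j + 1) ^ 4 * e ^ j * e ^ j \<le> K * e ^ j"
      by (rule mult_right_mono) (use e in simp)
    then show ?thesis unfolding \<rho> mult.assoc .
  qed
  have "summable (\<lambda>j. K * e ^ j)"
    using e by (intro summable_mult summable_geometric) simp
  then show ?thesis
  proof (rule summable_comparison_test'[where N = 0])
    fix j
    have "0 \<le> (real j + 1) ^ 4 * \<rho> ^ j" using assms by (intro mult_nonneg_nonneg zero_le_power) auto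
    then show "norm ((real j + 1) ^ 4 * \<rho> ^ j) \<le> K * e ^ j"
      unfolding real_norm_def using le[of j] by (simp only: abs_of_nonneg)
  qed
qed

text \<open>The third coordinate is rounded after the shear caused by rounding the first two. What
  is left is a triple of fractional parts, whose gauge has fourth power at most 5 < 16. The explicit
  \<open>k\<close> serves to locate it in a box.\<close>

lemma lattice_pt_near:
  obtains k where "hnorm (hinv (lattice_pt k) \<star> (p, q, r)) < 2"
    "k = (\<lfloor>p\<rfloor>, \<lfloor>q\<rfloor>, \<lfloor>r + 2 * (of_int \<lfloor>p\<rfloor> * q - of_int \<lfloor>q\<rfloor> * p)\<rfloor>)"
proof
  let ?r = "r + 2 * (of_int \<lfloor>p\<rfloor> * q - of_int \<lfloor>q\<rfloor> * p)"
  let ?x = "(frac p, frac q, frac ?r)"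
  have eq: "hinv (lattice_pt (\<lfloor>p\<rfloor>, \<lfloor>q\<rfloor>, \<lfloor>?r\<rfloor>)) \<star> (p, q, r) = ?x"
    by (simp add: hinv_def frac_def algebra_simps)
  have f: "(frac a)\<^sup>2 \<le> 1" for a :: real
    using frac_lt_1[of a] by (simp add: power_le_one less_imp_le)
  have "((frac p)\<^sup>2 + (frac q)\<^sup>2)\<^sup>2 \<le> 2\<^sup>2"
    using f[of p] f[of q] by (intro power_mono) auto
  then have "hnorm ?x ^ 4 < 2 ^ 4"
    unfolding hnorm_pow4 using f[of ?r] by simp
  then show "hnorm (hinv (lattice_pt (\<lfloor>p\<rfloor>, \<lfloor>q\<rfloor>, \<lfloor>?r\<rfloor>)) \<star> (p, q, r)) < 2"
    unfolding eq by (rule power_less_imp_less_base) simp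
qed simp

text \<open>Balls of radius 2 * 2^(-j) about the grid points in \<open>K j\<close> number at most 27
  (j + 1)^4 16^j, so their t-th powers are summable for t > 4. The slowly growing factor j + 1 in
  \<open>m\<close> makes the boxes reach every point eventually, and one limsup set covers the
  unbounded group.\<close>

lemma hausdorff_measure_gt_hdim:
  assumes t: "4 < t"
  shows "hausdorff_measure t E = 0"
proof -
  define m :: "nat \<Rightarrow> int" where "m = (\<lambda>j. (int j + 1) * 2 ^ j)"
  have m: "1 \<le> m j" for j
    using mult_mono[of 1 "int j + 1" 1 "2 ^ j"] by (simp add: m_def)
  define K where "K = (\<lambda>j. {- m j..m j} \<times> {- m j..m j} \<times> {- (m j)\<^sup>2..(m j)\<^sup>2})"
  define \<rho> where "\<rho> = (2::real) powr (4 - t)"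
  have \<rho>: "0 < \<rho>" "\<rho> < 1" using t powr_less_mono[of "4 - t" 0 2] by (auto simp: \<rho>_def)
  define r where "r = (\<lambda>j::nat. 2 * 2 powi (- int j) :: real)"
  have card: "real (card (K j)) \<le> 27 * ((real j + 1) ^ 4 * 16 ^ j)" for j
  proof -
    define M where "M = real_of_int (m j)"
    have M: "1 \<le> M" using m[of j] by (simp add: M_def)
    have "real (card (K j)) = (2 * M + 1) * ((2 * M + 1) * (2 * M\<^sup>2 + 1))"
      using m[of j] by (simp add: K_def card_cartesian_product M_def)
    also have "\<dots> \<le> (3 * M) * ((3 * M) * (3 * M\<^sup>2))"
      by (intro mult_mono) (use M in \<open>auto simp: one_le_power\<close>)
    also have "\<dots> = 27 * M ^ 4" by (simp add: power2_eq_square power4_eq_xxxx)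
    also have "M ^ 4 = (real j + 1) ^ 4 * 16 ^ j"
      by (simp add: M_def m_def power_mult_distrib power_mult[symmetric] mult.commute[of j])
         (simp add: power_mult)
    finally show ?thesis .
  qed
  have sm: "(\<lambda>(j, k). r j powr t) summable_on (Sigma UNIV K)"
  proof (rule summable_on_Sigma_nat)
    fix j and F assume F: "finite F" "F \<subseteq> K j"
    have "finite (K j)" by (simp add: K_def)
    then have "real (card F) \<le> 27 * ((real j + 1) ^ 4 * 16 ^ j)"
      using card_mono[of "K j" F] F card[of j] by linarith
    then have le: "(\<Sum>k\<in>F. r j powr t) \<le> 27 * ((real j + 1) ^ 4 * 16 ^ j) * r j powr t"
      by (simp add: mult_right_mono)
    have "r j powr t = 2 powr t * 2 powr (- t * real j)"
      by (simp add: r_def powr_mult power_int_minus powr_realpow[symmetric] powr_powr powr_minus[symmetric] mult.commute)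
    then have "27 * ((real j + 1) ^ 4 * 16 ^ j) * r j powr t =
        27 * 2 powr t * ((real j + 1) ^ 4 * (16 ^ j * 2 powr (- t * real j)))"
      by simp
    also have "16 ^ j * 2 powr (- t * real j) = \<rho> ^ j"
    proof -
      have "(16::real) ^ j = 2 powr (4 * real j)"
        using powr_powr[of 2 4 "real j"] powr_realpow[of 16 j] by simp
      then show ?thesis
        by (simp add: \<rho>_def powr_add[symmetric] powr_realpow[symmetric] powr_powr algebra_simps)
    qed
    finally show "(\<Sum>k\<in>F. r j powr t) \<le> 27 * 2 powr t * ((real j + 1) ^ 4 * \<rho> ^ j)"
      using le by (simp only:)
  qed (auto intro!: summable_mult summable_power4_geometric \<rho>)
  show ?thesis
  proof (rule hausdorff_measure_limsup[where c = "\<lambda>(j, k). grid_pt (int j) k" and r = "\<lambda>(j, k). r j" and I = "Sigma UNIV K"])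
    show "(\<lambda>i. (case i of (j, k) \<Rightarrow> r j) powr t) summable_on Sigma UNIV K"
      using sm by (simp add: case_prod_unfold)
    fix x :: heis
    obtain p q s where x: "x = (p, q, s)" by (cases x)
    \<comment> \<open>From scale \<open>R\<close> on, the rounded coordinates of the dilated point
      lie in \<open>K j\<close>. The factor 2 and both of |p| and |q| come from the sheared third
      coordinate, the 1 from rounding.\<close>
    define R where "R = \<bar>s\<bar> + 2 * (\<bar>p\<bar> + \<bar>q\<bar>) + 1"
    have "\<exists>k. k \<in> K j \<and> x \<in> gauge_ball (grid_pt (int j) k) (r j)" if j: "R \<le> real j" for j
    proof -
      define l where "l = (2::real) ^ j"
      have l: "1 \<le> l" by (simp add: l_def)
      have dx: "dil (2 powi int j) x = (l * p, l * q, l\<^sup>2 * s)" by (simp add: x l_def)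
      obtain k where k: "hnorm (hinv (lattice_pt k) \<star> (l * p, l * q, l\<^sup>2 * s)) < 2"
        "k = (\<lfloor>l * p\<rfloor>, \<lfloor>l * q\<rfloor>, \<lfloor>l\<^sup>2 * s + 2 * (of_int \<lfloor>l * p\<rfloor> * (l * q) - of_int \<lfloor>l * q\<rfloor> * (l * p))\<rfloor>)"
        using lattice_pt_near .
      have "x \<in> gauge_ball (grid_pt (int j) k) (r j)"
      proof -
        have "hdist (grid_pt (int j) k) x = 2 powi (- int j) * hnorm (hinv (lattice_pt k) \<star> (l * p, l * q, l\<^sup>2 * s))"
          by (simp only: hdist_grid_pt dx)
        then show ?thesis using k(1) by (simp add: gauge_ball_def r_def)
      qed
      moreover have "k \<in> K j"
      proof -
        define M where "M = real_of_int (m j)"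
        have M: "M = (real j + 1) * l" by (simp add: M_def m_def l_def)
        have R: "\<bar>p\<bar> + 1 \<le> real j + 1" "\<bar>q\<bar> + 1 \<le> real j + 1" "0 \<le> R" using j by (auto simp: R_def)
        have fl: "\<bar>real_of_int \<lfloor>l * a\<rfloor>\<bar> \<le> M" if "\<bar>a\<bar> + 1 \<le> real j + 1" for a
        proof -
          have "\<bar>real_of_int \<lfloor>l * a\<rfloor>\<bar> \<le> \<bar>l * a\<bar> + 1" by linarith
          also have "\<dots> \<le> l * (\<bar>a\<bar> + 1)" using l by (simp add: abs_mult algebra_simps)
          also have "\<dots> \<le> M" unfolding M using l that by (simp add: mult.commute mult_left_mono)
          finally show ?thesis .
        qed
        let ?c = "l\<^sup>2 * s + 2 * (of_int \<lfloor>l * p\<rfloor> * (l * q) - of_int \<lfloor>l * q\<rfloor> * (l * p))"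
        have M0: "0 \<le> M" using l by (simp add: M)
        have pr: "\<bar>of_int \<lfloor>l * p\<rfloor> * (l * q)\<bar> \<le> M * (l * \<bar>q\<bar>)" "\<bar>of_int \<lfloor>l * q\<rfloor> * (l * p)\<bar> \<le> M * (l * \<bar>p\<bar>)"
          using l R fl M0 by (auto simp: abs_mult intro!: mult_mono)
        have tri: "\<bar>a + 2 * (b - c)\<bar> \<le> \<bar>a\<bar> + 2 * (\<bar>b\<bar> + \<bar>c\<bar>)" for a b c :: real
          by (smt (verit))
        have "\<bar>?c\<bar> \<le> \<bar>l\<^sup>2 * s\<bar> + 2 * (\<bar>of_int \<lfloor>l * p\<rfloor> * (l * q)\<bar> + \<bar>of_int \<lfloor>l * q\<rfloor> * (l * p)\<bar>)"
          by (rule tri)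
        also have "\<dots> \<le> l\<^sup>2 * \<bar>s\<bar> + 2 * (M * (l * \<bar>q\<bar>) + M * (l * \<bar>p\<bar>))"
          using pr by (simp add: abs_mult)
        finally have "\<bar>real_of_int \<lfloor>?c\<rfloor>\<bar> \<le> l\<^sup>2 * \<bar>s\<bar> + 2 * (M * (l * \<bar>q\<bar>) + M * (l * \<bar>p\<bar>)) + 1" by linarith
        also have "\<dots> \<le> l\<^sup>2 * ((real j + 1) * \<bar>s\<bar>) + 2 * (M * (l * \<bar>q\<bar>) + M * (l * \<bar>p\<bar>)) + l\<^sup>2 * (real j + 1)"
          using l M0 mult_mono[of 1 "l\<^sup>2" 1 "real j + 1"]
          by (intro add_mono mult_left_mono) (auto simp: one_le_power mult_le_cancel_right1)
        also have "\<dots> = l\<^sup>2 * (real j + 1) * R"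
          by (simp add: R_def M power2_eq_square algebra_simps)
        also have "\<dots> \<le> l\<^sup>2 * (real j + 1) * (real j + 1)"
          using j by (intro mult_left_mono) auto
        also have "\<dots> = M\<^sup>2" by (simp add: M power2_eq_square)
        finally have c: "\<bar>real_of_int \<lfloor>?c\<rfloor>\<bar> \<le> M\<^sup>2" .
        have int: "n \<in> {- a..a}" if "\<bar>real_of_int n\<bar> \<le> real_of_int a" for n a
          using that by (simp add: abs_le_iff)
        show ?thesis
          unfolding k(2) K_def
          using fl[OF R(1)] fl[OF R(2)] c by (auto simp only: mem_Sigma_iff M_def of_int_power[symmetric] intro!: int)
      qed
      ultimately show ?thesis by blast
    qed
    then obtain k where k: "\<And>j. R \<le> real j \<Longrightarrow> k j \<in> K j \<and> x \<in> gauge_ball (grid_pt (int j) (k j)) (r j)" by metis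
    have "(\<lambda>j. (j, k j)) ` {j. R \<le> real j} \<subseteq> {i \<in> Sigma UNIV K. x \<in> gauge_ball (case i of (j, k) \<Rightarrow> grid_pt (int j) k) (case i of (j, k) \<Rightarrow> r j)}"
      using k by auto
    moreover have "infinite {j. R \<le> real j}"
    proof -
      have "{nat \<lceil>R\<rceil>..} \<subseteq> {j. R \<le> real j}" by (auto simp: nat_le_iff) linarith
      then show ?thesis using infinite_Ici infinite_super by blast
    qed
    then have "infinite ((\<lambda>j. (j, k j)) ` {j. R \<le> real j})"
      by (subst finite_image_iff) (auto simp: inj_on_def)
    ultimately show "infinite {i \<in> Sigma UNIV K. x \<in> gauge_ball (case i of (j, k) \<Rightarrow> grid_pt (int j) k) (case i of (j, k) \<Rightarrow> r j)}"
      using infinite_super by blast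
  qed (use t in \<open>auto simp: r_def\<close>)
qed

lemma hausdorff_dim_le_hdim: "hausdorff_dim E \<le> 4"
proof (rule ereal_le_epsilon2)
  fix e :: real assume "0 < e"
  then have "hausdorff_dim E \<le> ereal (4 + e)"
    by (intro hausdorff_dim_le hausdorff_measure_gt_hdim) auto
  then show "hausdorff_dim E \<le> 4 + ereal e" by simp
qed

section \<open>Estimates for the wavelet series\<close>

text \<open>The condition n - 1 \<le> w \<le> n makes one power serve both regimes: it dominates the
  remainder of order \<open>n\<close> for small \<open>z\<close> and the polynomial of degree at
  most n - 1 for large \<open>z\<close>. There \<open>g (y \<star> z)\<close> is kept apart, because
  it decays in \<open>y \<star> z\<close> and not in \<open>y\<close>. The factor exp(4 / \<rho>)
  moves the decay from points within distance 4 back to \<open>y\<close>.\<close>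

lemma htaylor_estimate:
  assumes n: "1 \<le> n" and \<rho>: "0 < \<rho>"
    and D: "\<And>w. word_weight w \<le> n + 1 \<Longrightarrow> iter_differentiable left_field w g"
    and B: "\<And>w x. word_weight w \<le> n + 1 \<Longrightarrow> \<bar>iter_deriv left_field w g x\<bar> \<le> A * exp (- hnorm x / \<rho>)"
    and w: "real n - 1 \<le> w" "w \<le> real n"
  shows "\<bar>g (y \<star> z) - htaylor n g y z\<bar> \<le>
    (real ((n + 1) ^ 3) * 3 ^ n * exp (4 / \<rho>)) * A * hnorm z powr w * exp (- hnorm y / \<rho>) +
    (if 1 < hnorm z then \<bar>g (y \<star> z)\<bar> else 0)"
proof -
  define E where "E = exp (- hnorm y / \<rho>)"
  define N where "N = hnorm z"
  have E: "0 < E" by (simp add: E_def)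
  have N: "0 \<le> N" by (simp add: N_def)
  have A: "0 \<le> A" using order_trans[OF abs_ge_zero B[of "[]" 0]] by (simp add: word_weight_def)
  define C where "C = real ((n + 1) ^ 3) * 3 ^ n * exp (4 / \<rho>)"
  have e1: "1 \<le> exp (4 / \<rho>)" using \<rho> by simp
  have cube: "real ((n + 1) ^ 2) * 3 ^ n * exp (4 / \<rho>) \<le> C" "real (n ^ 3) * 3 ^ n \<le> C"
  proof -
    have "real ((n + 1) ^ 2) \<le> real ((n + 1) ^ 3)"
      by (intro of_nat_mono power_increasing) auto
    then show "real ((n + 1) ^ 2) * 3 ^ n * exp (4 / \<rho>) \<le> C"
      unfolding C_def by (intro mult_right_mono) auto
    have "real (n ^ 3) \<le> real ((n + 1) ^ 3)"
      by (intro of_nat_mono power_mono) auto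
    then have "real (n ^ 3) * 3 ^ n * 1 \<le> C"
      unfolding C_def using e1 by (intro mult_mono) auto
    then show "real (n ^ 3) * 3 ^ n \<le> C" by simp
  qed
  show ?thesis
  proof (cases "1 < hnorm z")
    case False
    have "\<bar>iter_deriv left_field w' g (y \<star> x)\<bar> \<le> A * (exp (4 / \<rho>) * E)" if "word_weight w' \<le> n + 1" "hnorm x \<le> 4" for w' x
    proof -
      have "hnorm y \<le> hnorm (y \<star> x) + 4" using hnorm_le_hmul_right[of y x] that(2) by simp
      then have "- hnorm (y \<star> x) / \<rho> \<le> 4 / \<rho> + - hnorm y / \<rho>"
        using \<rho> by (simp add: field_simps)
      then have "exp (- hnorm (y \<star> x) / \<rho>) \<le> exp (4 / \<rho>) * E"
        unfolding E_def exp_add[symmetric] by simp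
      then show ?thesis using B[OF that(1), of "y \<star> x"] mult_left_mono[OF _ A] order_trans by blast
    qed
    then have "\<bar>g (y \<star> z) - htaylor n g y z\<bar> \<le> real ((n + 1) ^ 2) * 3 ^ n * (A * (exp (4 / \<rho>) * E)) * N ^ n"
      unfolding N_def by (intro htaylor_remainder D) (use False in auto)
    also have "\<dots> = (real ((n + 1) ^ 2) * 3 ^ n * exp (4 / \<rho>)) * (A * N ^ n * E)"
      by (simp only: mult_ac)
    also have "\<dots> \<le> C * (A * N ^ n * E)"
      by (intro mult_right_mono cube) (use A N E in auto)
    also have "N ^ n \<le> N powr w"
    proof (cases "N = 0")
      case True
      then show ?thesis using n by (simp add: zero_power)
    next
      case False
      then have "N ^ n = N powr real n" using N by (simp add: powr_realpow)
      also have "\<dots> \<le> N powr w"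
        by (rule powr_mono') (use \<open>\<not> 1 < hnorm z\<close> N w in \<open>auto simp: N_def\<close>)
      finally show ?thesis .
    qed
    then have "C * (A * N ^ n * E) \<le> C * (A * N powr w * E)"
      by (intro mult_left_mono mult_right_mono) (use A E in \<open>auto simp: C_def\<close>)
    finally show ?thesis using False by (simp add: C_def N_def E_def mult.assoc)
  next
    case True
    have "\<bar>htaylor n g y z\<bar> \<le> real (n ^ 3) * 3 ^ n * (A * E) * N ^ (n - 1)"
      unfolding N_def E_def by (intro abs_htaylor_le B) (use True in auto)
    also have "\<dots> = (real (n ^ 3) * 3 ^ n) * (A * N ^ (n - 1) * E)"
      by (simp only: mult_ac)
    also have "\<dots> \<le> C * (A * N ^ (n - 1) * E)"
      by (intro mult_right_mono cube) (use A N E in auto)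
    finally have le: "\<bar>htaylor n g y z\<bar> \<le> C * (A * N ^ (n - 1) * E)" .
    have "N ^ (n - 1) = N powr real (n - 1)" using True by (simp add: powr_realpow N_def)
    also have "\<dots> \<le> N powr w"
      by (rule powr_mono) (use True n w in \<open>auto simp: N_def of_nat_diff\<close>)
    finally have "C * (A * N ^ (n - 1) * E) \<le> C * (A * N powr w * E)"
      by (intro mult_left_mono mult_right_mono) (use A E in \<open>auto simp: C_def\<close>)
    with le have "\<bar>htaylor n g y z\<bar> \<le> C * A * N powr w * E" by (simp only: mult.assoc)
    then show ?thesis
      using True abs_triangle_ineq4[of "g (y \<star> z)" "htaylor n g y z"]
      by (simp add: C_def N_def E_def)
  qed
qed

text \<open>For \<open>j \<ge> 0\<close> the two available bounds for the coefficient are interpolated on the part of the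
  wavelet that is not controlled by the Taylor expansion; this gives geometric decay in \<open>j\<close>
  without a logarithmic loss.\<close>

lemma wavelet_term_bound:
  fixes j :: int
  assumes \<rho>: "0 < \<rho>" and A: "0 \<le> A" "0 \<le> C1"
    and D: "\<And>w. word_weight w \<le> N0 + 1 \<Longrightarrow> iter_differentiable left_field w g"
    and B: "\<And>w x. word_weight w \<le> N0 + 1 \<Longrightarrow> \<bar>iter_deriv left_field w g x\<bar> \<le> A * exp (- hnorm x / \<rho>)"
    and N: "1 \<le> N" "N \<le> N0" "real N - 1 \<le> u" "u \<le> real N"
    and par: "0 < u" "u < v" "0 < \<sigma>" "\<sigma> < real N0"
    and \<tau>: "\<tau> \<le> real N0 - \<sigma>" "\<tau> \<le> v - u" "\<tau> \<le> \<sigma> * (1 - u / v)"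
    and c1: "\<bar>c\<bar> \<le> C1 * 2 powr (- \<sigma> * real_of_int j)"
    and c2: "0 \<le> j \<Longrightarrow> \<bar>c\<bar> \<le> C1 * (2 powr (- real_of_int j) * (1 + hnorm y)) powr v"
    and z: "hnorm z = 2 powr real_of_int j * X" "0 \<le> X"
  shows "\<bar>c * (g (y \<star> z) - htaylor (if j < 0 then N0 else N) g y z)\<bar> \<le>
    C1 * A * (real ((N0 + 1) ^ 3) * 3 ^ N0 * exp (4 / \<rho>) + 2 powr u) * 2 powr (- \<tau> * \<bar>real_of_int j\<bar>) *
      (X powr u + X powr real N0) * (decay v \<rho> y + decay v \<rho> (y \<star> z))"
proof -
  define K where "K = real ((N0 + 1) ^ 3) * 3 ^ N0 * exp (4 / \<rho>)"
  define G where "G = \<bar>g (y \<star> z)\<bar>"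
  define W1 W2 where "W1 = decay v \<rho> y" and "W2 = decay v \<rho> (y \<star> z)"
  define S where "S = 2 powr (- \<tau> * \<bar>real_of_int j\<bar>)"
  have v: "0 < v" using par by simp
  have K: "1 \<le> K" "0 \<le> K"
  proof -
    have "1 * 1 * 1 \<le> K"
      unfolding K_def using \<rho> by (intro mult_mono one_le_power) (auto simp: one_le_power)
    then show "1 \<le> K" "0 \<le> K" by auto
  qed
  have W: "0 \<le> W1" "0 \<le> W2" "0 \<le> S" by (simp_all add: W1_def W2_def S_def decay_nonneg)
  have u2: "1 \<le> 2 powr u" using par by (simp add: ge_one_powr_ge_zero)
  have G: "G \<le> A * exp (- hnorm (y \<star> z) / \<rho>)"
    using B[of "[]" "y \<star> z"] by (simp add: word_weight_def G_def)
  have e1: "exp (- hnorm y / \<rho>) \<le> W1" and e2: "exp (- hnorm (y \<star> z) / \<rho>) \<le> W2"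
    unfolding W1_def W2_def using v by (intro exp_le_decay; simp)+
  show ?thesis
  proof (cases "j < 0")
    case True
    have zpow: "hnorm z powr real N0 = 2 powr (real N0 * real_of_int j) * X powr real N0"
      unfolding z(1) using z(2) by (simp add: powr_mult powr_powr mult.commute)
    \<comment> \<open>At low frequencies the coefficient bound grows as j decreases, and the Taylor
      order \<open>N0\<close> > \<sigma> more than compensates.\<close>
    have jS: "2 powr (- \<sigma> * real_of_int j) * 2 powr (real N0 * real_of_int j) \<le> S"
    proof -
      have "- \<sigma> * real_of_int j + real N0 * real_of_int j = - ((real N0 - \<sigma>) * \<bar>real_of_int j\<bar>)"
        using True by (simp add: algebra_simps)
      also have "\<dots> \<le> - \<tau> * \<bar>real_of_int j\<bar>"
        using mult_right_mono[OF \<tau>(1), of "\<bar>real_of_int j\<bar>"] by simp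
      finally show ?thesis unfolding S_def powr_add[symmetric] by (intro powr_mono) auto
    qed
    have "\<bar>g (y \<star> z) - htaylor N0 g y z\<bar> \<le> K * A * hnorm z powr real N0 * exp (- hnorm y / \<rho>) + (if 1 < hnorm z then G else 0)"
      unfolding K_def G_def by (rule htaylor_estimate) (use N \<rho> D B in auto)
    also have "(if 1 < hnorm z then G else 0) \<le> A * hnorm z powr real N0 * W2"
    proof (cases "1 < hnorm z")
      case True
      have "G \<le> A * W2" using G mult_left_mono[OF e2 A(1)] by linarith
      also have "\<dots> \<le> A * W2 * hnorm z powr real N0"
        using mult_left_mono[of 1 "hnorm z powr real N0" "A * W2"] True A W N
        by (simp add: ge_one_powr_ge_zero)
      finally show ?thesis using True by (simp add: mult_ac)
    qed (use A W in auto)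
    also have "K * A * hnorm z powr real N0 * exp (- hnorm y / \<rho>) + A * hnorm z powr real N0 * W2
        \<le> K * A * hnorm z powr real N0 * W1 + K * A * hnorm z powr real N0 * W2"
      using e1 A K W mult_right_mono[OF K(1), of "A * hnorm z powr real N0 * W2"]
      by (intro add_mono mult_left_mono) (auto simp: mult_ac)
    also have "\<dots> = K * A * hnorm z powr real N0 * (W1 + W2)" by (simp only: distrib_left)
    finally have "\<bar>g (y \<star> z) - htaylor N0 g y z\<bar> \<le> K * A * hnorm z powr real N0 * (W1 + W2)"
      by simp
    then have "\<bar>c * (g (y \<star> z) - htaylor N0 g y z)\<bar> \<le>
        (C1 * 2 powr (- \<sigma> * real_of_int j)) * (K * A * hnorm z powr real N0 * (W1 + W2))"
      unfolding abs_mult using c1 A by (intro mult_mono) auto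
    also have "\<dots> = (C1 * A * K * X powr real N0 * (W1 + W2)) * (2 powr (- \<sigma> * real_of_int j) * 2 powr (real N0 * real_of_int j))"
      unfolding zpow by (simp only: mult_ac)
    also have "\<dots> \<le> (C1 * A * K * X powr real N0 * (W1 + W2)) * S"
      using A K W by (intro mult_left_mono[OF jS]) auto
    also have "\<dots> = (C1 * A * S * (W1 + W2)) * (K * X powr real N0)" by (simp only: mult_ac)
    also have "\<dots> \<le> (C1 * A * S * (W1 + W2)) * ((K + 2 powr u) * (X powr u + X powr real N0))"
      using A K W u2 by (intro mult_left_mono mult_mono) auto
    finally show ?thesis
      using True unfolding K_def W1_def W2_def S_def by (simp add: mult_ac)
  next
    case False
    then have j: "0 \<le> j" by simp
    define h where "h = 1 + hnorm y"
    have h: "1 \<le> h" by (simp add: h_def)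
    have c2': "\<bar>c\<bar> \<le> C1 * (2 powr (- v * real_of_int j) * h powr v)"
      using c2[OF j] h unfolding h_def[symmetric] by (simp add: powr_mult powr_powr mult.commute)
    have zpow: "hnorm z powr u = 2 powr (u * real_of_int j) * X powr u"
      unfolding z(1) using z(2) by (simp add: powr_mult powr_powr mult.commute)
    have jS: "2 powr (- v * real_of_int j) * 2 powr (u * real_of_int j) \<le> S"
      using mult_right_mono[OF \<tau>(2), of "real_of_int j"] j
      unfolding S_def powr_add[symmetric] by (intro powr_mono) (auto simp: algebra_simps)
    \<comment> \<open>The Taylor part: the growth \<open>h powr v\<close> of the coefficient bound
      is absorbed into the weight at \<open>y\<close>, which leaves 2^((u - v) j).\<close>
    have t1: "\<bar>c\<bar> * (K * A * hnorm z powr u * exp (- hnorm y / \<rho>)) \<le> C1 * A * S * X powr u * (K * W1)"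
    proof -
      have "\<bar>c\<bar> * (K * A * hnorm z powr u * exp (- hnorm y / \<rho>)) \<le>
          (C1 * (2 powr (- v * real_of_int j) * h powr v)) * (K * A * hnorm z powr u * exp (- hnorm y / \<rho>))"
        using A K by (intro mult_right_mono c2') auto
      also have "\<dots> = (C1 * A * K * X powr u * W1) * (2 powr (- v * real_of_int j) * 2 powr (u * real_of_int j))"
        unfolding zpow W1_def decay_def h_def[symmetric] by (simp only: mult_ac)
      also have "\<dots> \<le> (C1 * A * K * X powr u * W1) * S"
        using A K W by (intro mult_left_mono[OF jS]) auto
      finally show ?thesis by (simp only: mult_ac)
    qed
    have t2: "\<bar>c\<bar> * (if 1 < hnorm z then G else 0) \<le> C1 * A * S * X powr u * (2 powr u * W2)"
    proof (cases "1 < hnorm z")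
      case True
      \<comment> \<open>With this exponent the second bound contributes exactly the power
        \<open>u\<close> of 2^(-j) h, while the fraction 1 - \<theta> of the first leaves the decay
        2^(-\<sigma> (1 - \<theta>) j).\<close>
      define \<theta> where "\<theta> = u / v"
      have \<theta>: "0 < \<theta>" "\<theta> < 1" "v * \<theta> = u" using par by (auto simp: \<theta>_def)
      define H where "H = 1 + hnorm (y \<star> z)"
      have H: "1 \<le> H" by (simp add: H_def)
      \<comment> \<open>Growth at \<open>y\<close> is transferred to \<open>y \<star> z\<close>,
        where \<open>g\<close> decays, at the price of a factor \<open>hnorm z\<close>; the 2^j in
        it cancels the 2^(-j).\<close>
      have "h \<le> H + hnorm z" using hnorm_le_hmul_right[of y z] by (simp add: h_def H_def)
      also have "\<dots> \<le> 2 * (H * hnorm z)"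
        using mult_mono[of 1 H "1" "hnorm z"] mult_right_mono[OF H, of "hnorm z"] mult_left_mono[of 1 "hnorm z" H] H True by linarith
      finally have hH: "h \<le> 2 * (H * hnorm z)" .
      have "\<bar>c\<bar> = \<bar>c\<bar> powr (1 - \<theta>) * \<bar>c\<bar> powr \<theta>"
        by (simp add: powr_add[symmetric] abs_if)
      also have "\<dots> \<le> (C1 * 2 powr (- \<sigma> * real_of_int j)) powr (1 - \<theta>) * (C1 * (2 powr (- v * real_of_int j) * h powr v)) powr \<theta>"
        using \<theta> by (intro mult_mono powr_mono2 c1 c2') auto
      also have "\<dots> = C1 * (2 powr (- \<sigma> * real_of_int j * (1 - \<theta>)) * (2 powr (- u * real_of_int j) * h powr u))"
      proof -
        have "C1 powr (1 - \<theta>) * C1 powr \<theta> = C1" using A by (simp add: powr_add[symmetric])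
        moreover have "v * real_of_int j * \<theta> = u * real_of_int j" using \<theta>(3) by (metis mult.assoc mult.commute)
        ultimately show ?thesis
          using A h \<theta>(3) by (simp add: powr_mult powr_powr mult_ac) (metis mult.assoc mult.commute)
      qed
      also have "\<dots> \<le> C1 * (S * (2 powr (- u * real_of_int j) * (2 * (H * hnorm z)) powr u))"
      proof (intro mult_left_mono mult_mono powr_mono2)
        have "\<tau> * real_of_int j \<le> \<sigma> * (1 - \<theta>) * real_of_int j"
          using \<tau>(3) j unfolding \<theta>_def by (intro mult_right_mono) auto
        then show "2 powr (- \<sigma> * real_of_int j * (1 - \<theta>)) \<le> S"
          unfolding S_def using j by (intro powr_mono) (auto simp: mult_ac)
      qed (use par h hH A W in auto)
      also have "2 powr (- u * real_of_int j) * (2 * (H * hnorm z)) powr u = 2 powr u * (H powr u * X powr u)"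
        using H z(2) unfolding z(1) by (simp add: powr_mult powr_powr powr_minus mult.commute)
      finally have cle: "\<bar>c\<bar> \<le> C1 * (S * (2 powr u * (H powr u * X powr u)))" .
      have "H powr u \<le> H powr v" using H par by (intro powr_mono) auto
      then have HW: "H powr u * exp (- hnorm (y \<star> z) / \<rho>) \<le> W2"
        unfolding W2_def decay_def H_def[symmetric] by (intro mult_right_mono) auto
      have "\<bar>c\<bar> * G \<le> (C1 * (S * (2 powr u * (H powr u * X powr u)))) * (A * exp (- hnorm (y \<star> z) / \<rho>))"
        using cle G A W by (intro mult_mono) (auto simp: G_def)
      also have "\<dots> = (C1 * A * S * X powr u * 2 powr u) * (H powr u * exp (- hnorm (y \<star> z) / \<rho>))"
        by (simp only: mult_ac)
      also have "\<dots> \<le> (C1 * A * S * X powr u * 2 powr u) * W2"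
        using A W by (intro mult_left_mono[OF HW]) auto
      finally show ?thesis using True by (simp add: mult_ac)
    qed (use A W in auto)
    have "\<bar>g (y \<star> z) - htaylor N g y z\<bar> \<le>
        real ((N + 1) ^ 3) * 3 ^ N * exp (4 / \<rho>) * A * hnorm z powr u * exp (- hnorm y / \<rho>) + (if 1 < hnorm z then G else 0)"
      unfolding G_def by (rule htaylor_estimate) (use N \<rho> D B in auto)
    also have "real ((N + 1) ^ 3) * 3 ^ N * exp (4 / \<rho>) * A * hnorm z powr u * exp (- hnorm y / \<rho>) \<le> K * A * hnorm z powr u * exp (- hnorm y / \<rho>)"
      unfolding K_def using N A by (intro mult_right_mono mult_mono power_mono power_increasing of_nat_mono) auto
    finally have "\<bar>g (y \<star> z) - htaylor N g y z\<bar> \<le> K * A * hnorm z powr u * exp (- hnorm y / \<rho>) + (if 1 < hnorm z then G else 0)"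
      by simp
    then have "\<bar>c * (g (y \<star> z) - htaylor N g y z)\<bar> \<le> \<bar>c\<bar> * (K * A * hnorm z powr u * exp (- hnorm y / \<rho>) + (if 1 < hnorm z then G else 0))"
      unfolding abs_mult by (rule mult_left_mono) simp
    also have "\<dots> \<le> C1 * A * S * X powr u * (K * W1) + C1 * A * S * X powr u * (2 powr u * W2)"
      unfolding distrib_left using t1 t2 by (rule add_mono)
    also have "\<dots> = (C1 * A * S) * (X powr u * (K * W1 + 2 powr u * W2))" by (simp only: distrib_left mult.assoc)
    also have "\<dots> \<le> (C1 * A * S) * ((X powr u + X powr real N0) * ((K + 2 powr u) * W1 + (K + 2 powr u) * W2))"
      using A K W u2 by (intro mult_left_mono mult_mono add_mono mult_right_mono) auto
    also have "\<dots> = C1 * A * (K + 2 powr u) * S * (X powr u + X powr real N0) * (W1 + W2)"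
      unfolding distrib_left[symmetric] by (simp only: mult_ac)
    finally show ?thesis
      using False by (simp only: K_def W1_def W2_def S_def if_False)
  qed
qed

section \<open>Null sets, measurability and derivatives of the wavelets\<close>

text \<open>A left translation is a linear shear followed by a Euclidean translation, and both
  preserve negligible sets.\<close>

lemma AE_left_translation:
  assumes "AE y in lebesgue. Q y"
  shows "AE x in lebesgue. Q (x0 \<star> x)"
proof -
  obtain p0 q0 r0 where h: "hinv x0 = (p0, q0, r0)" by (cases "hinv x0")
  define L where "L = (\<lambda>x::heis. (fst x, fst (snd x), snd (snd x) + 2 * (q0 * fst x - p0 * fst (snd x))))"
  have "linear L" by (rule linearI) (auto simp: L_def algebra_simps)
  obtain N where N: "N \<in> null_sets lebesgue" "{y. \<not> Q y} \<subseteq> N"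
    using assms by (auto simp: eventually_ae_filter)
  have "negligible N" using N(1) by (simp add: negligible_iff_null_sets)
  then have "negligible (L ` N)" by (intro negligible_differentiable_image_negligible linear_imp_differentiable_on \<open>linear L\<close>) auto
  then have "negligible ((+) (hinv x0) ` (L ` N))" by (rule negligible_translation)
  moreover have "{x. \<not> Q (x0 \<star> x)} \<subseteq> (+) (hinv x0) ` (L ` N)"
  proof
    fix x assume "x \<in> {x. \<not> Q (x0 \<star> x)}"
    then have "x0 \<star> x \<in> N" using N(2) by auto
    moreover have "hinv x0 + L y = hinv x0 \<star> y" for y by (cases y) (simp add: h L_def)
    then have "x = hinv x0 + L (x0 \<star> x)" by simp
    ultimately show "x \<in> (+) (hinv x0) ` (L ` N)" by (intro image_eqI[where x = "L (x0 \<star> x)"] imageI)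
  qed
  ultimately have "{x. \<not> Q (x0 \<star> x)} \<in> null_sets lebesgue"
    using negligible_subset negligible_iff_null_sets by blast
  then show ?thesis by (rule AE_I') auto
qed

lemma continuous_hnorm_translate: "continuous_on UNIV (\<lambda>y. hnorm (x0 \<star> y))"
proof -
  obtain p0 q0 r0 where "x0 = (p0, q0, r0)" by (cases x0)
  then have "(\<lambda>y. hnorm (x0 \<star> y)) = (\<lambda>y. root 4 (((p0 + fst y)\<^sup>2 + (q0 + fst (snd y))\<^sup>2)\<^sup>2 +
      (r0 + snd (snd y) + 2 * (q0 * fst y - p0 * fst (snd y)))\<^sup>2))"
    by (auto simp: fun_eq_iff hnorm.simps)
  then show ?thesis by (simp only:) (intro continuous_intros)
qed

text \<open>Of the weight below 4 M - 4 available for \<open>\<theta> \<epsilon>\<close>, the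
  \<open>M\<close> sub-Laplacians use up 2 M.\<close>

lemma mother_derivatives:
  assumes "lemarie_wavelets M \<theta>"
  obtains A \<rho> where "0 \<le> A" "0 < \<rho>"
    "\<And>\<epsilon> w. \<epsilon> \<in> wtypes \<Longrightarrow> int (word_weight w) < 2 * int M - 4 \<Longrightarrow> iter_differentiable left_field w (mother M \<theta> \<epsilon>)"
    "\<And>\<epsilon> w x. \<epsilon> \<in> wtypes \<Longrightarrow> int (word_weight w) < 2 * int M - 4 \<Longrightarrow>
      \<bar>iter_deriv left_field w (mother M \<theta> \<epsilon>) x\<bar> \<le> A * exp (- hnorm x / \<rho>)"
proof -
  obtain C0 r0 where C0: "0 < C0" "0 < r0" and all: "\<forall>\<epsilon>\<in>wtypes.
        (\<forall>w. int (word_weight w) < 4 * int M - hdim \<longrightarrow>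
           iter_differentiable left_field w (\<theta> \<epsilon>) \<and>
           (\<forall>x. \<bar>iter_deriv left_field w (\<theta> \<epsilon>) x\<bar> \<le> C0 * exp (- hnorm x / r0))) \<and>
        (\<forall>P\<in>hpoly (real (2 * M)). (LINT x|lebesgue. mother M \<theta> \<epsilon> x * P x) = 0) \<and>
        (\<forall>x. \<bar>mother M \<theta> \<epsilon> x\<bar> \<le> C0 * exp (- hnorm x / r0))"
    using assms[unfolded lemarie_wavelets_def, THEN conjunct2, THEN conjunct2, THEN conjunct1]
    by (elim exE conjE) (rule that)
  have B: "iter_differentiable left_field w (\<theta> \<epsilon>)"
    "\<bar>iter_deriv left_field w (\<theta> \<epsilon>) x\<bar> \<le> C0 * exp (- hnorm x / r0)"
    if "\<epsilon> \<in> wtypes" "int (word_weight w) < 4 * int M - 4" for \<epsilon> w x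
    using bspec[OF all that(1), THEN conjunct1, rule_format, OF that(2)] by blast+
  have *: "iter_differentiable left_field w (mother M \<theta> \<epsilon>) \<and>
      \<bar>iter_deriv left_field w (mother M \<theta> \<epsilon>) x\<bar> \<le> 2 ^ M * (C0 * exp (- hnorm x / r0))"
    if "\<epsilon> \<in> wtypes" "int (word_weight w) < 2 * int M - 4" for \<epsilon> w x
    unfolding mother_def
    using that(2) by (intro sublap_power_bound[where n = "nat (2 * int M - 4)"] B that(1)) auto
  show ?thesis
  proof (rule that[of "2 ^ M * C0" r0])
    fix \<epsilon> w x assume "\<epsilon> \<in> wtypes" "int (word_weight w) < 2 * int M - 4"
    from *[OF this] show "iter_differentiable left_field w (mother M \<theta> \<epsilon>)"
      "\<bar>iter_deriv left_field w (mother M \<theta> \<epsilon>) x\<bar> \<le> 2 ^ M * C0 * exp (- hnorm x / r0)"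
      unfolding mult.assoc by blast+
  qed (use C0 in auto)
qed

lemma wavelet_measurable:
  assumes "lemarie_wavelets M \<theta>" "\<epsilon> \<in> wtypes"
  shows "wavelet M \<theta> \<epsilon> j k \<in> borel_measurable lebesgue"
proof -
  define s where "s = (2::real) powr (real_of_int j * hdim / 2)"
  have "(\<lambda>x. s * wavelet M \<theta> \<epsilon> j k x) \<in> borel_measurable lebesgue"
  proof -
    have hb: "\<forall>i\<in>wtypes \<times> UNIV \<times> UNIV.
        (\<lambda>(\<epsilon>, j, k) x. 2 powr (real_of_int j * hdim / 2) * wavelet M \<theta> \<epsilon> j k x) i \<in> L2"
      using assms(1)[unfolded lemarie_wavelets_def, THEN conjunct2, THEN conjunct2, THEN conjunct2]
      unfolding hilbert_basis_L2_def by (rule conjunct1)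
    have "(\<epsilon>, j, k) \<in> wtypes \<times> UNIV \<times> UNIV" using assms(2) by simp
    from bspec[OF hb this] show ?thesis
      unfolding prod.case s_def[symmetric] L2_def by blast
  qed
  then have m: "(\<lambda>x. (1 / s) * (s * wavelet M \<theta> \<epsilon> j k x)) \<in> borel_measurable lebesgue"
    by (rule borel_measurable_times[OF borel_measurable_const])
  have eq: "(\<lambda>x. (1 / s) * (s * wavelet M \<theta> \<epsilon> j k x)) = wavelet M \<theta> \<epsilon> j k"
    by (simp add: s_def fun_eq_iff)
  show ?thesis using m unfolding eq .
qed

text \<open>Puts a wavelet near \<open>x0\<close> into the form g(y \<star> z) of the Taylor
  estimates: \<open>y\<close> is the rescaled base point seen from the lattice point,
  \<open>z\<close> the rescaled increment.\<close>

lemma wavelet_left_translate: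
  "wavelet M \<theta> \<epsilon> j k (x0 \<star> x) =
    mother M \<theta> \<epsilon> ((hinv (lattice_pt k) \<star> dil (2 powi j) x0) \<star> dil (2 powi j) x)"
  by (simp only: wavelet_def dil_grid_pt) (simp only: dil_hmul hmul_assoc)

text \<open>The lattice sum is bounded uniformly in its centre, so \<open>X\<close> and
  \<open>Y\<close> may vary with the scale; what remains is a two-sided geometric series, times the
  15 wavelet types.\<close>

lemma sum_wavelet_weights:
  assumes "0 < \<rho>" "0 < \<tau>"
  obtains C where "0 \<le> C" "\<And>F X Y. finite F \<Longrightarrow> F \<subseteq> wtypes \<times> UNIV \<times> UNIV \<Longrightarrow>
    (\<Sum>(\<epsilon>, j, k)\<in>F. 2 powr (- \<tau> * \<bar>real_of_int j\<bar>) *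
      (decay v \<rho> (hinv (lattice_pt k) \<star> X j) + decay v \<rho> (hinv (lattice_pt k) \<star> Y j))) \<le> C"
proof -
  obtain D where D: "0 \<le> D" "\<And>A y. finite A \<Longrightarrow> (\<Sum>k\<in>A. decay v \<rho> (hinv (lattice_pt k) \<star> y)) \<le> D"
    using sum_decay_lattice[OF assms(1)] by blast
  define \<kappa> where "\<kappa> = (2::real) powr (- \<tau>)"
  have \<kappa>: "0 < \<kappa>" "\<kappa> < 1" using assms powr_less_mono[of "- \<tau>" 0 2] by (auto simp: \<kappa>_def)
  have sm: "summable (\<lambda>n. \<kappa> ^ n)" using \<kappa> by (intro summable_geometric) auto
  define S where "S = suminf (\<lambda>n. \<kappa> ^ n)"
  have S: "0 \<le> S" unfolding S_def by (rule suminf_nonneg[OF sm]) (use \<kappa> in auto)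
  have pw: "2 powr (- \<tau> * \<bar>real_of_int j\<bar>) = \<kappa> ^ nat \<bar>j\<bar>" for j :: int
    using \<kappa> by (simp add: \<kappa>_def powr_realpow[symmetric] powr_powr)
  show ?thesis
  proof (rule that[of "15 * (2 * S * (D + D))"])
    show "0 \<le> 15 * (2 * S * (D + D))" using S D by simp
    fix F :: "(nat \<times> int \<times> lattice) set" and X Y :: "int \<Rightarrow> heis"
    assume F: "finite F" "F \<subseteq> wtypes \<times> UNIV \<times> UNIV"
    define J K where "J = (fst \<circ> snd) ` F" and "K = (snd \<circ> snd) ` F"
    have fin: "finite J" "finite K" using F by (auto simp: J_def K_def)
    have sub: "F \<subseteq> wtypes \<times> J \<times> K"
    proof
      fix i assume "i \<in> F"
      then show "i \<in> wtypes \<times> J \<times> K"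
        unfolding J_def K_def mem_Times_iff
        using F(2) imageI[of i F "fst \<circ> snd"] imageI[of i F "snd \<circ> snd"] by (auto simp del: image_comp)
    qed
    let ?w = "\<lambda>j k. decay v \<rho> (hinv (lattice_pt k) \<star> X j) + decay v \<rho> (hinv (lattice_pt k) \<star> Y j)"
    have "(\<Sum>(\<epsilon>, j, k)\<in>F. 2 powr (- \<tau> * \<bar>real_of_int j\<bar>) * ?w j k) \<le>
        (\<Sum>(\<epsilon>, j, k)\<in>wtypes \<times> J \<times> K. 2 powr (- \<tau> * \<bar>real_of_int j\<bar>) * ?w j k)"
      by (rule sum_mono2) (use fin sub in \<open>auto intro!: mult_nonneg_nonneg add_nonneg_nonneg decay_nonneg\<close>)
    also have "\<dots> = (\<Sum>\<epsilon>\<in>wtypes. \<Sum>j\<in>J. \<Sum>k\<in>K. 2 powr (- \<tau> * \<bar>real_of_int j\<bar>) * ?w j k)"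
      by (simp only: sum.cartesian_product)
    also have "\<dots> = 15 * (\<Sum>j\<in>J. 2 powr (- \<tau> * \<bar>real_of_int j\<bar>) * (\<Sum>k\<in>K. ?w j k))"
      by (simp add: sum_distrib_left)
    also have "\<dots> \<le> 15 * (\<Sum>j\<in>J. 2 powr (- \<tau> * \<bar>real_of_int j\<bar>) * (D + D))"
      unfolding sum.distrib by (intro mult_left_mono sum_mono add_mono D fin) auto
    also have "\<dots> = 15 * ((\<Sum>j\<in>J. \<kappa> ^ nat \<bar>j\<bar>) * (D + D))"
      by (simp only: pw sum_distrib_right)
    also have "\<dots> \<le> 15 * (2 * S * (D + D))"
      unfolding S_def by (intro mult_left_mono mult_right_mono sum_int_le fin sm) (use D \<kappa> in auto)
    finally show "(\<Sum>(\<epsilon>, j, k)\<in>F. 2 powr (- \<tau> * \<bar>real_of_int j\<bar>) * ?w j k) \<le> 15 * (2 * S * (D + D))" .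
  qed
qed

section \<open>Termwise integration against test functions\<close>

lemma locally_integrable_bound:
  assumes g: "g \<in> borel_measurable lebesgue"
    and B: "continuous_on UNIV B" "\<And>y. \<bar>g y\<bar> \<le> B y"
  shows "locally_integrable g"
  unfolding locally_integrable_def set_integrable_def
proof (intro allI impI)
  fix K :: "heis set" assume K: "compact K"
  show "integrable lebesgue (\<lambda>y. indicator K y *\<^sub>R g y)"
  proof (rule Bochner_Integration.integrable_bound)
    show "integrable lebesgue (\<lambda>y. indicator K y *\<^sub>R B y)"
      using locally_integrable_continuous[OF B(1)] K unfolding locally_integrable_def set_integrable_def by blast
    have "K \<in> sets lebesgue" using K by (simp add: borel_compact)
    then show "(\<lambda>y. indicator K y *\<^sub>R g y) \<in> borel_measurable lebesgue"
      using g by (intro borel_measurable_scaleR borel_measurable_indicator)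
    show "AE y in lebesgue. norm (indicator K y *\<^sub>R g y) \<le> norm (indicator K y *\<^sub>R B y)"
    proof (rule AE_I2)
      fix y
      have "\<bar>g y\<bar> \<le> \<bar>B y\<bar>" using B(2)[of y] by linarith
      then show "norm (indicator K y *\<^sub>R g y) \<le> norm (indicator K y *\<^sub>R B y)"
        by (simp add: abs_mult mult_left_mono)
    qed
  qed
qed

text \<open>An unconditional sum may be evaluated along any enumeration of \<open>I\<close>. The
  partial sums are dominated by \<open>B\<close>, which is integrable against a compactly supported
  \<phi>, so dominated convergence exchanges sum and integral.\<close>

lemma has_sum_integral_test:
  fixes H :: "'i \<Rightarrow> heis \<Rightarrow> real"
  assumes I: "countable I" "infinite I"
    and H: "\<And>i. i \<in> I \<Longrightarrow> H i \<in> borel_measurable lebesgue"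
    and B: "continuous_on UNIV B" "\<And>F y. finite F \<Longrightarrow> F \<subseteq> I \<Longrightarrow> (\<Sum>i\<in>F. \<bar>H i y\<bar>) \<le> B y"
  shows "locally_integrable (\<lambda>y. \<Sum>\<^sub>\<infinity>i\<in>I. H i y)" and "\<bar>\<Sum>\<^sub>\<infinity>i\<in>I. H i y\<bar> \<le> B y"
    and "\<phi> \<in> test_functions \<Longrightarrow> ((\<lambda>i. LINT y|lebesgue. H i y * \<phi> y) has_sum s) I \<Longrightarrow>
      s = (LINT y|lebesgue. (\<Sum>\<^sub>\<infinity>i\<in>I. H i y) * \<phi> y)"
proof -
  define b where "b = from_nat_into I"
  have b: "bij_betw b UNIV I" unfolding b_def using I by (rule bij_betw_from_nat_into)
  have bI: "b n \<in> I" for n using bij_betwE[OF b] by blast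
  have binj: "inj_on b A" for A by (rule inj_on_subset[OF bij_betw_imp_inj_on[OF b] subset_UNIV])
  define F where "F = (\<lambda>y. \<Sum>\<^sub>\<infinity>i\<in>I. H i y)"
  have abs: "(\<lambda>i. \<bar>H i y\<bar>) summable_on I" for y
    by (rule bdd_imp_summable_on) (rule abs_ge_zero, rule B(2))
  have sm: "(\<lambda>i. H i y) summable_on I" for y
    by (rule abs_summable_summable) (use abs[of y] in simp)
  have hs: "((\<lambda>i. H i y) has_sum F y) I" for y
    unfolding F_def using sm by (rule has_sum_infsum)
  have lim: "(\<lambda>n. \<Sum>m<n. H (b m) y) \<longlonglongrightarrow> F y" for y
  proof -
    have "((\<lambda>m. H (b m) y) has_sum F y) UNIV"
      using hs[of y] has_sum_reindex_bij_betw[OF b, of "\<lambda>i. H i y"] by simp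
    then show ?thesis using has_sum_imp_sums unfolding sums_def by blast
  qed
  have part: "\<bar>\<Sum>m<n. H (b m) y\<bar> \<le> B y" for n y
  proof -
    have "\<bar>\<Sum>m<n. H (b m) y\<bar> \<le> (\<Sum>m<n. \<bar>H (b m) y\<bar>)" by (rule sum_abs)
    also have "\<dots> = (\<Sum>i\<in>b ` {..<n}. \<bar>H i y\<bar>)" by (simp add: sum.reindex binj)
    also have "\<dots> \<le> B y" by (rule B(2)) (use bI in auto)
    finally show ?thesis .
  qed
  have FB: "\<bar>F y\<bar> \<le> B y" for y
    by (rule LIMSEQ_le_const2[OF tendsto_rabs[OF lim]]) (intro exI[of _ 0] allI impI part)
  then show "\<bar>\<Sum>\<^sub>\<infinity>i\<in>I. H i y\<bar> \<le> B y" by (simp add: F_def)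
  have Hm: "(\<lambda>y. \<Sum>m<n. H (b m) y) \<in> borel_measurable lebesgue" for n
    by (intro borel_measurable_sum H bI)
  have Fm: "F \<in> borel_measurable lebesgue"
    by (rule borel_measurable_LIMSEQ_real[OF lim Hm])
  note lB = locally_integrable_continuous[OF B(1)]
  show "locally_integrable (\<lambda>y. \<Sum>\<^sub>\<infinity>i\<in>I. H i y)"
    using locally_integrable_bound[OF Fm B(1) FB] by (simp only: F_def)
  assume \<phi>: "\<phi> \<in> test_functions" and s: "((\<lambda>i. LINT y|lebesgue. H i y * \<phi> y) has_sum s) I"
  have lH: "locally_integrable (H i)" if "i \<in> I" for i
    by (rule locally_integrable_bound[OF H[OF that] B(1)]) (use B(2)[of "{i}"] that in auto)
  have int: "(LINT y|lebesgue. (\<Sum>m<n. H (b m) y) * \<phi> y) = (\<Sum>m<n. LINT y|lebesgue. H (b m) y * \<phi> y)" for n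
    unfolding sum_distrib_right
    by (rule Bochner_Integration.integral_sum) (rule integrable_mult_test[OF lH[OF bI] \<phi>])
  have \<phi>m: "\<phi> \<in> borel_measurable lebesgue"
    by (rule borel_measurable_lebesgueI[OF test_functions_continuous[OF \<phi>]])
  have "(\<lambda>n. LINT y|lebesgue. (\<Sum>m<n. H (b m) y) * \<phi> y) \<longlonglongrightarrow> (LINT y|lebesgue. F y * \<phi> y)"
  proof (rule integral_dominated_convergence)
    show "integrable lebesgue (\<lambda>y. \<bar>B y * \<phi> y\<bar>)" by (rule integrable_abs[OF integrable_mult_test[OF lB \<phi>]])
    show "(\<lambda>y. F y * \<phi> y) \<in> borel_measurable lebesgue" by (intro borel_measurable_times Fm \<phi>m)
    show "(\<lambda>y. (\<Sum>m<n. H (b m) y) * \<phi> y) \<in> borel_measurable lebesgue" for n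
      by (intro borel_measurable_times Hm \<phi>m)
    show "AE y in lebesgue. (\<lambda>n. (\<Sum>m<n. H (b m) y) * \<phi> y) \<longlonglongrightarrow> F y * \<phi> y"
      by (intro AE_I2 tendsto_mult lim tendsto_const)
    show "AE y in lebesgue. norm ((\<Sum>m<n. H (b m) y) * \<phi> y) \<le> \<bar>B y * \<phi> y\<bar>" for n
    proof (rule AE_I2)
      fix y
      have "\<bar>\<Sum>m<n. H (b m) y\<bar> \<le> \<bar>B y\<bar>" using part[of y n] by linarith
      then show "norm ((\<Sum>m<n. H (b m) y) * \<phi> y) \<le> \<bar>B y * \<phi> y\<bar>"
        unfolding real_norm_def abs_mult by (rule mult_right_mono) simp
    qed
  qed
  moreover have "(\<lambda>n. LINT y|lebesgue. (\<Sum>m<n. H (b m) y) * \<phi> y) \<longlonglongrightarrow> s"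
  proof -
    have "((\<lambda>m. LINT y|lebesgue. H (b m) y * \<phi> y) has_sum s) UNIV"
      using s has_sum_reindex_bij_betw[OF b, of "\<lambda>i. LINT y|lebesgue. H i y * \<phi> y"] by simp
    then show ?thesis unfolding int using has_sum_imp_sums unfolding sums_def by blast
  qed
  ultimately show "s = (LINT y|lebesgue. (\<Sum>\<^sub>\<infinity>i\<in>I. H i y) * \<phi> y)"
    unfolding F_def by (rule LIMSEQ_unique[rotated])
qed

section \<open>Spectrum of singularities\<close>

text \<open>\<open>c1\<close> controls all scales, \<open>c2\<close> adds the dependence on
  \<open>x0\<close> at the fine ones. Accordingly the Taylor order is \<open>N0\<close> for j < 0
  and \<open>N\<close> for j \<ge> 0. Both orders lie below 2 M, so no correction is seen by test
  functions with vanishing moments.\<close>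

lemma pointwise_holder_of_coeffs:
  assumes lem: "lemarie_wavelets M \<theta>"
    and f: "locally_integrable f" "wavelet_expansion M \<theta> f"
    and par: "0 < u" "u < v" "0 < \<sigma>" "\<sigma> < real N0" "u \<le> real N0" "int N0 + 1 < 2 * int M - 4"
    and c1: "\<And>\<epsilon> j k. \<epsilon> \<in> wtypes \<Longrightarrow> \<bar>wcoeff M \<theta> f \<epsilon> j k\<bar> \<le> C' * 2 powr (- \<sigma> * real_of_int j)"
    and c2: "\<And>\<epsilon> j k. \<epsilon> \<in> wtypes \<Longrightarrow> 0 \<le> j \<Longrightarrow>
      \<bar>wcoeff M \<theta> f \<epsilon> j k\<bar> \<le> C' * (2 powr (- real_of_int j) + hdist (grid_pt j k) x0) powr v"
  shows "pointwise_holder f u x0"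
proof -
  obtain A \<rho> where A: "0 \<le> A" "0 < \<rho>"
    and D: "\<And>\<epsilon> w. \<epsilon> \<in> wtypes \<Longrightarrow> int (word_weight w) < 2 * int M - 4 \<Longrightarrow> iter_differentiable left_field w (mother M \<theta> \<epsilon>)"
    and Bd: "\<And>\<epsilon> w x. \<epsilon> \<in> wtypes \<Longrightarrow> int (word_weight w) < 2 * int M - 4 \<Longrightarrow>
      \<bar>iter_deriv left_field w (mother M \<theta> \<epsilon>) x\<bar> \<le> A * exp (- hnorm x / \<rho>)"
    using mother_derivatives[OF lem] by blast
  define N where "N = nat \<lceil>u\<rceil>"
  have N: "1 \<le> N" "N \<le> N0" "real N - 1 \<le> u" "u \<le> real N"
    using par(1,5) unfolding N_def by linarith+
  \<comment> \<open>The least of the three rates in \<open>wavelet_term_bound\<close>: low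
    frequencies, Taylor part, interpolated far part.\<close>
  define \<tau> where "\<tau> = min (real N0 - \<sigma>) (min (v - u) (\<sigma> * (1 - u / v)))"
  have \<tau>: "\<tau> \<le> real N0 - \<sigma>" "\<tau> \<le> v - u" "\<tau> \<le> \<sigma> * (1 - u / v)" "0 < \<tau>"
    using par by (auto simp: \<tau>_def)
  have C': "0 \<le> C'"
    using order_trans[OF abs_ge_zero c1[of 0 0 undefined]] by simp
  obtain CW where CW: "0 \<le> CW" "\<And>F X Y. finite F \<Longrightarrow> F \<subseteq> wtypes \<times> UNIV \<times> UNIV \<Longrightarrow>
    (\<Sum>(\<epsilon>, j, k)\<in>F. 2 powr (- \<tau> * \<bar>real_of_int j\<bar>) *
      (decay v \<rho> (hinv (lattice_pt k) \<star> X j) + decay v \<rho> (hinv (lattice_pt k) \<star> Y j))) \<le> CW"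
    using sum_wavelet_weights[OF A(2) \<tau>(4)] by blast
  define K where "K = C' * A * (real ((N0 + 1) ^ 3) * 3 ^ N0 * exp (4 / \<rho>) + 2 powr u)"
  have K: "0 \<le> K" unfolding K_def using C' A by (intro mult_nonneg_nonneg add_nonneg_nonneg) auto
  define I where "I = wtypes \<times> (UNIV :: int set) \<times> (UNIV :: lattice set)"
  define y0 where "y0 = (\<lambda>(j::int) k. hinv (lattice_pt k) \<star> dil (2 powi j) x0)"
  define n where "n = (\<lambda>j::int. if j < 0 then N0 else N)"
  define T where "T = (\<lambda>\<epsilon> j k y. htaylor (n j) (mother M \<theta> \<epsilon>) (y0 j k) (dil (2 powi j) (hinv x0 \<star> y)))"
  define H where "H = (\<lambda>(\<epsilon>, j, k) y. wcoeff M \<theta> f \<epsilon> j k * (wavelet M \<theta> \<epsilon> j k y - T \<epsilon> j k y))"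
  define X where "X = (\<lambda>y. hnorm (hinv x0 \<star> y))"
  define B where "B = (\<lambda>y. K * (X y powr u + X y powr real N0) * CW)"
  have T_hpoly: "T \<epsilon> j k \<in> hpoly (real (2 * M))" for \<epsilon> j k
  proof (rule hpoly_subset)
    show "T \<epsilon> j k \<in> hpoly (real (n j))"
      unfolding T_def by (rule hpoly_translate[OF hpoly_dil[OF htaylor_hpoly]])
    show "real m < real (2 * M)" if "real m < real (n j)" for m
      using that par(6) N(2) by (auto simp: n_def split: if_splits)
  qed
  have Hb: "\<bar>H (\<epsilon>, j, k) y\<bar> \<le> K * (X y powr u + X y powr real N0) *
      (2 powr (- \<tau> * \<bar>real_of_int j\<bar>) * (decay v \<rho> (y0 j k) + decay v \<rho> (hinv (lattice_pt k) \<star> dil (2 powi j) y)))"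
    if \<epsilon>: "\<epsilon> \<in> wtypes" for \<epsilon> j k y
  proof -
    let ?z = "dil (2 powi j) (hinv x0 \<star> y)"
    have p2: "2 powr real_of_int i = 2 powi i" for i :: int
      by (rule powr_real_of_int') auto
    have yz: "y0 j k \<star> ?z = hinv (lattice_pt k) \<star> dil (2 powi j) y"
      by (simp add: y0_def hmul_assoc flip: dil_hmul)
    have wv: "wavelet M \<theta> \<epsilon> j k y = mother M \<theta> \<epsilon> (y0 j k \<star> ?z)"
      using wavelet_left_translate[of M \<theta> \<epsilon> j k x0 "hinv x0 \<star> y"] by (simp add: y0_def)
    have zn: "hnorm ?z = 2 powr real_of_int j * X y"
      by (simp add: hnorm_dil X_def p2)
    have cc: "\<bar>wcoeff M \<theta> f \<epsilon> j k\<bar> \<le> C' * (2 powr (- real_of_int j) * (1 + hnorm (y0 j k))) powr v" if "0 \<le> j"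
      using c2[OF \<epsilon> that, of k] p2[of "- j"] by (simp add: hdist_grid_pt y0_def distrib_left)
    have weights: "int (word_weight w) < 2 * int M - 4" if "word_weight w \<le> N0 + 1" for w
      using that par(6) by linarith
    have "\<bar>wcoeff M \<theta> f \<epsilon> j k * (mother M \<theta> \<epsilon> (y0 j k \<star> ?z) - htaylor (if j < 0 then N0 else N) (mother M \<theta> \<epsilon>) (y0 j k) ?z)\<bar> \<le>
      C' * A * (real ((N0 + 1) ^ 3) * 3 ^ N0 * exp (4 / \<rho>) + 2 powr u) * 2 powr (- \<tau> * \<bar>real_of_int j\<bar>) *
      (X y powr u + X y powr real N0) * (decay v \<rho> (y0 j k) + decay v \<rho> (y0 j k \<star> ?z))"
      by (rule wavelet_term_bound[OF A(2,1) C' D[OF \<epsilon> weights] Bd[OF \<epsilon> weights] N par(1-4) \<tau>(1-3) c1[OF \<epsilon>] cc zn])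
        (simp_all add: X_def)
    then show ?thesis
      unfolding H_def prod.case T_def n_def wv yz K_def[symmetric] by (simp only: mult_ac)
  qed
  have I: "countable I" "infinite I"
  proof -
    show "countable I" by (simp add: I_def)
    have "UNIV \<subseteq> (fst \<circ> snd) ` I"
    proof
      fix j :: int
      have "(0, j, undefined) \<in> I" by (simp add: I_def)
      then show "j \<in> (fst \<circ> snd) ` I" by (rule image_eqI[rotated]) simp
    qed
    then show "infinite I"
      using infinite_UNIV_int finite_subset finite_imageI by blast
  qed
  have Hsum: "(\<Sum>i\<in>F. \<bar>H i y\<bar>) \<le> B y" if F: "finite F" "F \<subseteq> I" for F y
  proof -
    have "(\<Sum>i\<in>F. \<bar>H i y\<bar>) \<le> (\<Sum>i\<in>F. K * (X y powr u + X y powr real N0) * (case i of (\<epsilon>, j, k) \<Rightarrow>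
      (2 powr (- \<tau> * \<bar>real_of_int j\<bar>) * (decay v \<rho> (hinv (lattice_pt k) \<star> dil (2 powi j) x0) +
        decay v \<rho> (hinv (lattice_pt k) \<star> dil (2 powi j) y)))))"
    proof (rule sum_mono)
      fix i assume "i \<in> F"
      then have "i \<in> I" using F(2) by blast
      moreover obtain \<epsilon> j k where i: "i = (\<epsilon>, j, k)" by (cases i)
      ultimately have "\<epsilon> \<in> wtypes" by (simp add: I_def)
      with i show "\<bar>H i y\<bar> \<le> K * (X y powr u + X y powr real N0) * (case i of (\<epsilon>, j, k) \<Rightarrow>
      (2 powr (- \<tau> * \<bar>real_of_int j\<bar>) * (decay v \<rho> (hinv (lattice_pt k) \<star> dil (2 powi j) x0) +
        decay v \<rho> (hinv (lattice_pt k) \<star> dil (2 powi j) y))))"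
        using Hb[of \<epsilon> j k y] unfolding y0_def by simp
    qed
    also have "\<dots> \<le> B y"
      unfolding sum_distrib_left[symmetric] B_def
      by (intro mult_left_mono CW(2) mult_nonneg_nonneg K add_nonneg_nonneg) (use F in \<open>auto simp: I_def\<close>)
    finally show ?thesis .
  qed
  have Bcont: "continuous_on UNIV B"
    unfolding B_def X_def using par(1,5)
    by (intro continuous_intros continuous_on_powr' continuous_hnorm_translate) auto
  have Tcont: "continuous_on UNIV (T \<epsilon> j k)" for \<epsilon> j k by (rule hpoly_continuous[OF T_hpoly])
  have Hm: "H i \<in> borel_measurable lebesgue" if "i \<in> I" for i
  proof -
    obtain \<epsilon> j k where i: "i = (\<epsilon>, j, k)" "\<epsilon> \<in> wtypes" using \<open>i \<in> I\<close> by (cases i) (auto simp: I_def)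
    have "(\<lambda>y. wcoeff M \<theta> f \<epsilon> j k * (wavelet M \<theta> \<epsilon> j k y - T \<epsilon> j k y)) \<in> borel_measurable lebesgue"
      by (intro borel_measurable_times borel_measurable_const borel_measurable_diff wavelet_measurable[OF lem i(2)]
          borel_measurable_lebesgueI[OF Tcont])
    then show ?thesis by (simp add: H_def i)
  qed
  define F where "F = (\<lambda>y. \<Sum>\<^sub>\<infinity>i\<in>I. H i y)"
  have lF: "locally_integrable F" and FB: "\<And>y. \<bar>F y\<bar> \<le> B y"
    unfolding F_def using has_sum_integral_test(1,2)[where H = H and B = B and I = I, OF I Hm Bcont Hsum] by blast+
  have wl: "locally_integrable (wavelet M \<theta> \<epsilon> j k)" if \<epsilon>: "\<epsilon> \<in> wtypes" for \<epsilon> j k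
  proof (rule locally_integrable_bound[OF wavelet_measurable[OF lem \<epsilon>]])
    show "continuous_on UNIV (\<lambda>_::heis. A)" by simp
    fix y
    have "\<bar>mother M \<theta> \<epsilon> x\<bar> \<le> A" for x
    proof -
      have "\<bar>mother M \<theta> \<epsilon> x\<bar> \<le> A * exp (- hnorm x / \<rho>)"
        using Bd[OF \<epsilon>, of "[]" x] par(6) by (simp add: word_weight_def)
      also have "\<dots> \<le> A * 1" using A by (intro mult_left_mono) auto
      finally show ?thesis by simp
    qed
    then show "\<bar>wavelet M \<theta> \<epsilon> j k y\<bar> \<le> A" by (simp add: wavelet_def)
  qed
  obtain P where P: "P \<in> hpoly (real (2 * M))" "AE y in lebesgue. f y - F y = P y"
  proof -
    have "\<exists>P\<in>hpoly (real (2 * M)). AE y in lebesgue. f y - F y = P y"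
    proof (rule AE_eq_hpoly)
      show "locally_integrable (\<lambda>y. f y - F y)"
        using f(1) lF unfolding locally_integrable_def by (auto intro: set_integral_diff)
      fix \<phi> assume \<phi>: "\<phi> \<in> test_functions" and mom: "\<And>P. P \<in> hpoly (real (2 * M)) \<Longrightarrow> (LINT x|lebesgue. \<phi> x * P x) = 0"
      have "((\<lambda>(\<epsilon>, j, k). wcoeff M \<theta> f \<epsilon> j k * (LINT x|lebesgue. wavelet M \<theta> \<epsilon> j k x * \<phi> x))
           has_sum (LINT x|lebesgue. f x * \<phi> x)) I"
        using f(2) \<phi> mom unfolding wavelet_expansion_def I_def by blast
      moreover have "(LINT y|lebesgue. H i y * \<phi> y) =
          (case i of (\<epsilon>, j, k) \<Rightarrow> wcoeff M \<theta> f \<epsilon> j k * (LINT x|lebesgue. wavelet M \<theta> \<epsilon> j k x * \<phi> x))" if "i \<in> I" for i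
      proof -
        obtain \<epsilon> j k where i: "i = (\<epsilon>, j, k)" "\<epsilon> \<in> wtypes" using \<open>i \<in> I\<close> by (cases i) (auto simp: I_def)
        have z: "(LINT y|lebesgue. T \<epsilon> j k y * \<phi> y) = 0"
          using mom[OF T_hpoly[of \<epsilon> j k]] by (simp only: mult.commute)
        have "(LINT y|lebesgue. H i y * \<phi> y) =
            (LINT y|lebesgue. wcoeff M \<theta> f \<epsilon> j k * (wavelet M \<theta> \<epsilon> j k y * \<phi> y - T \<epsilon> j k y * \<phi> y))"
          by (simp add: H_def i left_diff_distrib mult.assoc)
        also have "\<dots> = wcoeff M \<theta> f \<epsilon> j k * ((LINT y|lebesgue. wavelet M \<theta> \<epsilon> j k y * \<phi> y) - (LINT y|lebesgue. T \<epsilon> j k y * \<phi> y))"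
          using integrable_mult_test[OF wl[OF i(2)] \<phi>] integrable_mult_test[OF locally_integrable_continuous[OF Tcont] \<phi>]
          by simp
        finally show ?thesis using z by (simp add: i)
      qed
      ultimately have "((\<lambda>i. LINT y|lebesgue. H i y * \<phi> y) has_sum (LINT x|lebesgue. f x * \<phi> x)) I"
        by (simp cong: has_sum_cong)
      then have "(LINT x|lebesgue. f x * \<phi> x) = (LINT y|lebesgue. F y * \<phi> y)"
        unfolding F_def by (intro has_sum_integral_test(3)[where H = H and B = B and I = I] I Hm Bcont Hsum \<phi>)
      then show "(LINT x|lebesgue. (f x - F x) * \<phi> x) = 0"
        using integrable_mult_test[OF f(1) \<phi>] integrable_mult_test[OF lF \<phi>] by (simp add: left_diff_distrib)
    qed
    then show ?thesis using that by blast
  qed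
  \<comment> \<open>\<open>P\<close> may have any degree below 2 M; its part of degree at least
    \<open>u\<close> joins the error term.\<close>
  obtain R C where R: "R \<in> hpoly u" "\<And>x. hnorm x < 1 \<Longrightarrow> \<bar>P (x0 \<star> x) - R x\<bar> \<le> C * hnorm x powr u" "0 \<le> C"
    using hpoly_truncate[OF hpoly_translate[OF P(1)] par(1)] by blast
  have "AE x in lebesgue. hnorm x < 1 \<longrightarrow> \<bar>f (x0 \<star> x) - R x\<bar> \<le> (C + 2 * K * CW + 1) * hnorm x powr u"
    using AE_left_translation[OF P(2), of x0]
  proof eventually_elim
    case (elim x)
    show ?case
    proof
      assume x: "hnorm x < 1"
      have "hnorm x powr real N0 \<le> hnorm x powr u"
      proof (cases "hnorm x = 0")
        case False
        then show ?thesis using x par(5) hnorm_nonneg[of x] by (intro powr_mono') auto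
      qed simp
      then have "B (x0 \<star> x) \<le> K * (hnorm x powr u + hnorm x powr u) * CW"
        unfolding B_def X_def using K CW(1) by (simp add: mult_left_mono mult_right_mono)
      then have "\<bar>F (x0 \<star> x)\<bar> \<le> 2 * K * CW * hnorm x powr u"
        using FB[of "x0 \<star> x"] by (simp add: mult_ac)
      moreover have "f (x0 \<star> x) - R x = F (x0 \<star> x) + (P (x0 \<star> x) - R x)" using elim by simp
      ultimately have "\<bar>f (x0 \<star> x) - R x\<bar> \<le> 2 * K * CW * hnorm x powr u + C * hnorm x powr u"
        using R(2)[OF x] abs_triangle_ineq[of "F (x0 \<star> x)" "P (x0 \<star> x) - R x"] by linarith
      also have "\<dots> \<le> (C + 2 * K * CW + 1) * hnorm x powr u"
        by (simp add: distrib_right)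
      finally show "\<bar>f (x0 \<star> x) - R x\<bar> \<le> (C + 2 * K * CW + 1) * hnorm x powr u" .
    qed
  qed
  moreover have "0 < C + 2 * K * CW + 1"
  proof -
    have "0 \<le> 2 * K * CW" using K CW(1) by simp
    with R(3) show ?thesis by linarith
  qed
  ultimately show ?thesis
    unfolding pointwise_holder_def using R(1) zero_less_one by blast
qed

lemma holder_exponent_ge:
  assumes "0 < u" "pointwise_holder f u x"
  shows "ereal u \<le> holder_exponent f x"
  unfolding holder_exponent_def using assms by (auto intro!: Sup_upper)

section \<open>Coefficient bounds from the Besov norm\<close>

lemma sum_le_ell_norm:
  assumes "a \<in> ell (ereal p) I" "1 \<le> p" "finite F" "F \<subseteq> I"
  shows "(\<Sum>i\<in>F. \<bar>a i\<bar> powr p) \<le> ell_norm (ereal p) I a powr p"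
proof -
  have sm: "(\<lambda>i. \<bar>a i\<bar> powr p) summable_on I" using assms by (simp add: ell_def)
  have "(\<Sum>i\<in>F. \<bar>a i\<bar> powr p) \<le> (\<Sum>\<^sub>\<infinity>i\<in>I. \<bar>a i\<bar> powr p)"
    by (rule finite_sum_le_infsum[OF sm assms(3,4)]) simp
  also have "\<dots> = ell_norm (ereal p) I a powr p"
    using assms(2) by (simp add: ell_norm_def powr_powr infsum_nonneg)
  finally show ?thesis .
qed

lemma ell_norm_nonneg:
  assumes "a \<in> ell p I" "i \<in> I"
  shows "0 \<le> ell_norm p I a"
proof (cases "p = \<infinity>")
  case True
  then have "bdd_above ((\<lambda>i. \<bar>a i\<bar>) ` I)" using assms(1) by (simp add: ell_def)
  from cSUP_upper[OF assms(2) this] show ?thesis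
    using True abs_ge_zero[of "a i"] by (simp add: ell_norm_def)
qed (simp add: ell_norm_def)

lemma abs_le_ell_norm:
  assumes "a \<in> ell p I" "1 \<le> p" "i \<in> I"
  shows "\<bar>a i\<bar> \<le> ell_norm p I a"
proof (cases "p = \<infinity>")
  case True
  then have "bdd_above ((\<lambda>i. \<bar>a i\<bar>) ` I)" using assms(1) by (simp add: ell_def)
  from cSUP_upper[OF assms(3) this] show ?thesis using True by (simp add: ell_norm_def)
next
  case False
  then obtain p' where p: "p = ereal p'" "1 \<le> p'" using assms(2) by (cases p) auto
  have le: "\<bar>a i\<bar> powr p' \<le> ell_norm p I a powr p'"
    using sum_le_ell_norm[of a p' I "{i}"] assms p by simp
  show ?thesis
  proof (rule ccontr)
    assume "\<not> \<bar>a i\<bar> \<le> ell_norm p I a"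
    then have "ell_norm p I a powr p' < \<bar>a i\<bar> powr p'"
      using p ell_norm_nonneg[OF assms(1,3)] by (intro powr_less_mono2) auto
    with le show False by simp
  qed
qed

text \<open>A sequence in the outer space is bounded, so one constant \<open>A\<close> bounds the
  inner norms at all scales. The inner norm in turn dominates each single coefficient and, for
  finite p, the sum of p-th powers.\<close>

lemma besov_coeff_bounds:
  assumes f: "f \<in> besov M \<theta> s p q" and pq: "1 \<le> p" "1 \<le> q" and \<sigma>: "\<sigma> = s - real_of_ereal (4 / p)"
  obtains A where "0 \<le> A"
    "\<And>\<epsilon> j k. \<epsilon> \<in> wtypes \<Longrightarrow> \<bar>wcoeff M \<theta> f \<epsilon> j k\<bar> \<le> A * 2 powr (- \<sigma> * real_of_int j)"
    "\<And>p' j F. p = ereal p' \<Longrightarrow> finite F \<Longrightarrow> F \<subseteq> UNIV \<times> wtypes \<Longrightarrow>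
      (\<Sum>(k, \<epsilon>)\<in>F. \<bar>wcoeff M \<theta> f \<epsilon> j k\<bar> powr p') \<le> A powr p' * 2 powr (- \<sigma> * p' * real_of_int j)"
proof -
  define a where "a = (\<lambda>j. ell_norm p (UNIV \<times> wtypes) (scale_coeffs M \<theta> s p f j))"
  have sc: "scale_coeffs M \<theta> s p f j \<in> ell p (UNIV \<times> wtypes)" for j
    using f unfolding besov_def by blast
  have aq: "a \<in> ell q UNIV" using f unfolding besov_def a_def by blast
  define A where "A = ell_norm q UNIV a"
  have A: "a j \<le> A" "0 \<le> A" for j
    using abs_le_ell_norm[OF aq pq(2), of j] ell_norm_nonneg[OF aq UNIV_I] unfolding A_def by auto
  have a0: "0 \<le> a j" for j
  proof -
    have "(undefined, 0) \<in> UNIV \<times> wtypes" by simp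
    then show ?thesis unfolding a_def by (rule ell_norm_nonneg[OF sc])
  qed
  define E where "E = (\<lambda>j::int. 2 powr (\<sigma> * real_of_int j))"
  have E: "0 < E j" "2 powr (- \<sigma> * real_of_int j) = 1 / E j" for j
    by (simp_all add: E_def powr_minus_divide)
  have scale: "\<bar>scale_coeffs M \<theta> s p f j (k, \<epsilon>)\<bar> = E j * \<bar>wcoeff M \<theta> f \<epsilon> j k\<bar>" for j k \<epsilon>
    by (simp add: scale_coeffs_def E_def \<sigma> abs_mult mult.commute)
  show ?thesis
  proof (rule that[OF A(2)])
    fix \<epsilon> j and k :: lattice assume "\<epsilon> \<in> wtypes"
    then have "(k, \<epsilon>) \<in> UNIV \<times> wtypes" by simp
    from abs_le_ell_norm[OF sc pq(1) this, of j] have "E j * \<bar>wcoeff M \<theta> f \<epsilon> j k\<bar> \<le> A"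
      using A(1)[of j] unfolding scale a_def by linarith
    then show "\<bar>wcoeff M \<theta> f \<epsilon> j k\<bar> \<le> A * 2 powr (- \<sigma> * real_of_int j)"
      unfolding E(2) using E(1)[of j] by (simp add: field_simps)
  next
    fix p' j and F :: "(lattice \<times> nat) set" assume p': "p = ereal p'" and F: "finite F" "F \<subseteq> UNIV \<times> wtypes"
    have p1: "1 \<le> p'" using pq(1) p' by simp
    have "(\<Sum>i\<in>F. \<bar>scale_coeffs M \<theta> s p f j i\<bar> powr p') \<le> a j powr p'"
      unfolding a_def p' by (rule sum_le_ell_norm[OF sc[unfolded p'] p1 F])
    also have "\<dots> \<le> A powr p'"
      using a0 A p1 by (intro powr_mono2) auto
    finally have "(\<Sum>i\<in>F. \<bar>scale_coeffs M \<theta> s p f j i\<bar> powr p') \<le> A powr p'" .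
    moreover have "(\<Sum>i\<in>F. \<bar>scale_coeffs M \<theta> s p f j i\<bar> powr p') = E j powr p' * (\<Sum>(k, \<epsilon>)\<in>F. \<bar>wcoeff M \<theta> f \<epsilon> j k\<bar> powr p')"
      unfolding sum_distrib_left
      by (rule sum.cong) (use E(1)[of j] in \<open>auto simp: scale powr_mult\<close>)
    ultimately have le: "E j powr p' * (\<Sum>(k, \<epsilon>)\<in>F. \<bar>wcoeff M \<theta> f \<epsilon> j k\<bar> powr p') \<le> A powr p'" by simp
    have eq: "2 powr (- \<sigma> * p' * real_of_int j) = 1 / E j powr p'"
      by (simp add: E_def powr_powr powr_minus_divide mult_ac)
    have "0 < E j powr p'" using E(1)[of j] by simp
    then show "(\<Sum>(k, \<epsilon>)\<in>F. \<bar>wcoeff M \<theta> f \<epsilon> j k\<bar> powr p') \<le> A powr p' * 2 powr (- \<sigma> * p' * real_of_int j)"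
      unfolding eq using le by (simp add: pos_le_divide_eq mult.commute)
  qed
qed

text \<open>A point outside of the limsup of the balls \<open>B(x\<^bsub>j,k\<^esub>, |d\<^bsub>j,k\<^esub>|\<^bsup>1/v\<^esup>)\<close> satisfies the coefficient
  bound of \<open>pointwise_holder_of_coeffs\<close>.\<close>

definition large_coeffs ::
  "nat \<Rightarrow> (nat \<Rightarrow> heis \<Rightarrow> real) \<Rightarrow> (heis \<Rightarrow> real) \<Rightarrow> real \<Rightarrow> nat \<Rightarrow> (lattice \<times> nat) set"
  where "large_coeffs M \<theta> f v j = {(k, \<epsilon>). \<epsilon> \<in> wtypes \<and> 2 powr (- v * real j) < \<bar>wcoeff M \<theta> f \<epsilon> (int j) k\<bar>}"

text \<open>With radii |d|^(1/v) the covering sum involves |d|^b, where b = t / v. The p-th power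
  sum at scale j is known, and the factor |d|^(b - p) is bounded by one of two means, depending on
  its sign. Either way a gain 2^(-\<tau> j) remains.\<close>

lemma hausdorff_measure_irregular_points:
  assumes v: "0 < v" and t: "0 < t" "p * (v - \<sigma>) < t" and par: "0 < \<sigma>" "1 \<le> p" "0 \<le> A"
    and c1: "\<And>\<epsilon> j k. \<epsilon> \<in> wtypes \<Longrightarrow> \<bar>wcoeff M \<theta> f \<epsilon> j k\<bar> \<le> A * 2 powr (- \<sigma> * real_of_int j)"
    and cp: "\<And>j F. finite F \<Longrightarrow> F \<subseteq> UNIV \<times> wtypes \<Longrightarrow>
      (\<Sum>(k, \<epsilon>)\<in>F. \<bar>wcoeff M \<theta> f \<epsilon> j k\<bar> powr p) \<le> A powr p * 2 powr (- \<sigma> * p * real_of_int j)"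
    and E: "\<And>x C. x \<in> E \<Longrightarrow> \<exists>\<epsilon>\<in>wtypes. \<exists>j\<ge>0. \<exists>k.
      C * (2 powr (- real_of_int j) + hdist (grid_pt j k) x) powr v < \<bar>wcoeff M \<theta> f \<epsilon> j k\<bar>"
  shows "hausdorff_measure t E = 0"
proof -
  define d where "d = (\<lambda>(j::nat) (k, \<epsilon>). \<bar>wcoeff M \<theta> f \<epsilon> (int j) k\<bar>)"
  define L where "L = large_coeffs M \<theta> f v"
  have L: "2 powr (- v * real j) < d j i" "snd i \<in> wtypes" "0 < d j i" if "i \<in> L j" for i j
    using that less_trans[of 0 "2 powr (- v * real j)" "d j i"] by (auto simp: L_def large_coeffs_def d_def)
  define b where "b = t / v"
  have b: "0 < b" "b * v = t" using t v by (auto simp: b_def)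
  obtain \<tau> K where \<tau>: "0 < \<tau>" "0 \<le> K" and db: "\<And>i j. i \<in> L j \<Longrightarrow> d j i powr b \<le> K * 2 powr ((\<sigma> * p - \<tau>) * real j) * d j i powr p"
  proof (cases "p \<le> b")
    case True
    show ?thesis
    \<comment> \<open>Nonnegative excess exponent: \<open>c1\<close> bounds the coefficient from
      above.\<close>
    proof (rule that[of "\<sigma> * b" "A powr (b - p)"])
      fix i j assume i: "i \<in> L j"
      have "d j i powr b = d j i powr (b - p) * d j i powr p" by (simp add: powr_add[symmetric])
      also have "d j i powr (b - p) \<le> (A * 2 powr (- \<sigma> * real j)) powr (b - p)"
        using c1[of "snd i" "int j" "fst i"] L[OF i] True by (intro powr_mono2) (auto simp: d_def case_prod_unfold)
      also have "\<dots> = A powr (b - p) * 2 powr ((\<sigma> * p - \<sigma> * b) * real j)"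
        using par by (simp add: powr_mult powr_powr algebra_simps)
      finally show "d j i powr b \<le> A powr (b - p) * 2 powr ((\<sigma> * p - \<sigma> * b) * real j) * d j i powr p"
        by (simp add: mult_right_mono)
    qed (use par b in auto)
  next
    case False
    show ?thesis
    \<comment> \<open>Negative excess exponent: the threshold 2^(-v j) bounds the coefficient from
      below, and the hypothesis p (v - \<sigma>) < t is exactly the positivity of the gain.\<close>
    proof (rule that[of "t - p * (v - \<sigma>)" 1])
      fix i j assume i: "i \<in> L j"
      have "d j i powr b = d j i powr (b - p) * d j i powr p" by (simp add: powr_add[symmetric])
      also have "d j i powr (b - p) \<le> (2 powr (- v * real j)) powr (b - p)"
        using L[OF i] False by (intro powr_mono2') auto
      also have "\<dots> = 2 powr ((\<sigma> * p - (t - p * (v - \<sigma>))) * real j)"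
        unfolding powr_powr b(2)[symmetric] by (simp add: algebra_simps)
      finally show "d j i powr b \<le> 1 * 2 powr ((\<sigma> * p - (t - p * (v - \<sigma>))) * real j) * d j i powr p"
        by (simp add: mult_right_mono)
    qed (use t in auto)
  qed
  define I where "I = Sigma UNIV L"
  have sm: "(\<lambda>(j, i). d j i powr b) summable_on I"
    unfolding I_def
  proof (rule summable_on_Sigma_nat)
    fix j F assume F: "finite F" "F \<subseteq> L j"
    have F': "F \<subseteq> UNIV \<times> wtypes" using F(2) L(2) by force
    have "(\<Sum>i\<in>F. d j i powr b) \<le> (\<Sum>i\<in>F. K * 2 powr ((\<sigma> * p - \<tau>) * real j) * d j i powr p)"
      by (intro sum_mono db) (use F in auto)
    also have "\<dots> = K * 2 powr ((\<sigma> * p - \<tau>) * real j) * (\<Sum>(k, \<epsilon>)\<in>F. \<bar>wcoeff M \<theta> f \<epsilon> (int j) k\<bar> powr p)"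
      unfolding sum_distrib_left[symmetric] by (simp add: d_def case_prod_unfold)
    also have "\<dots> \<le> K * 2 powr ((\<sigma> * p - \<tau>) * real j) * (A powr p * 2 powr (- \<sigma> * p * real_of_int (int j)))"
      using \<tau> by (intro mult_left_mono cp F F') auto
    also have "\<dots> = K * A powr p * (2 powr ((\<sigma> * p - \<tau>) * real j) * 2 powr (- \<sigma> * p * real j))"
      by (simp only: mult_ac of_int_of_nat_eq)
    also have "\<dots> = K * A powr p * (2 powr (- \<tau>)) ^ j"
      by (simp add: powr_add[symmetric] powr_realpow[symmetric] powr_powr algebra_simps)
    finally show "(\<Sum>i\<in>F. d j i powr b) \<le> K * A powr p * (2 powr (- \<tau>)) ^ j" .
  next
    have "2 powr (- \<tau>) < 1" using \<tau> powr_less_mono[of "- \<tau>" 0 2] by simp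
    then show "summable (\<lambda>j. K * A powr p * (2 powr (- \<tau>)) ^ j)"
      by (intro summable_mult summable_geometric) simp
  qed auto
  define c where "c = (\<lambda>(j, i :: lattice \<times> nat). grid_pt (int j) (fst i))"
  define r where "r = (\<lambda>(j, i). d j i powr (1 / v))"
  show ?thesis
  proof (rule hausdorff_measure_limsup[OF t(1), of I r E c])
    show "countable I" by simp
    show "0 < r i" if "i \<in> I" for i
      using that L(3) by (force simp: r_def I_def)
    show "(\<lambda>i. r i powr t) summable_on I"
      using sm by (simp add: r_def case_prod_unfold powr_powr b_def)
    fix x assume x: "x \<in> E"
    define J where "J = {i \<in> I. x \<in> gauge_ball (c i) (r i)}"
    define D where "D = (\<lambda>(j, k, \<epsilon> :: nat). (2 powr (- real j) + hdist (grid_pt (int j) k) x) powr v)"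
    have Dpos: "0 < D i" for i
    proof -
      have "0 < 2 powr (- real (fst i)) + hdist (grid_pt (int (fst i)) (fst (snd i))) x"
        by (intro add_pos_nonneg) (auto simp: hdist_def)
      then show ?thesis by (simp add: D_def case_prod_unfold)
    qed
    have inJ: "(j, k, \<epsilon>) \<in> J" if \<epsilon>: "\<epsilon> \<in> wtypes" and big: "D (j, k, \<epsilon>) < d j (k, \<epsilon>)" for j k \<epsilon>
    proof -
      let ?h = "hdist (grid_pt (int j) k) x"
      have h: "0 \<le> ?h" by (simp add: hdist_def)
      have "2 powr (- v * real j) = (2 powr (- real j)) powr v" by (simp add: powr_powr mult.commute)
      also have "\<dots> \<le> D (j, k, \<epsilon>)" unfolding D_def prod.case using h v by (intro powr_mono2) auto
      finally have "2 powr (- v * real j) < d j (k, \<epsilon>)" using big by linarith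
      then have "(j, k, \<epsilon>) \<in> I" using \<epsilon> by (simp add: I_def L_def large_coeffs_def d_def)
      moreover have "?h < d j (k, \<epsilon>) powr (1 / v)"
      proof -
        have "?h powr v \<le> D (j, k, \<epsilon>)" unfolding D_def prod.case using h v by (intro powr_mono2) auto
        then have "?h powr v < d j (k, \<epsilon>)" using big by linarith
        then have "(?h powr v) powr (1 / v) < d j (k, \<epsilon>) powr (1 / v)"
          using v by (intro powr_less_mono2) auto
        then show ?thesis using v h by (simp add: powr_powr)
      qed
      ultimately show ?thesis by (simp add: J_def gauge_ball_def c_def r_def)
    qed
    show "infinite {i \<in> I. x \<in> gauge_ball (c i) (r i)}"
    proof
      assume "finite {i \<in> I. x \<in> gauge_ball (c i) (r i)}"
      then have fin: "finite J" by (simp add: J_def)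
      \<comment> \<open>If only finitely many balls contained \<open>x\<close>, this constant would
        be at least each of their ratios \<open>d\<close> / \<open>D\<close>. A violation with
        constant \<open>C\<close> is also one with constant 1, so it belongs to \<open>J\<close>,
        where its ratio cannot exceed \<open>C\<close>.\<close>
      define C where "C = 1 + (\<Sum>i\<in>J. d (fst i) (snd i) / D i)"
      have q: "0 \<le> d (fst i) (snd i) / D i" for i
        using Dpos[of i] by (auto simp: d_def case_prod_unfold)
      have C1: "1 \<le> C" using sum_nonneg[of J "\<lambda>i. d (fst i) (snd i) / D i"] q by (simp add: C_def)
      obtain \<epsilon> j k where e: "\<epsilon> \<in> wtypes" "0 \<le> j"
        "C * (2 powr (- real_of_int j) + hdist (grid_pt j k) x) powr v < \<bar>wcoeff M \<theta> f \<epsilon> j k\<bar>"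
        using E[OF x, of C] by blast
      define m where "m = nat j"
      have j: "j = int m" using e(2) by (simp add: m_def)
      have CD: "C * D (m, k, \<epsilon>) < d m (k, \<epsilon>)" using e(3) by (simp add: D_def d_def j)
      moreover have "D (m, k, \<epsilon>) \<le> C * D (m, k, \<epsilon>)"
        using mult_right_mono[OF C1, of "D (m, k, \<epsilon>)"] Dpos[of "(m, k, \<epsilon>)"] by simp
      ultimately have "(m, k, \<epsilon>) \<in> J" by (intro inJ e(1)) linarith
      then have "d m (k, \<epsilon>) / D (m, k, \<epsilon>) \<le> C"
        using member_le_sum[of "(m, k, \<epsilon>)" J "\<lambda>i. d (fst i) (snd i) / D i"] fin q by (simp add: C_def)
      then show False using CD Dpos[of "(m, k, \<epsilon>)"] by (simp add: field_simps)
    qed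
  qed
qed

theorem theorem4:
  fixes M :: nat and \<theta> :: "nat \<Rightarrow> heis \<Rightarrow> real"
    and s :: real and p q :: ereal and f :: "heis \<Rightarrow> real"
  assumes "lemarie_wavelets M \<theta>"
    and "\<lfloor>s\<rfloor> + 2 < 2 * int M - hdim"
    and "1 \<le> p" and "1 \<le> q"
    and "ereal s > hdim / p"
    and "f \<in> besov M \<theta> s p q"
  shows "(\<forall>h. h \<ge> ereal s - hdim / p \<longrightarrow> spectrum f h \<le> spectrum_bound s p h) \<and>
         (\<forall>h. 0 \<le> h \<and> h < ereal s - hdim / p \<longrightarrow> spectrum f h = - \<infinity> \<and> iso_holder f h = {})"
proof -
  define \<sigma> where "\<sigma> = s - real_of_ereal (hdim / p)"
  have \<sigma>: "ereal s - hdim / p = ereal \<sigma>" "0 < \<sigma>" "\<sigma> \<le> s"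
    using assms(3,5) by (cases p; auto simp: \<sigma>_def)+
  obtain A where A: "0 \<le> A"
    and c1: "\<And>\<epsilon> j k. \<epsilon> \<in> wtypes \<Longrightarrow> \<bar>wcoeff M \<theta> f \<epsilon> j k\<bar> \<le> A * 2 powr (- \<sigma> * real_of_int j)"
    and cp: "\<And>p' j F. p = ereal p' \<Longrightarrow> finite F \<Longrightarrow> F \<subseteq> UNIV \<times> wtypes \<Longrightarrow>
      (\<Sum>(k, \<epsilon>)\<in>F. \<bar>wcoeff M \<theta> f \<epsilon> j k\<bar> powr p') \<le> A powr p' * 2 powr (- \<sigma> * p' * real_of_int j)"
    using besov_coeff_bounds[OF assms(6,3,4) \<sigma>_def] by blast
  have f: "locally_integrable f" "wavelet_expansion M \<theta> f"
    using assms(6) by (auto simp: besov_def locally_integrable_def)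
  \<comment> \<open>The least natural number above \<open>s\<close>; the assumption on
    \<open>M\<close> says that derivatives of weight \<open>N0\<close> + 1 of the mother wavelets
    are still controlled.\<close>
  define N0 where "N0 = nat (\<lfloor>s\<rfloor> + 1)"
  have N0: "s < real N0" "int N0 + 1 < 2 * int M - 4"
    using assms(2) \<sigma> unfolding N0_def by linarith+
  have regular: "pointwise_holder f u x"
    if "0 < u" "u < v" "v \<le> s" "A \<le> C"
      and "\<And>\<epsilon> j k. \<epsilon> \<in> wtypes \<Longrightarrow> 0 \<le> j \<Longrightarrow>
        \<bar>wcoeff M \<theta> f \<epsilon> j k\<bar> \<le> C * (2 powr (- real_of_int j) + hdist (grid_pt j k) x) powr v"
    for u v x C
  proof (rule pointwise_holder_of_coeffs[OF assms(1) f that(1,2) \<sigma>(2) _ _ N0(2), where C' = C])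
    fix \<epsilon> j k assume "\<epsilon> \<in> wtypes"
    then show "\<bar>wcoeff M \<theta> f \<epsilon> j k\<bar> \<le> C * 2 powr (- \<sigma> * real_of_int j)"
      using order_trans[OF c1 mult_right_mono[OF that(4)]] by simp
  qed (use that \<sigma> N0 in auto)
  have uniform: "iso_holder f h = {}" if h: "0 \<le> h" "h < ereal \<sigma>" for h
  proof (rule equals0I)
    fix x assume "x \<in> iso_holder f h"
    then have hx: "holder_exponent f x = h" by (simp add: iso_holder_def)
    obtain h' where h': "h = ereal h'" "0 \<le> h'" "h' < \<sigma>" using h by (cases h) auto
    \<comment> \<open>Two orders strictly between h' and \<sigma>: the uniform decay 2^(-\<sigma> j)
      implies the bound of order \<open>v\<close> at every point, hence regularity \<open>u\<close>
      above the supposed exponent.\<close>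
    define u v where "u = (2 * h' + \<sigma>) / 3" and "v = (h' + 2 * \<sigma>) / 3"
    have uv: "h' < u" "u < v" "v < \<sigma>" using h' by (auto simp: u_def v_def)
    have "pointwise_holder f u x"
    proof (rule regular)
      fix \<epsilon> and j :: int and k assume \<epsilon>: "\<epsilon> \<in> wtypes" and j: "0 \<le> j"
      have "2 powr (- \<sigma> * real_of_int j) \<le> (2 powr (- real_of_int j)) powr v"
        unfolding powr_powr using mult_right_mono[of v \<sigma> "real_of_int j"] uv j by (intro powr_mono) (auto simp: mult.commute)
      also have "\<dots> \<le> (2 powr (- real_of_int j) + hdist (grid_pt j k) x) powr v"
        using uv h' by (intro powr_mono2) (auto simp: hdist_def)
      finally show "\<bar>wcoeff M \<theta> f \<epsilon> j k\<bar> \<le> A * (2 powr (- real_of_int j) + hdist (grid_pt j k) x) powr v"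
        using c1[OF \<epsilon>, of j k] A by (meson mult_left_mono order_trans)
    qed (use uv h' \<sigma> in auto)
    then have "ereal u \<le> h" using holder_exponent_ge[of u f x] uv h' hx by auto
    then show False using uv h' by simp
  qed
  have le4: "spectrum f h \<le> 4" for h
    unfolding spectrum_def by (rule hausdorff_dim_le_hdim)
  have upper: "spectrum f h \<le> spectrum_bound s p h" if h: "ereal \<sigma> \<le> h" for h
  proof (cases "p = \<infinity>")
    case True
    then show ?thesis using le4 by (simp add: spectrum_bound_def)
  next
    case False
    then obtain p' where p': "p = ereal p'" "1 \<le> p'" using assms(3) by (cases p) auto
    have \<sigma>': "\<sigma> = s - 4 / p'" using p' by (simp add: \<sigma>_def)
    have "spectrum f h \<le> p * (h - ereal s + 4 / p)"
    proof (cases "h < ereal s")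
      case False
      \<comment> \<open>For h \<ge> s the right-hand side is at least Q, so the dimension of the
        group suffices.\<close>
      have "4 \<le> p * (h - ereal s + 4 / p)"
      proof (cases h)
        case (real h')
        then have "4 \<le> p' * (h' - s + 4 / p')"
          using False p' by (simp add: distrib_left)
        then show ?thesis using real p' by simp
      qed (use False p' in auto)
      then show ?thesis using le4[of h] by (rule order_trans[rotated])
    next
      case True
      then obtain h' where h': "h = ereal h'" "\<sigma> \<le> h'" "h' < s" using h by (cases h) auto
      have "spectrum f h \<le> ereal (p' * (h' - \<sigma>))"
      proof (rule ereal_le_epsilon2)
        fix e :: real assume e: "0 < e"
        define t where "t = p' * (h' - \<sigma>) + e"
        \<comment> \<open>The first term of the minimum keeps p' (v - \<sigma>) below
          \<open>t\<close> by e / 2; the second keeps \<open>v\<close> below \<open>s\<close>,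
          within the reach of order \<open>N0\<close>.\<close>
        define v where "v = h' + min (e / (2 * p')) ((s - h') / 2)"
        define u where "u = (h' + v) / 2"
        have v: "h' < v" "v < s" using e p' h' by (auto simp: v_def min_def field_simps)
        have uv: "h' < u" "u < v" using v by (auto simp: u_def)
        have "v - \<sigma> \<le> (h' - \<sigma>) + e / (2 * p')" by (simp add: v_def)
        then have "p' * (v - \<sigma>) \<le> p' * (h' - \<sigma>) + p' * (e / (2 * p'))"
          unfolding distrib_left[symmetric] using p'(2) by (intro mult_left_mono) auto
        also have "p' * (e / (2 * p')) = e / 2" using p' by simp
        finally have tv: "p' * (v - \<sigma>) < t" using e by (simp add: t_def)
        have t0: "0 < t" unfolding t_def using p' h' e by (intro add_nonneg_pos mult_nonneg_nonneg) auto
        have "hausdorff_measure t (iso_holder f h) = 0"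
        proof (rule hausdorff_measure_irregular_points[OF _ t0 tv \<sigma>(2) p'(2) A c1 cp[OF p'(1)]])
          show "0 < v" using v h' \<sigma> by simp
          fix x C assume "x \<in> iso_holder f h"
          then have hx: "holder_exponent f x = h" by (simp add: iso_holder_def)
          \<comment> \<open>Since u > h', regularity \<open>u\<close> would contradict the exponent
            of \<open>x\<close>. Hence the coefficient bound of order v > u fails at
            \<open>x\<close> for every constant.\<close>
          have not: "\<not> pointwise_holder f u x"
            using holder_exponent_ge[of u f x] hx h' uv \<sigma> by auto
          show "\<exists>\<epsilon>\<in>wtypes. \<exists>j\<ge>0. \<exists>k. C * (2 powr (- real_of_int j) + hdist (grid_pt j k) x) powr v < \<bar>wcoeff M \<theta> f \<epsilon> j k\<bar>"
          proof (rule ccontr)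
            assume "\<not> ?thesis"
            then have C: "\<And>\<epsilon> j k. \<epsilon> \<in> wtypes \<Longrightarrow> 0 \<le> j \<Longrightarrow>
              \<bar>wcoeff M \<theta> f \<epsilon> j k\<bar> \<le> C * (2 powr (- real_of_int j) + hdist (grid_pt j k) x) powr v"
              by (meson not_less)
            have "pointwise_holder f u x"
            proof (rule regular[where C = "max A C" and v = v])
              fix \<epsilon> and j :: int and k assume "\<epsilon> \<in> wtypes" "0 \<le> j"
              from C[OF this, of k]
              show "\<bar>wcoeff M \<theta> f \<epsilon> j k\<bar> \<le> max A C * (2 powr (- real_of_int j) + hdist (grid_pt j k) x) powr v"
                by (rule order_trans) (intro mult_right_mono, auto)
            qed (use uv v h' \<sigma> in auto)
            with not show False by simp
          qed
        qed
        then have "spectrum f h \<le> ereal t"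
          unfolding spectrum_def using t0 by (intro hausdorff_dim_le) auto
        then show "spectrum f h \<le> ereal (p' * (h' - \<sigma>)) + ereal e"
          by (simp add: t_def)
      qed
      also have "ereal (p' * (h' - \<sigma>)) = p * (h - ereal s + 4 / p)"
        using p' h' by (simp add: \<sigma>')
      finally show ?thesis .
    qed
    then show ?thesis using le4[of h] False by (simp add: spectrum_bound_def)
  qed
  have "spectrum f h = - \<infinity>" if "iso_holder f h = {}" for h
    using that by (simp add: spectrum_def hausdorff_dim_def)
  then show ?thesis
    unfolding \<sigma>(1) using upper uniform by blast
qed

end
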